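(* Let $n\ge 3$ be odd and let $P=(p,q)\in(\mathbb{Z}/n\mathbb{Z})^2$ be an $n$-torsion point of $E_{-1}$ such that $P$ and $P_1=\bar c(P)=(-q,p)$ are in general position, i.e. the matrix $\begin{pmatrix} p & -q \\ q & p \end{pmatrix}$ is invertible over $\mathbb{Z}/n\mathbb{Z}$. Then \begin{align*} \Gamma(D_P)=\;&\{A\in \mathrm{SL}_2(\mathbb{Z}) \mid A\equiv\pm\begin{pmatrix} 1 & 0 \\ 0 & 1 \end{pmatrix}\text{ or }A\equiv\pm\begin{pmatrix} 0 & -1 \\ 1 & 0 \end{pmatrix} \bmod n\}\\ &\cap\;\{A\in \mathrm{SL}_2(\mathbb{Z}) \mid A\equiv\pm\begin{pmatrix} 1 & 0 \\ 0 & 1 \end{pmatrix}\text{ or }A\equiv\pm\begin{pmatrix} 0 & -1 \\ 1 & 0 \end{pmatrix} \bmod 2\}\\ =\;&\{A=\begin{pmatrix} a & b \\ c & d \end{pmatrix}\in \mathrm{SL}_2(\mathbb{Z}) \mid a+c\text{ and }b+d\text{ are odd, and } (A\equiv\pm\begin{pmatrix} 1 & 0 \\ 0 & 1 \end{pmatrix}\text{ or }A\equiv\pm\begin{pmatrix} 0 & -1 \\ 1 & 0 \end{pmatrix} \bmod n)\}. \end{align*}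
   Context: Let $E_{-1}$ be the torus $\mathbb{R}^2/(n\mathbb{Z})^2$ (a square torus, with $\mathbb{R}^2=\mathbb{C}$, so that the elliptic curve is $y^2=x^3-x$), with origin $O=(0,0)$; its $n$-torsion points are $\mathbb{Z}^2/(n\mathbb{Z})^2=(\mathbb{Z}/n\mathbb{Z})^2$. Let $\bar c:(x,y)\mapsto(-y,x)$ be the rotation by $\pi/2$; its fixed points are $O$ and $M=(\frac n2,\frac n2)$. For an $n$-torsion point $P=(p,q)$ with $2P\ne0$, let $S=\{(p,q),(-q,p),(-p,-q),(q,-p)\}$ be its orbit under $\bar c$. Let $\kappa:X\to E_{-1}$ be the degree $2$ covering ramified exactly over $S$ such that $\bar c$ lifts to an automorphism $c$ of $X$ for which $\tau=c^2$ has exactly four fixed points, namely the preimages of $O$ and $M$ (these properties determine $\kappa$ up to isomorphism). The origami $D_P$ is the covering $\mathrm{pr}\circ\kappa:X\to\mathbb{R}^2/\mathbb{Z}^2$ of degree $2n^2$, where $\mathrm{pr}:\mathbb{R}^2/(n\mathbb{Z})^2\to\mathbb{R}^2/\mathbb{Z}^2$ is the natural projection (up to rescaling this is $[n]\circ\kappa$, $[n]$ being multiplication by $n$); it is ramified only over $\infty:=0$. Let $X^*$ be the complement of the preimage of $\infty$ in $X$, with the translation structure $\mu$ lifted from $\mathbb{R}^2/\mathbb{Z}^2$. A diffeomorphism of $X^*$ is affine if in the charts of $\mu$ it has the form $z\mapsto Az+b$ with $A\in \mathrm{GL}_2(\mathbb{R})$; the matrix $A$, its derivative, is independent of the charts.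 The Veech group $\Gamma(D_P)$ is the group of derivatives of orientation preserving affine diffeomorphisms of $(X^*,\mu)$; it is a finite index subgroup of $\mathrm{SL}_2(\mathbb{Z})$. *)

theory Defs
  imports "HOL-Analysis.Analysis" "HOL-Number_Theory.Cong"
begin

text \<open>Points of the torus are the cosets of the lattice \<open>(mZ)^2\<close> in the plane.\<close>

definition coset :: "nat \<Rightarrow> real^2 \<Rightarrow> (real^2) set" where
  "coset m z = {z + real m *\<^sub>R v | v. \<forall>i. v $ i \<in> \<int>}"

definition torus :: "nat \<Rightarrow> (real^2) set topology" where
  "torus m = topology (\<lambda>U. U \<subseteq> range (coset m) \<and> open (coset m -` U))"

lemma openin_torus: "openin (torus m) U \<longleftrightarrow> U \<subseteq> range (coset m) \<and> open (coset m -` U)"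
proof -
  have "istopology (\<lambda>U. U \<subseteq> range (coset m) \<and> open (coset m -` U))"
    unfolding istopology_def by (simp add: vimage_Union open_Int open_UN le_infI1 Sup_le_iff)
  then show ?thesis
    unfolding torus_def by simp
qed

lemma topspace_torus: "topspace (torus m) = range (coset m)"
proof -
  have "openin (torus m) (range (coset m))"
    unfolding openin_torus by (simp add: vimage_def)
  moreover have "U \<subseteq> range (coset m)" if "openin (torus m) U" for U
    using that unfolding openin_torus by simp
  ultimately show ?thesis
    by (metis openin_subset openin_topspace subset_antisym)
qed

lemma quotient_map_coset: "quotient_map euclidean (torus m) (coset m)"
  by (simp add: quotient_map_def topspace_torus openin_torus vimage_def)

lemma coset_eq_iff:
  "coset m z = coset m w \<longleftrightarrow> (\<exists>v. (\<forall>i. v $ i \<in> \<int>) \<and> w = z + real m *\<^sub>R v)"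
proof
  assume eq: "coset m z = coset m w"
  have "w \<in> coset m w"
    by (auto simp: coset_def intro!: exI[of _ 0])
  then show "\<exists>v. (\<forall>i. v $ i \<in> \<int>) \<and> w = z + real m *\<^sub>R v"
    unfolding eq[symmetric] by (auto simp: coset_def)
next
  assume "\<exists>v. (\<forall>i. v $ i \<in> \<int>) \<and> w = z + real m *\<^sub>R v"
  then obtain v where v: "\<forall>i. v $ i \<in> \<int>" "w = z + real m *\<^sub>R v"
    by blast
  show "coset m z = coset m w"
  proof (intro set_eqI iffI)
    fix x assume "x \<in> coset m z"
    then obtain u where u: "\<forall>i. u $ i \<in> \<int>" "x = z + real m *\<^sub>R u"
      by (auto simp: coset_def)
    with v have "x = w + real m *\<^sub>R (u - v)" "\<forall>i. (u - v) $ i \<in> \<int>"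
      by (auto simp: algebra_simps)
    then show "x \<in> coset m w"
      unfolding coset_def by blast
  next
    fix x assume "x \<in> coset m w"
    then obtain u where u: "\<forall>i. u $ i \<in> \<int>" "x = w + real m *\<^sub>R u"
      by (auto simp: coset_def)
    with v have "x = z + real m *\<^sub>R (u + v)" "\<forall>i. (u + v) $ i \<in> \<int>"
      by (auto simp: algebra_simps)
    then show "x \<in> coset m z"
      unfolding coset_def by blast
  qed
qed

text \<open>The projection from \<open>R^2/(nZ)^2\<close> to \<open>R^2/Z^2\<close> sends a coset of \<open>(nZ)^2\<close> to the
  coset of \<open>Z^2\<close> containing it.\<close>

definition pr :: "(real^2) set \<Rightarrow> (real^2) set" where
  "pr C = (\<Union>z\<in>C. coset 1 z)"

lemma pr_coset: "pr (coset n z) = coset 1 z"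
proof -
  have "coset 1 w = coset 1 z" if w: "w \<in> coset n z" for w
  proof -
    obtain v where v: "\<forall>i. v $ i \<in> \<int>" "w = z + real n *\<^sub>R v"
      using w unfolding coset_def by blast
    have "w = z + real 1 *\<^sub>R (real n *\<^sub>R v)" "\<forall>i. (real n *\<^sub>R v) $ i \<in> \<int>"
      using v by simp_all
    then show ?thesis
      using coset_eq_iff by metis
  qed
  moreover have "coset n z \<noteq> {}"
  proof -
    have "\<forall>i. (0 :: real^2) $ i \<in> \<int>"
      by simp
    then have "z + real n *\<^sub>R 0 \<in> coset n z"
      unfolding coset_def by blast
    then show ?thesis
      by blast
  qed
  ultimately show ?thesis
    unfolding pr_def by simp
qed

text \<open>The rotation of the torus by \<open>\<pi>/2\<close>, acting on cosets elementwise.\<close>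

definition rot90 :: "real^2 \<Rightarrow> real^2" where
  "rot90 z = vector [- (z $ 2), z $ 1]"

definition cbar :: "(real^2) set \<Rightarrow> (real^2) set" where
  "cbar C = rot90 ` C"

lemma cbar_coset: "cbar (coset m z) = coset m (rot90 z)"
proof -
  have lin: "rot90 (z + real m *\<^sub>R v) = rot90 z + real m *\<^sub>R rot90 v" for v
    by (simp add: rot90_def vec_eq_iff forall_2)
  have int: "(\<forall>i. rot90 v $ i \<in> \<int>) \<longleftrightarrow> (\<forall>i. v $ i \<in> \<int>)" for v
    by (auto simp: rot90_def forall_2)
  have surj: "\<exists>u. v = rot90 u" for v
    by (rule exI[of _ "vector [v $ 2, - (v $ 1)]"]) (simp add: rot90_def vec_eq_iff forall_2)
  show ?thesis
  proof (intro set_eqI iffI)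
    fix x assume "x \<in> cbar (coset m z)"
    then obtain v where v: "\<forall>i. v $ i \<in> \<int>" "x = rot90 (z + real m *\<^sub>R v)"
      unfolding cbar_def coset_def by blast
    then show "x \<in> coset m (rot90 z)"
      using int[of v] lin[of v] unfolding coset_def by blast
  next
    fix x assume "x \<in> coset m (rot90 z)"
    then obtain v where v: "\<forall>i. v $ i \<in> \<int>" "x = rot90 z + real m *\<^sub>R v"
      unfolding coset_def by blast
    obtain u where u: "v = rot90 u"
      using surj by blast
    have "z + real m *\<^sub>R u \<in> coset m z"
      using v int[of u] unfolding u coset_def by blast
    then show "x \<in> cbar (coset m z)"
      using v lin[of u] unfolding u cbar_def by (metis imageI)
  qed
qed

definition torsion_point :: "nat \<Rightarrow> int \<Rightarrow> int \<Rightarrow> (real^2) set" where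
  "torsion_point n p q = coset n (vector [of_int p, of_int q])"

definition power_map_near ::
    "'a topology \<Rightarrow> 'b topology \<Rightarrow> ('a \<Rightarrow> 'b) \<Rightarrow> 'a \<Rightarrow> nat \<Rightarrow> bool" where
  "power_map_near X Y f x k \<longleftrightarrow>
     (\<exists>U V \<phi> \<psi>. openin X U \<and> x \<in> U \<and> openin Y V \<and> f ` U \<subseteq> V \<and>
        homeomorphic_map (subtopology X U) (top_of_set (ball (0::complex) 1)) \<phi> \<and>
        homeomorphic_map (subtopology Y V) (top_of_set (ball (0::complex) 1)) \<psi> \<and>
        \<phi> x = 0 \<and> \<psi> (f x) = 0 \<and> (\<forall>u\<in>U. \<psi> (f u) = \<phi> u ^ k))"

text \<open>The ramification points are those where \<open>f\<close> has local exponent at least 2; their image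
  is required to be exactly \<open>B\<close>, and the degree \<open>d\<close> is the size of the unramified fibres.\<close>

definition ramified_covering ::
    "'a topology \<Rightarrow> 'b topology \<Rightarrow> ('a \<Rightarrow> 'b) \<Rightarrow> nat \<Rightarrow> 'b set \<Rightarrow> bool" where
  "ramified_covering X Y f d B \<longleftrightarrow>
     compact_space X \<and> connected_space X \<and> Hausdorff_space X \<and> continuous_map X Y f \<and>
     (\<forall>x\<in>topspace X. \<exists>k\<ge>1. power_map_near X Y f x k) \<and>
     f ` {x \<in> topspace X. \<exists>k\<ge>2. power_map_near X Y f x k} = B \<and>
     (\<forall>y\<in>topspace Y - B. card {x \<in> topspace X. f x = y} = d)"

text \<open>A homeomorphism of \<open>X\<close> lifting the holomorphic map \<open>cbar\<close> is automatically holomorphic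
  for the complex structure pulled back along \<open>\<kappa>\<close>, so it is an automorphism of the
  Riemann surface \<open>X\<close>.\<close>

definition origami_covering ::
    "nat \<Rightarrow> int \<Rightarrow> int \<Rightarrow> 'a topology \<Rightarrow> ('a \<Rightarrow> (real^2) set) \<Rightarrow> bool" where
  "origami_covering n p q X \<kappa> \<longleftrightarrow>
     ramified_covering X (torus n) \<kappa> 2
       {torsion_point n p q, torsion_point n (- q) p,
        torsion_point n (- p) (- q), torsion_point n q (- p)} \<and>
     (\<exists>c. homeomorphic_map X X c \<and>
          (\<forall>x\<in>topspace X. \<kappa> (c x) = cbar (\<kappa> x)) \<and>
          card {x \<in> topspace X. c (c x) = x} = 4 \<and>
          {x \<in> topspace X. c (c x) = x} =
            {x \<in> topspace X. \<kappa> x \<in> {coset n 0, coset n (vector [real n / 2, real n / 2])}})"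

text \<open>A map \<open>D\<close> from \<open>X\<close> to \<open>R^2/Z^2\<close>, ramified only over 0, lifts the translation structure
  of the torus to the complement of the preimage of 0: the charts are the local lifts
  of \<open>D\<close> to the plane.\<close>

definition punctured :: "'a topology \<Rightarrow> ('a \<Rightarrow> (real^2) set) \<Rightarrow> 'a topology" where
  "punctured X D = subtopology X {x \<in> topspace X. D x \<noteq> coset 1 0}"

definition translation_chart ::
    "'a topology \<Rightarrow> ('a \<Rightarrow> (real^2) set) \<Rightarrow> 'a set \<Rightarrow> ('a \<Rightarrow> real^2) \<Rightarrow> bool" where
  "translation_chart Y D U \<phi> \<longleftrightarrow>
     openin Y U \<and>
     (\<exists>W. open W \<and> homeomorphic_map (subtopology Y U) (top_of_set W) \<phi>) \<and>
     (\<forall>u\<in>U. coset 1 (\<phi> u) = D u)"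

text \<open>Locally affine homeomorphisms with invertible linear part are diffeomorphisms, so
  smoothness need not be required separately.\<close>

definition affine_diffeo ::
    "'a topology \<Rightarrow> ('a \<Rightarrow> (real^2) set) \<Rightarrow> real^2^2 \<Rightarrow> ('a \<Rightarrow> 'a) \<Rightarrow> bool" where
  "affine_diffeo Y D A f \<longleftrightarrow>
     invertible A \<and> homeomorphic_map Y Y f \<and>
     (\<forall>U \<phi> V \<psi>. translation_chart Y D U \<phi> \<and> translation_chart Y D V \<psi> \<longrightarrow>
        (\<forall>x\<in>U. f x \<in> V \<longrightarrow>
           (\<exists>N b. openin Y N \<and> x \<in> N \<and> N \<subseteq> U \<and> f ` N \<subseteq> V \<and>
                  (\<forall>u\<in>N. \<psi> (f u) = A *v \<phi> u + b))))"

definition veech_group :: "'a topology \<Rightarrow> ('a \<Rightarrow> (real^2) set) \<Rightarrow> (real^2^2) set" where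
  "veech_group X D = {A. det A > 0 \<and> (\<exists>f. affine_diffeo (punctured X D) D A f)}"

definition SL2Z :: "(int^2^2) set" where
  "SL2Z = {A. det A = 1}"

definition real_matrix :: "int^2^2 \<Rightarrow> real^2^2" where
  "real_matrix A = (\<chi> i j. real_of_int (A $ i $ j))"

definition mat_cong :: "int \<Rightarrow> int^2^2 \<Rightarrow> int^2^2 \<Rightarrow> bool" where
  "mat_cong m A B \<longleftrightarrow> (\<forall>i j. [A $ i $ j = B $ i $ j] (mod m))"

definition invertible_mod :: "int \<Rightarrow> int^2^2 \<Rightarrow> bool" where
  "invertible_mod m A \<longleftrightarrow> (\<exists>B. mat_cong m (A ** B) (mat 1) \<and> mat_cong m (B ** A) (mat 1))"

definition mat2 :: "int \<Rightarrow> int \<Rightarrow> int \<Rightarrow> int \<Rightarrow> int^2^2" where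
  "mat2 a b c d = vector [vector [a, b], vector [c, d]]"

definition cong_quarter_turn :: "int \<Rightarrow> int^2^2 \<Rightarrow> bool" where
  "cong_quarter_turn m A \<longleftrightarrow>
     mat_cong m A (mat2 1 0 0 1) \<or> mat_cong m A (- mat2 1 0 0 1) \<or>
     mat_cong m A (mat2 0 (-1) 1 0) \<or> mat_cong m A (- mat2 0 (-1) 1 0)"

end

theory Submission
  imports Defs
begin

text \<open>Outside the branch points \<open>S\<close> the covering has a sheet involution \<open>\<sigma>\<close>, and near a branch point
  it has no section, because such a section would be a continuous square root on a punctured disc. Hence
  \<open>X\<^sup>*\<close> is connected, and a locally constant property holds at all of its points or at none.

  An affine diffeomorphism \<open>f\<close> with derivative \<open>A\<close> maps segments that avoid the lattice to such segments.
  From a point of irrational abscissa and ordinate \<open>1/2\<close> all lattice points are visible, so that \<open>A\<close>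
  preserves the lattice and \<open>\<kappa> \<circ> f = A \<circ> \<kappa> + b\<close> with \<open>b\<close> integral. As \<open>z \<mapsto> A z + b\<close> preserves \<open>S\<close>, \<open>b\<close> vanishes
  modulo \<open>n\<close> and \<open>A\<close> is a quarter turn modulo \<open>n\<close>; as \<open>f\<close> commutes with \<open>c\<^sup>2\<close>, \<open>A\<close> fixes \<open>M\<close>, which is the
  condition modulo 2.

  Conversely, the bijections from the fibre over \<open>z\<close> to the fibre over \<open>A z\<close> form a two-valued local system on the
  plane outside \<open>S\<close>. It has no monodromy around \<open>S\<close>, where the sheets are exchanged both over \<open>z\<close> and over
  \<open>A z\<close>, hence it has a global section on the plane. Its behaviour under a translation by \<open>n v\<close> is a sign,
  which is seen to be trivial by applying \<open>c\<^sup>2\<close> at the 2-torsion point \<open>n v / 2\<close>, since \<open>A\<close> fixes \<open>O\<close> and \<open>M\<close>.\<close>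

section \<open>Two-valued local systems on the plane\<close>

text \<open>The obstruction to lifting A is a character with values 1 and -1 of the fundamental
  group of the torus minus the branch points: it compares \<open>\<kappa>\<close> with its pullback
  under A. Once loops around branch points are seen not to contribute, a character of the period
  lattice remains, which is why half periods, that is 2-torsion points, decide. Fundamental groups
  are avoided: path lifting and the comparison of fibres are two instances of one statement about
  two-valued local systems on the plane.

  That b and A are determined modulo n rests on opposite points: the images of P and -P add up to 2
  b, and so do those of P_1 and -P_1; as det A = 1, opposite points can only go to opposite points,
  so 2 b = 0 and b = 0 for odd n. Oddness is used again for M, which is not an n-torsion point: the
  points over M belong to \<open>X\<^sup>*\<close>, where f can be evaluated, whereas those over O
  are punctures, near which f and c^2 have to be compared on a punctured disc.\<close>

definition rect :: "real \<Rightarrow> real \<Rightarrow> real \<Rightarrow> real \<Rightarrow> complex set" where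
  "rect a b c d = {z. a < Re z \<and> Re z < b \<and> c < Im z \<and> Im z < d}"

lemma rect_eq: "rect a b c d = {z. a < Re z} \<inter> {z. Re z < b} \<inter> {z. c < Im z} \<inter> {z. Im z < d}"
  by (auto simp: rect_def)

lemma open_rect: "open (rect a b c d)"
  unfolding rect_eq by (intro open_Int open_halfspace_Re_gt open_halfspace_Re_lt open_halfspace_Im_gt open_halfspace_Im_lt)

lemma convex_rect: "convex (rect a b c d)"
  unfolding rect_eq by (intro convex_Int convex_halfspace_Re_gt convex_halfspace_Re_lt convex_halfspace_Im_gt convex_halfspace_Im_lt)

text \<open>\<open>L U G\<close> says that G is a section over U, whatever its values outside U.
  \<open>free\<close> asks for one moved point in each nonempty open set, not for all points,
  because the matchings below take the value \<open>{}\<close> at branch points, where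
  \<open>\<iota>\<close> fixes it.\<close>

locale plane_torsor =
  fixes L :: "complex set \<Rightarrow> (complex \<Rightarrow> 'b) \<Rightarrow> bool" and \<iota> :: "'b \<Rightarrow> 'b"
  assumes loc: "\<And>U G. open U \<Longrightarrow>
      (\<And>z. z \<in> U \<Longrightarrow> \<exists>V H. open V \<and> z \<in> V \<and> L V H \<and> (\<forall>w\<in>V \<inter> U. G w = H w)) \<Longrightarrow> L U G"
    and inv: "\<And>U G. open U \<Longrightarrow> L U G \<Longrightarrow> L U (\<lambda>z. \<iota> (G z))"
    and dich: "\<And>U G H. open U \<Longrightarrow> convex U \<Longrightarrow> L U G \<Longrightarrow> L U H \<Longrightarrow>
      (\<forall>z\<in>U. G z = H z) \<or> (\<forall>z\<in>U. G z = \<iota> (H z))"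
    and free: "\<And>U G. open U \<Longrightarrow> U \<noteq> {} \<Longrightarrow> L U G \<Longrightarrow> \<exists>z\<in>U. \<iota> (G z) \<noteq> G z"
    and ex: "\<And>z. \<exists>V G. open V \<and> z \<in> V \<and> L V G"
begin

lemma restrict: "L V G \<Longrightarrow> open V \<Longrightarrow> open U \<Longrightarrow> U \<subseteq> V \<Longrightarrow> L U G"
  by (rule loc) blast+

text \<open>On the convex overlap the two sections agree or differ by \<open>\<iota>\<close>; in the
  second case H is first replaced by its image under \<open>\<iota>\<close>. The union itself may
  fail to be convex.\<close>

lemma glue2:
  assumes "open U" "open V" "convex (U \<inter> V)" "L U G" "L V H"
  shows "\<exists>K. L (U \<union> V) K"
proof -
  have op: "open (U \<inter> V)" "open (U \<union> V)" using assms by auto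
  have 1: "L (U \<inter> V) G" "L (U \<inter> V) H" using restrict assms op by blast+
  obtain H' where H': "L V H'" "\<forall>z\<in>U \<inter> V. G z = H' z"
    using dich[OF op(1) assms(3) 1] inv[OF assms(2,5)] assms(5) by blast
  have "L (U \<union> V) (\<lambda>z. if z \<in> U then G z else H' z)"
  proof (rule loc)
    fix z assume "z \<in> U \<union> V"
    then show "\<exists>Va H. open Va \<and> z \<in> Va \<and> L Va H \<and>
        (\<forall>w\<in>Va \<inter> (U \<union> V). (if w \<in> U then G w else H' w) = H w)"
      using assms(1,2,4) H' by (cases "z \<in> U") (rule exI[of _ U], force, rule exI[of _ V], force)
  qed (rule op)
  then show ?thesis by blast
qed

lemma restrict_rect: "L (rect a b c d) G \<Longrightarrow> rect a' b' c' d' \<subseteq> rect a b c d \<Longrightarrow> L (rect a' b' c' d') G"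
  by (rule restrict[OF _ open_rect open_rect])

text \<open>Compactness of the interval in the form of \<open>Bolzano\<close> induction: short
  pieces come from \<open>ex\<close>, adjacent pieces are joined by \<open>glue2\<close>. The margin
  e makes neighbouring rectangles overlap in an open rectangle.\<close>

lemma ex_thin:
  assumes "a \<le> b"
  shows "\<exists>e>0. \<exists>G. L (rect (a - e) (b + e) (y - e) (y + e)) G"
  using assms
proof (induction rule: Bolzano)
  case (trans a b c)
  then obtain e1 G1 e2 G2 where e: "e1 > 0" "e2 > 0"
    "L (rect (a - e1) (b + e1) (y - e1) (y + e1)) G1" "L (rect (b - e2) (c + e2) (y - e2) (y + e2)) G2" by blast
  define e where "e = min e1 e2"
  have "L (rect (a - e) (b + e) (y - e) (y + e)) G1" "L (rect (b - e) (c + e) (y - e) (y + e)) G2"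
    by (rule restrict_rect[OF e(3)], (auto simp: rect_def e_def)[1],
        rule restrict_rect[OF e(4)], auto simp: rect_def e_def)
  then obtain K where K: "L (rect (a - e) (b + e) (y - e) (y + e) \<union> rect (b - e) (c + e) (y - e) (y + e)) K"
    using glue2 open_rect convex_rect convex_Int by metis
  have "rect (a - e) (c + e) (y - e) (y + e) \<subseteq>
      rect (a - e) (b + e) (y - e) (y + e) \<union> rect (b - e) (c + e) (y - e) (y + e)"
    using e(1,2) by (auto simp: rect_def e_def)
  then have "L (rect (a - e) (c + e) (y - e) (y + e)) K"
    by (rule restrict[OF K open_Un[OF open_rect open_rect] open_rect])
  moreover have "e > 0" using e by (simp add: e_def)
  ultimately show ?case by blast
next
  case (local x)
  obtain V G where V: "open V" "Complex x y \<in> V" "L V G" using ex by blast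
  obtain r where r: "r > 0" "ball (Complex x y) r \<subseteq> V" using V open_contains_ball by blast
  \<comment> \<open>Horizontally a point of the rectangle is within 2 e of x, vertically within e of
    y, and 3 e is well below r.\<close>
  define e where "e = r / 8"
  have e: "e > 0" using r by (simp add: e_def)
  have "L (rect (a - e) (b + e) (y - e) (y + e)) G" if "a \<le> x \<and> x \<le> b \<and> b - a < e" for a b
  proof (rule restrict[OF V(3,1) open_rect])
    show "rect (a - e) (b + e) (y - e) (y + e) \<subseteq> V"
    proof
      fix w assume w: "w \<in> rect (a - e) (b + e) (y - e) (y + e)"
      have "cmod (Complex x y - w) \<le> \<bar>x - Re w\<bar> + \<bar>y - Im w\<bar>"
        using cmod_le[of "Complex x y - w"] by simp
      also have "\<dots> < r" using w that e by (auto simp: rect_def e_def)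
      finally show "w \<in> V" using r(2) by (auto simp: dist_norm)
    qed
  qed
  then show ?case using e by blast
qed

text \<open>The same induction in the vertical direction, with the strips of \<open>ex_thin\<close>
  as local pieces.\<close>

lemma ex_rect:
  assumes "a \<le> b" "c \<le> d"
  shows "\<exists>e>0. \<exists>G. L (rect (a - e) (b + e) (c - e) (d + e)) G"
  using assms(2)
proof (induction rule: Bolzano)
  case (trans c c' d)
  then obtain e1 G1 e2 G2 where e: "e1 > 0" "e2 > 0"
    "L (rect (a - e1) (b + e1) (c - e1) (c' + e1)) G1" "L (rect (a - e2) (b + e2) (c' - e2) (d + e2)) G2" by blast
  define e where "e = min e1 e2"
  have "L (rect (a - e) (b + e) (c - e) (c' + e)) G1" "L (rect (a - e) (b + e) (c' - e) (d + e)) G2"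
    by (rule restrict_rect[OF e(3)], (auto simp: rect_def e_def)[1],
        rule restrict_rect[OF e(4)], auto simp: rect_def e_def)
  then obtain K where K: "L (rect (a - e) (b + e) (c - e) (c' + e) \<union> rect (a - e) (b + e) (c' - e) (d + e)) K"
    using glue2 open_rect convex_rect convex_Int by metis
  have "rect (a - e) (b + e) (c - e) (d + e) \<subseteq>
      rect (a - e) (b + e) (c - e) (c' + e) \<union> rect (a - e) (b + e) (c' - e) (d + e)"
    using e(1,2) by (auto simp: rect_def e_def)
  then have "L (rect (a - e) (b + e) (c - e) (d + e)) K"
    by (rule restrict[OF K open_Un[OF open_rect open_rect] open_rect])
  moreover have "e > 0" using e by (simp add: e_def)
  ultimately show ?case by blast
next
  case (local y)
  obtain e0 G where e0: "e0 > 0" "L (rect (a - e0) (b + e0) (y - e0) (y + e0)) G" using ex_thin[OF assms(1)] by blast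
  define e where "e = e0 / 2"
  have e: "e > 0" using e0 by (simp add: e_def)
  have "L (rect (a - e) (b + e) (c - e) (d + e)) G" if "c \<le> y \<and> y \<le> d \<and> d - c < e" for c d
    by (rule restrict[OF e0(2) open_rect open_rect]) (use that e in \<open>auto simp: rect_def e_def\<close>)
  then show ?case using e by blast
qed

text \<open>Were G the twist of H, then \<open>\<iota>\<close> would fix H on all of V, which
  \<open>free\<close> excludes.\<close>

lemma agree:
  assumes "open U" "convex U" "L U G" "L U H" "open V" "V \<noteq> {}" "V \<subseteq> U" "\<forall>z\<in>V. G z = H z" "z \<in> U"
  shows "G z = H z"
proof (rule ccontr)
  assume "G z \<noteq> H z"
  then have "\<forall>z\<in>U. G z = \<iota> (H z)" using dich[OF assms(1-4)] assms(9) by blast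
  then have "\<forall>z\<in>V. \<iota> (H z) = H z" using assms(7,8) by force
  moreover have "L V H" using restrict assms by blast
  ultimately show False using free assms(5,6) by blast
qed

text \<open>Squares exhaust the plane. Sections over them that are normalised to coincide on the
  smallest square are restrictions of each other by \<open>agree\<close>, and therefore
  glue.\<close>

theorem global_section: "\<exists>G. L UNIV G"
proof -
  define R where "R m = rect (- real m - 1) (real m + 1) (- real m - 1) (real m + 1)" for m
  have oR: "open (R m)" and cR: "convex (R m)" for m by (simp_all add: R_def open_rect convex_rect)
  have mono: "R k \<subseteq> R m" if "k \<le> m" for k m using that by (auto simp: R_def rect_def)
  have R0: "R 0 \<noteq> {}"
  proof -
    have "0 \<in> R 0" by (simp add: R_def rect_def)
    then show ?thesis by blast
  qed
  have exR: "\<exists>G. L (R m) G" for m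
  proof -
    obtain e G where e: "e > 0" "L (rect (- real m - 1 - e) (real m + 1 + e) (- real m - 1 - e) (real m + 1 + e)) G"
      using ex_rect[of "- real m - 1" "real m + 1" "- real m - 1" "real m + 1"] by auto
    have "L (R m) G"
      unfolding R_def by (rule restrict_rect[OF e(2)]) (use \<open>e > 0\<close> in \<open>auto simp: rect_def\<close>)
    then show ?thesis by blast
  qed
  obtain G0 where G0: "L (R 0) G0" using exR by blast
  have "\<exists>G. L (R m) G \<and> (\<forall>z\<in>R 0. G z = G0 z)" for m
  proof -
    obtain G where G: "L (R m) G" using exR by blast
    have "L (R 0) G" by (rule restrict[OF G oR oR mono]) simp
    from dich[OF oR cR G0 this] show ?thesis using G inv[OF oR G] by metis
  qed
  then obtain F where F: "\<And>m. L (R m) (F m)" "\<And>m z. z \<in> R 0 \<Longrightarrow> F m z = G0 z" by metis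
  have comp: "F m z = F k z" if "z \<in> R k" "k \<le> m" for m k z
  proof (rule agree[OF oR cR _ F(1) oR R0 mono _ that(1)])
    show "L (R k) (F m)" by (rule restrict[OF F(1) oR oR mono[OF that(2)]])
  qed (use F(2) in auto)
  define N where "N z = (LEAST m. z \<in> R m)" for z
  have exN: "\<exists>m. z \<in> R m" for z
  proof -
    obtain m where "max \<bar>Re z\<bar> \<bar>Im z\<bar> < real m" using reals_Archimedean2 by blast
    then have "z \<in> R m" by (auto simp: R_def rect_def)
    then show ?thesis by blast
  qed
  have "L UNIV (\<lambda>z. F (N z) z)"
  proof (rule loc)
    fix z
    obtain m where m: "z \<in> R m" using exN by blast
    have "F (N w) w = F m w" if "w \<in> R m" for w
      unfolding N_def using comp LeastI[of "\<lambda>m. w \<in> R m" m] that by (metis Least_le)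
    then show "\<exists>V H. open V \<and> z \<in> V \<and> L V H \<and> (\<forall>w\<in>V \<inter> UNIV. F (N w) w = H w)"
      using oR m F(1) by blast
  qed simp
  then show ?thesis by blast
qed

end

text \<open>The quotient h(u^2) / u has square 1, hence is a constant sign on the connected
  punctured disc, but it is an odd function of u.\<close>

lemma no_sqrt_punctured_disc:
  assumes "\<delta> > 0" "continuous_on (ball 0 \<delta> - {0::complex}) h"
    "\<And>v. v \<in> ball 0 \<delta> - {0} \<Longrightarrow> h v ^ 2 = v"
  shows False
proof -
  define D where "D = ball 0 (sqrt \<delta>) - {0::complex}"
  define k where "k u = h (u ^ 2) / u" for u
  have sq: "u ^ 2 \<in> ball 0 \<delta> - {0}" if "u \<in> D" for u
    using that assms(1) by (auto simp: D_def norm_power real_less_rsqrt intro: )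
       (metis norm_ge_zero real_sqrt_less_iff real_sqrt_unique)
  have "continuous_on D k"
    unfolding k_def by (intro continuous_intros continuous_on_compose2[OF assms(2)]) (use sq in \<open>auto simp: D_def\<close>)
  moreover have "connected D" unfolding D_def by (rule connected_punctured_ball) simp
  moreover have "k ` D \<subseteq> {1, -1}"
  proof
    fix y assume "y \<in> k ` D"
    then obtain u where u: "u \<in> D" "y = k u" by blast
    have "y ^ 2 = 1" using assms(3)[OF sq[OF u(1)]] u by (simp add: k_def power_divide D_def)
    then show "y \<in> {1, -1}" by (simp add: power2_eq_1_iff)
  qed
  moreover have "finite {1, -1 :: complex}" by simp
  ultimately have "k constant_on D" using continuous_finite_range_constant finite_subset by blast
  then obtain c where c: "\<And>u. u \<in> D \<Longrightarrow> k u = c" by (auto simp: constant_on_def)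
  define u where "u = complex_of_real (sqrt \<delta> / 2)"
  have u: "u \<in> D" "- u \<in> D" using assms(1) by (auto simp: D_def u_def norm_mult)
  have "k u = - k (- u)" by (simp add: k_def)
  then have "k u = 0" using c u by simp
  then have "h (u ^ 2) ^ 2 = 0" using u by (simp add: k_def D_def)
  then show False using assms(3)[OF sq[OF u(1)]] u by (simp add: D_def)
qed

section \<open>Double coverings of the torus\<close>

definition lattice :: "(real^2) set" where
  "lattice = {v. \<forall>i. v $ i \<in> \<int>}"

lemma coset_eq: "coset m z = coset m w \<longleftrightarrow> (\<exists>v\<in>lattice. w = z + real m *\<^sub>R v)"
  unfolding coset_eq_iff lattice_def by blast

lemma lattice_dist:
  assumes "v \<in> lattice" "w \<in> lattice" "dist v w < 1"
  shows "v = w"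
proof (rule ccontr)
  assume "v \<noteq> w"
  then obtain i where i: "v $ i \<noteq> w $ i" by (auto simp: vec_eq_iff)
  have "v $ i - w $ i \<in> \<int>" using assms by (simp add: lattice_def)
  then have "1 \<le> \<bar>v $ i - w $ i\<bar>" using i Ints_nonzero_abs_ge1 by fastforce
  also have "\<dots> \<le> dist v w" using component_le_norm_cart[of "v - w" i] by (simp add: dist_norm)
  finally show False using assms(3) by simp
qed

lemma lattice_0: "0 \<in> lattice"
  and lattice_add: "v \<in> lattice \<Longrightarrow> w \<in> lattice \<Longrightarrow> v + w \<in> lattice"
  and lattice_diff: "v \<in> lattice \<Longrightarrow> w \<in> lattice \<Longrightarrow> v - w \<in> lattice"
  and lattice_uminus: "v \<in> lattice \<Longrightarrow> - v \<in> lattice"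
  and lattice_scale: "v \<in> lattice \<Longrightarrow> real m *\<^sub>R v \<in> lattice" by (auto simp: lattice_def)

lemma closed_subset_lattice:
  assumes "T \<subseteq> lattice"
  shows "closed T"
proof (rule discrete_imp_closed[of 1])
  show "\<forall>x\<in>T. \<forall>y\<in>T. dist y x < 1 \<longrightarrow> y = x"
  proof (intro ballI impI)
    fix x y assume "x \<in> T" "y \<in> T" "dist y x < 1"
    then show "y = x" using assms by (intro lattice_dist) auto
  qed
qed simp

lemma countable_lattice: "countable lattice"
proof -
  have "lattice \<subseteq> (\<lambda>(a, b). vector [real_of_int a, real_of_int b]) ` UNIV"
  proof
    fix v assume "v \<in> lattice"
    then have "v $ 1 \<in> \<int>" "v $ 2 \<in> \<int>" by (simp_all add: lattice_def)
    then obtain a b where "v $ 1 = of_int a" "v $ 2 = of_int b" by (auto elim!: Ints_cases)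
    then have "v = vector [of_int a, of_int b]" by (simp add: vec_eq_iff forall_2)
    then show "v \<in> (\<lambda>(a, b). vector [real_of_int a, real_of_int b]) ` UNIV" by auto
  qed
  then show ?thesis by (meson countableI_type countable_image countable_subset)
qed

lemma coset_open:
  assumes "open V"
  shows "openin (torus m) (coset m ` V)"
proof -
  have "coset m -` (coset m ` V) = (\<Union>u\<in>lattice. (+) (real m *\<^sub>R u) ` V)" (is "?L = ?R")
  proof (intro set_eqI iffI)
    fix x assume "x \<in> ?L"
    then obtain y where y: "y \<in> V" "coset m y = coset m x" by force
    then obtain u where "u \<in> lattice" "x = y + real m *\<^sub>R u" unfolding coset_eq by blast
    then show "x \<in> ?R" using y by (auto simp: add.commute)
  next
    fix x assume "x \<in> ?R"
    then obtain u y where u: "u \<in> lattice" "y \<in> V" "x = real m *\<^sub>R u + y" by blast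
    then have "coset m y = coset m x" unfolding coset_eq by (auto simp: add.commute)
    then show "x \<in> ?L" using u(2) by (metis image_eqI vimageI)
  qed
  then show ?thesis unfolding openin_torus using assms by (auto intro!: open_translation)
qed

lemma continuous_coset: "continuous_map euclidean (torus m) (coset m)"
  by (rule quotient_imp_continuous_map[OF quotient_map_coset])

lemma coset_inj:
  assumes "m > 0" "dist z w < 1" "coset m z = coset m w"
  shows "z = w"
proof -
  obtain v where v: "v \<in> lattice" "w = z + real m *\<^sub>R v" using assms(3) unfolding coset_eq by blast
  have "dist (real m *\<^sub>R v) 0 < 1" using assms(2) v by (simp add: dist_norm)
  then have "real m *\<^sub>R v = 0" using lattice_dist lattice_scale lattice_0 v(1) by blast
  then show ?thesis using v by simp
qed

text \<open>Points of the ball are less than 1 apart, while nonzero vectors of m Z^2 have length at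
  least 1. The images of these balls serve as local coordinates on the torus.\<close>

lemma coset_homeo:
  assumes "m > 0" "r \<le> 1 / 2"
  shows "homeomorphic_map (top_of_set (ball z r)) (subtopology (torus m) (coset m ` ball z r)) (coset m)"
proof (rule bijective_open_imp_homeomorphic_map)
  show "continuous_map (top_of_set (ball z r)) (subtopology (torus m) (coset m ` ball z r)) (coset m)"
    by (intro continuous_map_into_subtopology continuous_map_from_subtopology continuous_coset) auto
  show "open_map (top_of_set (ball z r)) (subtopology (torus m) (coset m ` ball z r)) (coset m)"
    unfolding open_map_def
  proof safe
    fix V assume "openin (top_of_set (ball z r)) V"
    then have "open V" "V \<subseteq> ball z r" using openin_open_eq open_ball by blast+
    then show "openin (subtopology (torus m) (coset m ` ball z r)) (coset m ` V)"
      by (metis coset_open image_mono openin_subset_topspace_eq openin_subtopology_Int2 inf.absorb_iff2)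
  qed
  show "coset m ` topspace (top_of_set (ball z r)) = topspace (subtopology (torus m) (coset m ` ball z r))"
    by (auto simp: topspace_torus)
  show "inj_on (coset m) (topspace (top_of_set (ball z r)))"
  proof (rule inj_onI)
    fix x y assume "x \<in> topspace (top_of_set (ball z r))" "y \<in> topspace (top_of_set (ball z r))"
      and eq: "coset m x = coset m y"
    then have "dist z x < r" "dist z y < r" by auto
    then have "dist x y < 1" using dist_triangle_half_r[of z x "2*r" y] assms(2) by linarith
    then show "x = y" using coset_inj assms(1) eq by blast
  qed
qed

lemma coset_ball_inj:
  assumes "m > 0" "r \<le> 1 / 2" "x \<in> ball z r" "y \<in> ball z r" "coset m x = coset m y"
  shows "x = y"
  using homeomorphic_imp_injective_map[OF coset_homeo[OF assms(1,2), of z]] assms(3-5) by (simp add: inj_on_def)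

section \<open>Lifts, local sections and the sheet involution\<close>

locale double_cover =
  fixes n :: nat and X :: "'a topology" and \<kappa> :: "'a \<Rightarrow> (real^2) set" and B :: "(real^2) set set"
  assumes n_pos: "n > 0"
    and cov: "ramified_covering X (torus n) \<kappa> 2 B"
    and B_lattice: "B \<subseteq> coset n ` lattice"
begin

text \<open>The branch set is pulled back to the plane, where it is periodic. As a subset of the
  integer lattice it is closed, and distinct points of it are at least 1 apart.\<close>

definition S :: "(real^2) set" where
  "S = {z. coset n z \<in> B}"

lemma S_lattice: "S \<subseteq> lattice"
proof
  fix z assume "z \<in> S"
  then obtain w where "w \<in> lattice" "coset n w = coset n z"
    using B_lattice unfolding S_def by (metis (mono_tags, lifting) imageE in_mono mem_Collect_eq)
  then show "z \<in> lattice" unfolding coset_eq using lattice_add lattice_scale by blast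
qed

lemma closed_S: "closed S"
  using closed_subset_lattice S_lattice .

lemma continuous_\<kappa>: "continuous_map X (torus n) \<kappa>"
  using cov by (simp add: ramified_covering_def)

lemma fibre_card: "z \<notin> S \<Longrightarrow> card {x \<in> topspace X. \<kappa> x = coset n z} = 2"
  using cov by (auto simp: ramified_covering_def S_def topspace_torus)

lemma fibre_point:
  assumes "z \<notin> S"
  obtains x where "x \<in> topspace X" "\<kappa> x = coset n z"
proof -
  have "{x \<in> topspace X. \<kappa> x = coset n z} \<noteq> {}"
    using fibre_card[OF assms] by (metis card.empty zero_neq_numeral)
  then show ?thesis using that by blast
qed

lemma obtain_coord:
  assumes "x \<in> topspace X"
  obtains z where "\<kappa> x = coset n z"
proof -
  have "\<kappa> x \<in> topspace (torus n)"
    using continuous_\<kappa> assms by (metis continuous_map_image_subset_topspace image_subset_iff)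
  then show ?thesis using that by (auto simp: topspace_torus)
qed

text \<open>The base map is recorded by a map E to the plane, taken modulo n. With the identity for
  E this is a section of \<open>\<kappa>\<close> over U, with a segment for E it is path lifting;
  the domain is polymorphic since \<open>real^2\<close>, \<open>complex\<close> and real intervals
  all occur.\<close>

definition lift :: "'c::topological_space set \<Rightarrow> ('c \<Rightarrow> real^2) \<Rightarrow> ('c \<Rightarrow> 'a) \<Rightarrow> bool" where
  "lift U E s \<longleftrightarrow> continuous_map (top_of_set U) X s \<and> (\<forall>u\<in>U. \<kappa> (s u) = coset n (E u))"

lemma lift_in: "lift U E s \<Longrightarrow> u \<in> U \<Longrightarrow> s u \<in> topspace X"
  unfolding lift_def by (metis continuous_map_image_subset_topspace image_subset_iff topspace_euclidean_subtopology)

lemma lift_coset: "lift U E s \<Longrightarrow> u \<in> U \<Longrightarrow> \<kappa> (s u) = coset n (E u)"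
  unfolding lift_def by blast

lemma lift_subset: "lift U E s \<Longrightarrow> V \<subseteq> U \<Longrightarrow> lift V E s"
  unfolding lift_def using continuous_map_from_subtopology_mono by blast

lemma lift_locally:
  assumes "\<And>u. u \<in> U \<Longrightarrow> \<exists>V t. open V \<and> u \<in> V \<and> lift (V \<inter> U) E t \<and> (\<forall>w\<in>V \<inter> U. s w = t w)"
  shows "lift U E s"
proof -
  obtain V t where V: "\<And>u. u \<in> U \<Longrightarrow> open (V u) \<and> u \<in> V u \<and> lift (V u \<inter> U) E (t u) \<and> (\<forall>w\<in>V u \<inter> U. s w = t u w)"
    using assms by metis
  have "continuous_map (top_of_set U) X s"
  proof (rule pasting_lemma[where I = U and T = "\<lambda>u. V u \<inter> U" and f = t])
    fix u assume "u \<in> U"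
    then show "openin (top_of_set U) (V u \<inter> U)" using V by (metis openin_open Int_commute)
    show "continuous_map (subtopology (top_of_set U) (V u \<inter> U)) X (t u)"
      using V[OF \<open>u \<in> U\<close>] by (simp add: lift_def subtopology_subtopology Int_absorb1 Int_commute Int_left_commute)
  next
    fix i j x assume "i \<in> U" "j \<in> U" "x \<in> topspace (top_of_set U) \<inter> (V i \<inter> U) \<inter> (V j \<inter> U)"
    then show "t i x = t j x" using V by (metis IntD1 IntD2)
  next
    fix x assume "x \<in> topspace (top_of_set U)"
    then show "\<exists>j. j \<in> U \<and> x \<in> V j \<inter> U \<and> s x = t j x" using V by auto
  qed
  moreover have "\<kappa> (s u) = coset n (E u)" if "u \<in> U" for u using V[OF that] that by (auto simp: lift_def)
  ultimately show ?thesis by (simp add: lift_def)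
qed

lemma lift_compose:
  assumes "lift U E s" "continuous_on V f" "f ` V \<subseteq> U" "\<And>v. v \<in> V \<Longrightarrow> coset n (E (f v)) = coset n (F v)"
  shows "lift V F (\<lambda>v. s (f v))"
proof -
  have "continuous_map (top_of_set V) (top_of_set U) f" using assms(2,3) by (simp add: image_subset_iff_funcset)
  then have "continuous_map (top_of_set V) X (s \<circ> f)"
    using assms(1) continuous_map_compose unfolding lift_def by blast
  then show ?thesis using assms by (auto simp: lift_def o_def)
qed

text \<open>A local exponent of at least 2 would put the image into B, so the exponent is 1 and
  \<open>\<kappa>\<close> is a local homeomorphism at x; s is its local inverse. Openness of s is
  recorded because sections serve as inverse charts.\<close>

lemma local_section:
  assumes x: "x \<in> topspace X" "\<kappa> x = coset n z" "z \<notin> S"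
  obtains r s where "0 < r" "r \<le> 1 / 2" "ball z r \<inter> S = {}" "lift (ball z r) (\<lambda>w. w) s" "s z = x"
    "\<And>V. open V \<Longrightarrow> V \<subseteq> ball z r \<Longrightarrow> openin X (s ` V)"
proof -
  obtain k where k: "k \<ge> 1" "power_map_near X (torus n) \<kappa> x k"
    using cov x(1) unfolding ramified_covering_def by blast
  have "k = 1"
  proof (rule ccontr)
    assume "k \<noteq> 1"
    then have "x \<in> {x \<in> topspace X. \<exists>k\<ge>2. power_map_near X (torus n) \<kappa> x k}"
      using k x(1) by (intro CollectI conjI exI[of _ k]) auto
    then have "\<kappa> x \<in> B" using cov unfolding ramified_covering_def by (metis (no_types, lifting) imageI)
    then show False using x by (simp add: S_def)
  qed
  then obtain U V \<phi> \<psi> where U: "openin X U" "x \<in> U" "openin (torus n) V" "\<kappa> ` U \<subseteq> V"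
    "homeomorphic_map (subtopology X U) (top_of_set (ball (0::complex) 1)) \<phi>"
    "homeomorphic_map (subtopology (torus n) V) (top_of_set (ball (0::complex) 1)) \<psi>"
    "\<And>u. u \<in> U \<Longrightarrow> \<psi> (\<kappa> u) = \<phi> u"
    using k(2) unfolding power_map_near_def by auto
  obtain \<phi>' where \<phi>': "homeomorphic_maps (subtopology X U) (top_of_set (ball 0 1)) \<phi> \<phi>'"
    using U(5) homeomorphic_map_maps by blast
  have UX: "topspace (subtopology X U) = U" using openin_subset[OF U(1)] by auto
  have VX: "topspace (subtopology (torus n) V) = V" using openin_subset[OF U(3)] by auto
  have \<phi>inv: "\<phi>' (\<phi> u) = u" if "u \<in> U" for u
    using \<phi>' that UX by (auto simp: homeomorphic_maps_def)
  have \<phi>'inv: "\<phi> (\<phi>' v) = v" "\<phi>' v \<in> U" if "v \<in> ball 0 1" for v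
    using \<phi>' that UX by (auto simp: homeomorphic_maps_def continuous_map_def)
  have \<psi>inj: "inj_on \<psi> V" using homeomorphic_imp_injective_map[OF U(6)] VX by simp
  have \<psi>im: "\<psi> ` V = ball 0 1" using homeomorphic_imp_surjective_map[OF U(6)] VX by simp
  define W where "W = coset n -` V"
  have W: "open W" using U(3) by (simp add: openin_torus W_def)
  have zW: "z \<in> W" using U(2,4) x(2) by (auto simp: W_def)
  define s where "s w = \<phi>' (\<psi> (coset n w))" for w
  have sU: "s w \<in> U" "\<phi> (s w) = \<psi> (coset n w)" if "w \<in> W" for w
  proof -
    have "\<psi> (coset n w) \<in> ball 0 1" using \<psi>im that by (auto simp: W_def)
    then show "s w \<in> U" "\<phi> (s w) = \<psi> (coset n w)"
      using \<phi>'inv[of "\<psi> (coset n w)"] by (auto simp only: s_def)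
  qed
  have s\<kappa>: "\<kappa> (s w) = coset n w" if "w \<in> W" for w
  proof (rule inj_onD[OF \<psi>inj])
    show "\<psi> (\<kappa> (s w)) = \<psi> (coset n w)" using sU[OF that] U(7) by simp
    show "\<kappa> (s w) \<in> V" using sU(1)[OF that] U(4) by (meson image_subset_iff)
    show "coset n w \<in> V" using that by (simp add: W_def)
  qed
  have "continuous_map (top_of_set W) (subtopology (torus n) V) (coset n)"
    by (intro continuous_map_into_subtopology continuous_map_from_subtopology continuous_coset)
       (auto simp: W_def)
  note c1 = continuous_map_compose[OF continuous_map_compose[OF this homeomorphic_imp_continuous_map[OF U(6)]]]
  have "continuous_map (top_of_set (ball 0 1)) X \<phi>'"
    using \<phi>' by (auto simp: homeomorphic_maps_def continuous_map_in_subtopology)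
  then have "continuous_map (top_of_set W) X (\<phi>' \<circ> (\<psi> \<circ> coset n))" by (rule c1)
  then have contW: "continuous_map (top_of_set W) X s" by (simp add: s_def[abs_def] o_def)
  then have lW: "lift W (\<lambda>w. w) s" using s\<kappa> by (simp add: lift_def)
  obtain r0 where r0: "r0 > 0" "ball z r0 \<subseteq> W - S"
    using open_contains_ball[of "W - S"] open_Diff[OF W closed_S] zW x(3) by blast
  define r where "r = min r0 (1/2)"
  have r: "r > 0" "r \<le> 1/2" "ball z r \<subseteq> W - S" using r0 by (auto simp: r_def)
  show ?thesis
  proof (rule that[OF r(1,2)])
    show "ball z r \<inter> S = {}" using r by blast
    show "lift (ball z r) (\<lambda>w. w) s" using lW lift_subset r by blast
    show "s z = x" using \<phi>inv U(2,7) x(2) unfolding s_def by metis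
    fix N assume N: "open N" "N \<subseteq> ball z r"
    \<comment> \<open>The image of N is the part inside U of the set lying over N, an intersection
      of two open sets.\<close>
    have "s ` N = {u \<in> topspace X. \<kappa> u \<in> coset n ` N} \<inter> U"
    proof (intro set_eqI iffI)
      fix u assume "u \<in> s ` N"
      then obtain w where w: "w \<in> N" "u = s w" by blast
      then have "w \<in> W" using N r by blast
      then show "u \<in> {u \<in> topspace X. \<kappa> u \<in> coset n ` N} \<inter> U"
        using w sU[of w] s\<kappa>[of w] openin_subset[OF U(1)] by auto
    next
      fix u assume u: "u \<in> {u \<in> topspace X. \<kappa> u \<in> coset n ` N} \<inter> U"
      then obtain w where w: "w \<in> N" "\<kappa> u = coset n w" by blast
      then have "s w = u" using u \<phi>inv U(7) unfolding s_def by (metis IntD2)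
      then show "u \<in> s ` N" using w by blast
    qed
    moreover have "openin X {u \<in> topspace X. \<kappa> u \<in> coset n ` N}"
      using openin_continuous_map_preimage[OF continuous_\<kappa> coset_open[OF N(1)]] .
    ultimately show "openin X (s ` N)" using U(1) by (simp add: openin_Int)
  qed
qed

text \<open>Over the complement of S the fibre has two points and the choice is forced; over branch
  points the value is meaningless.\<close>

definition \<sigma> :: "'a \<Rightarrow> 'a" where
  "\<sigma> x = (SOME y. y \<in> topspace X \<and> \<kappa> y = \<kappa> x \<and> y \<noteq> x)"

lemma \<sigma>:
  assumes "x \<in> topspace X" "\<kappa> x = coset n z" "z \<notin> S"
  shows \<sigma>_in: "\<sigma> x \<in> topspace X" and \<sigma>_\<kappa>: "\<kappa> (\<sigma> x) = \<kappa> x" and \<sigma>_neq: "\<sigma> x \<noteq> x"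
    and \<sigma>_fibre: "\<And>y. y \<in> topspace X \<Longrightarrow> \<kappa> y = \<kappa> x \<Longrightarrow> y = x \<or> y = \<sigma> x"
proof -
  obtain a b where ab: "{y \<in> topspace X. \<kappa> y = coset n z} = {a, b}" "a \<noteq> b"
    using fibre_card[OF assms(3)] by (auto simp: card_2_iff)
  have ab': "a \<in> topspace X" "\<kappa> a = coset n z" "b \<in> topspace X" "\<kappa> b = coset n z"
    using ab(1) by (metis (mono_tags, lifting) insertCI mem_Collect_eq)+
  have "\<exists>y. y \<in> topspace X \<and> \<kappa> y = \<kappa> x \<and> y \<noteq> x"
    using ab' ab(2) assms(2) by metis
  from someI_ex[OF this] have *: "\<sigma> x \<in> topspace X \<and> \<kappa> (\<sigma> x) = \<kappa> x \<and> \<sigma> x \<noteq> x"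
    unfolding \<sigma>_def .
  then show "\<sigma> x \<in> topspace X" "\<kappa> (\<sigma> x) = \<kappa> x" "\<sigma> x \<noteq> x" by auto
  have "x \<in> {a, b}" "\<sigma> x \<in> {a, b}" using ab(1) * assms by auto
  then have eq: "{a, b} = {x, \<sigma> x}" using * by auto
  fix y assume "y \<in> topspace X" "\<kappa> y = \<kappa> x"
  then have "y \<in> {a, b}" using ab(1) assms by auto
  then show "y = x \<or> y = \<sigma> x" unfolding eq by blast
qed

lemma \<sigma>_\<sigma>:
  assumes "x \<in> topspace X" "\<kappa> x = coset n z" "z \<notin> S"
  shows "\<sigma> (\<sigma> x) = x"
  using \<sigma>[OF assms] \<sigma>[of "\<sigma> x" z] assms by metis

text \<open>By continuity t v lies on the sheet s and E v in the ball; since \<open>coset n\<close>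
  is injective on the ball, t v can only be the point of the sheet over E v.\<close>

lemma lift_near:
  assumes "lift U E t" "continuous_on U E" "u \<in> U"
    and s: "lift (ball (E u) r) (\<lambda>w. w) s" "s (E u) = t u" "r > 0" "r \<le> 1 / 2"
      "openin X (s ` ball (E u) r)"
  obtains V where "open V" "u \<in> V" "\<And>v. v \<in> V \<inter> U \<Longrightarrow> E v \<in> ball (E u) r \<and> t v = s (E v)"
proof -
  have "openin (top_of_set U) {v \<in> U. t v \<in> s ` ball (E u) r}"
    using openin_continuous_map_preimage[OF _ s(5)] assms(1) unfolding lift_def by fastforce
  then obtain V1 where V1: "open V1" "{v \<in> U. t v \<in> s ` ball (E u) r} = U \<inter> V1"
    unfolding openin_open by blast
  have "openin (top_of_set U) (U \<inter> E -` ball (E u) r)"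
    using assms(2) continuous_openin_preimage_gen open_ball by blast
  then obtain V2 where V2: "open V2" "U \<inter> E -` ball (E u) r = U \<inter> V2" unfolding openin_open by blast
  show ?thesis
  proof (rule that[of "V1 \<inter> V2"])
    show "open (V1 \<inter> V2)" using V1 V2 by blast
    have "t u \<in> s ` ball (E u) r" using s(2,3) by (metis centre_in_ball imageI)
    then show "u \<in> V1 \<inter> V2" using assms(3) V1(2) V2(2) s(3) by auto
    fix v assume v: "v \<in> V1 \<inter> V2 \<inter> U"
    then obtain w where w: "w \<in> ball (E u) r" "t v = s w" using V1(2) by blast
    have Ev: "E v \<in> ball (E u) r" using v V2(2) by blast
    have "coset n w = coset n (E v)" using lift_coset[OF s(1) w(1)] lift_coset[OF assms(1), of v] w v by simp
    then have "w = E v" using coset_ball_inj[OF n_pos s(4) w(1) Ev] by blast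
    then show "E v \<in> ball (E u) r \<and> t v = s (E v)" using w Ev by simp
  qed
qed

text \<open>Separating \<open>s z\<close> and \<open>s' z\<close> by disjoint open sets keeps the
  two sections apart near z, and a fibre has no third point. This is the source of the continuity of
  \<open>\<sigma>\<close>.\<close>

lemma section_\<sigma>:
  assumes "lift (ball z r) (\<lambda>w. w) s" "lift (ball z r) (\<lambda>w. w) s'" "r > 0" "z \<notin> S" "s' z = \<sigma> (s z)"
  obtains e where "0 < e" "e \<le> r" "\<And>w. w \<in> ball z e \<Longrightarrow> w \<notin> S \<and> s' w = \<sigma> (s w)"
proof -
  have zin: "z \<in> ball z r" using assms by simp
  have x: "s z \<in> topspace X" "\<kappa> (s z) = coset n z" "s' z \<in> topspace X"
    using lift_in[OF assms(1) zin] lift_coset[OF assms(1) zin] lift_in[OF assms(2) zin] by auto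
  have "s z \<noteq> s' z" using \<sigma>_neq[OF x(1,2) assms(4)] assms(5) by simp
  then obtain O1 O2 where O: "openin X O1" "openin X O2" "s z \<in> O1" "s' z \<in> O2" "disjnt O1 O2"
    using cov x unfolding ramified_covering_def Hausdorff_space_def by metis
  have 1: "openin (top_of_set (ball z r)) {w \<in> ball z r. s w \<in> O1}"
    using openin_continuous_map_preimage[OF _ O(1)] assms(1) unfolding lift_def by fastforce
  have 2: "openin (top_of_set (ball z r)) {w \<in> ball z r. s' w \<in> O2}"
    using openin_continuous_map_preimage[OF _ O(2)] assms(2) unfolding lift_def by fastforce
  have "open ({w \<in> ball z r. s w \<in> O1} \<inter> {w \<in> ball z r. s' w \<in> O2} - S)"
    using 1 2 closed_S openin_open_eq by (meson open_Diff open_Int open_ball)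
  moreover have "z \<in> {w \<in> ball z r. s w \<in> O1} \<inter> {w \<in> ball z r. s' w \<in> O2} - S"
    using O zin assms by blast
  ultimately obtain e where e: "e > 0" "ball z e \<subseteq> {w \<in> ball z r. s w \<in> O1} \<inter> {w \<in> ball z r. s' w \<in> O2} - S"
    by (meson open_contains_ball_eq)
  show ?thesis
  proof (rule that[of "min e r"])
    fix w assume "w \<in> ball z (min e r)"
    then have w: "w \<in> ball z e" "w \<in> ball z r" by auto
    then have wS: "w \<notin> S" "s w \<in> O1" "s' w \<in> O2" using e by blast+
    then have "s w \<noteq> s' w" using O(5) by (auto simp: disjnt_def)
    moreover have "s w \<in> topspace X" "\<kappa> (s w) = coset n w" "s' w \<in> topspace X" "\<kappa> (s' w) = coset n w"
      using lift_in[OF assms(1) w(2)] lift_coset[OF assms(1) w(2)] lift_in[OF assms(2) w(2)] lift_coset[OF assms(2) w(2)]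
      by auto
    ultimately have "s' w = \<sigma> (s w)" using \<sigma>_fibre[of "s w" w "s' w"] wS by auto
    then show "w \<notin> S \<and> s' w = \<sigma> (s w)" using wS by blast
  qed (use e assms in auto)
qed

text \<open>Near u the lift t runs in one local section, and by \<open>section_\<sigma>\<close> its
  partner runs in the local section through \<open>\<sigma> (t u)\<close>.\<close>

lemma lift_\<sigma>:
  assumes t: "lift U E t" "continuous_on U E" "\<And>u. u \<in> U \<Longrightarrow> E u \<notin> S"
  shows "lift U E (\<lambda>u. \<sigma> (t u))"
proof (rule lift_locally)
  fix u assume u: "u \<in> U"
  have x: "t u \<in> topspace X" "\<kappa> (t u) = coset n (E u)" "E u \<notin> S"
    using lift_in[OF t(1) u] lift_coset[OF t(1) u] t(3)[OF u] by auto
  obtain r s where s: "0 < r" "r \<le> 1 / 2" "lift (ball (E u) r) (\<lambda>w. w) s" "s (E u) = t u"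
    "\<And>V. open V \<Longrightarrow> V \<subseteq> ball (E u) r \<Longrightarrow> openin X (s ` V)"
    using local_section[OF x] by metis
  have \<sigma>x: "\<sigma> (t u) \<in> topspace X" "\<kappa> (\<sigma> (t u)) = coset n (E u)"
    using \<sigma>[OF x] x by auto
  obtain r' s' where s': "0 < r'" "r' \<le> 1 / 2" "lift (ball (E u) r') (\<lambda>w. w) s'" "s' (E u) = \<sigma> (t u)"
    using local_section[OF \<sigma>x x(3)] by metis
  define q where "q = min r r'"
  have q: "q > 0" "lift (ball (E u) q) (\<lambda>w. w) s" "lift (ball (E u) q) (\<lambda>w. w) s'" "q \<le> r"
    using s(1) s'(1) lift_subset[OF s(3) subset_ball, of q] lift_subset[OF s'(3) subset_ball, of q]
    by (simp_all add: q_def)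
  obtain e where e: "0 < e" "e \<le> q" "\<And>w. w \<in> ball (E u) e \<Longrightarrow> w \<notin> S \<and> s' w = \<sigma> (s w)"
    using section_\<sigma>[OF q(2,3,1) x(3)] s(4) s'(4) by metis
  have le: "lift (ball (E u) e) (\<lambda>w. w) s" "openin X (s ` ball (E u) e)"
    using lift_subset[OF q(2) subset_ball[OF e(2)]] s(5)[OF open_ball subset_ball, of e] e(2) q(4) by simp_all
  obtain V where V: "open V" "u \<in> V" "\<And>v. v \<in> V \<inter> U \<Longrightarrow> E v \<in> ball (E u) e \<and> t v = s (E v)"
    by (rule lift_near[OF t(1,2) u le(1) s(4) e(1) _ le(2)], use e(2) q(4) s(2) in linarith, rule that; assumption)
  have "lift (V \<inter> U) E (\<lambda>v. s' (E v))"
  proof (rule lift_compose[OF q(3)])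
    show "continuous_on (V \<inter> U) E" using t(2) continuous_on_subset by blast
    show "E ` (V \<inter> U) \<subseteq> ball (E u) q" using V(3) subset_ball[OF e(2)] by blast
  qed simp
  moreover have "\<forall>w\<in>V \<inter> U. \<sigma> (t w) = s' (E w)" using V(3) e(3) by metis
  ultimately show "\<exists>V ta. open V \<and> u \<in> V \<and> lift (V \<inter> U) E ta \<and> (\<forall>w\<in>V \<inter> U. \<sigma> (t w) = ta w)"
    using V(1,2) by blast
qed

lemma lifts_agree_near:
  assumes "lift U E s" "lift U E t" "continuous_on U E" "u \<in> U" "E u \<notin> S" "s u = t u"
  obtains V where "open V" "u \<in> V" "\<And>v. v \<in> V \<inter> U \<Longrightarrow> s v = t v"
proof -
  have x: "s u \<in> topspace X" "\<kappa> (s u) = coset n (E u)"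
    using lift_in[OF assms(1,4)] lift_coset[OF assms(1,4)] by auto
  obtain r l where l: "0 < r" "r \<le> 1 / 2" "lift (ball (E u) r) (\<lambda>w. w) l" "l (E u) = s u"
    "\<And>V. open V \<Longrightarrow> V \<subseteq> ball (E u) r \<Longrightarrow> openin X (l ` V)"
    using local_section[OF x assms(5)] by metis
  have l': "openin X (l ` ball (E u) r)" "l (E u) = t u" using l(4,5) assms(6) by auto
  obtain V1 where V1: "open V1" "u \<in> V1" "\<And>v. v \<in> V1 \<inter> U \<Longrightarrow> E v \<in> ball (E u) r \<and> s v = l (E v)"
    by (rule lift_near[OF assms(1,3,4) l(3,4,1,2) l'(1)], rule that; assumption)
  obtain V2 where V2: "open V2" "u \<in> V2" "\<And>v. v \<in> V2 \<inter> U \<Longrightarrow> E v \<in> ball (E u) r \<and> t v = l (E v)"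
    by (rule lift_near[OF assms(2,3,4) l(3) l'(2) l(1,2) l'(1)], rule that; assumption)
  show ?thesis by (rule that[of "V1 \<inter> V2"]) (use V1 V2 in auto)
qed

text \<open>The set where the lifts agree is open, and so is its complement in U, because there s
  agrees with the lift \<open>\<sigma> (t u)\<close> instead.\<close>

lemma lift_dichotomy:
  assumes "connected U" "continuous_on U E" "\<And>u. u \<in> U \<Longrightarrow> E u \<notin> S" "lift U E s" "lift U E t"
  shows "(\<forall>u\<in>U. s u = t u) \<or> (\<forall>u\<in>U. s u = \<sigma> (t u))"
proof -
  have two: "s u = t u \<or> s u = \<sigma> (t u)" "t u \<noteq> \<sigma> (t u)" if "u \<in> U" for u
    using \<sigma>_fibre[of "t u" "E u" "s u"] \<sigma>_neq[of "t u" "E u"] lift_in lift_coset assms(3-5) that by metis+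
  have l\<sigma>: "lift U E (\<lambda>u. \<sigma> (t u))" using lift_\<sigma> assms by blast
  have step: "\<exists>T. openin (top_of_set U) T \<and> a \<in> T \<and> (\<forall>x\<in>T. (s a = t a) = (s x = t x))" if a: "a \<in> U" for a
  proof (cases "s a = t a")
    case True
    then obtain V where "open V" "a \<in> V" "\<And>v. v \<in> V \<inter> U \<Longrightarrow> s v = t v"
      using lifts_agree_near[OF assms(4,5,2) a] assms(3) a by blast
    then show ?thesis using True a by (intro exI[of _ "U \<inter> V"]) auto
  next
    case False
    then obtain V where V: "open V" "a \<in> V" "\<And>v. v \<in> V \<inter> U \<Longrightarrow> s v = \<sigma> (t v)"
      using lifts_agree_near[OF assms(4) l\<sigma> assms(2) a] assms(3) a two(1)[OF a] by blast
    then have "\<And>v. v \<in> V \<inter> U \<Longrightarrow> s v \<noteq> t v" using two(2) by (metis IntD2)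
    then show ?thesis using False a V(1,2) by (intro exI[of _ "U \<inter> V"]) auto
  qed
  have "(s a = t a) = (s b = t b)" if "a \<in> U" "b \<in> U" for a b
    by (rule connected_equivalence_relation[OF assms(1) that, of "\<lambda>a b. (s a = t a) = (s b = t b)"])
       (use step in auto)
  then show ?thesis using two(1) by blast
qed

text \<open>Over a neighbourhood of a branch point a section would be a continuous square root.\<close>

lemma no_section:
  assumes z: "z \<in> S" and N: "open N" "z \<in> N"
  shows "\<not> lift (N - {z}) (\<lambda>w. w) s"
proof
  assume s: "lift (N - {z}) (\<lambda>w. w) s"
  have "coset n z \<in> \<kappa> ` {x \<in> topspace X. \<exists>k\<ge>2. power_map_near X (torus n) \<kappa> x k}"
    using z cov unfolding ramified_covering_def S_def by simp
  then obtain x k where x: "x \<in> topspace X" "\<kappa> x = coset n z" "k \<ge> 2" "power_map_near X (torus n) \<kappa> x k"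
    by (smt (verit) imageE mem_Collect_eq)
  then obtain U V \<phi> \<psi> where U: "openin X U" "x \<in> U" "openin (torus n) V" "\<kappa> ` U \<subseteq> V"
    "homeomorphic_map (subtopology X U) (top_of_set (ball (0::complex) 1)) \<phi>"
    "homeomorphic_map (subtopology (torus n) V) (top_of_set (ball (0::complex) 1)) \<psi>"
    "\<psi> (coset n z) = 0"
    "\<And>u. u \<in> U \<Longrightarrow> \<psi> (\<kappa> u) = \<phi> u ^ k" unfolding power_map_near_def by auto
  obtain \<phi>' where \<phi>': "homeomorphic_maps (subtopology X U) (top_of_set (ball 0 1)) \<phi> \<phi>'"
    using U(5) homeomorphic_map_maps by blast
  obtain \<psi>' where \<psi>': "homeomorphic_maps (subtopology (torus n) V) (top_of_set (ball 0 1)) \<psi> \<psi>'"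
    using U(6) homeomorphic_map_maps by blast
  have UX: "topspace (subtopology X U) = U" using openin_subset[OF U(1)] by auto
  have VX: "topspace (subtopology (torus n) V) = V" using openin_subset[OF U(3)] by auto
  have \<phi>'inv: "\<phi> (\<phi>' v) = v \<and> \<phi>' v \<in> U" if "v \<in> ball 0 1" for v
    using \<phi>' that UX by (auto simp: homeomorphic_maps_def continuous_map_def)
  have \<psi>'inv: "\<psi> (\<psi>' v) = v \<and> \<psi>' v \<in> V" if "v \<in> ball 0 1" for v
    using \<psi>' that VX by (auto simp: homeomorphic_maps_def continuous_map_def)
  have \<psi>inv: "\<psi>' (\<psi> y) = y" if "y \<in> V" for y
    using \<psi>' that VX by (auto simp: homeomorphic_maps_def continuous_map_def)
  obtain r0 where r0: "r0 > 0" "ball z r0 \<subseteq> N" using open_contains_ball N by blast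
  define r where "r = min r0 (1/2)"
  have r: "r > 0" "r \<le> 1/2" "ball z r \<subseteq> N" using r0 by (auto simp: r_def)
  have rS: "w \<notin> S" if "w \<in> ball z r" "w \<noteq> z" for w
    using that lattice_dist[of z w] z S_lattice r(2) by auto
  define C where "C = coset n ` ball z r"
  obtain j where j: "homeomorphic_maps (top_of_set (ball z r)) (subtopology (torus n) C) (coset n) j"
    using coset_homeo[OF n_pos r(2)] homeomorphic_map_maps C_def by metis
  have opC: "openin (torus n) C" unfolding C_def by (rule coset_open) simp
  have CX: "topspace (subtopology (torus n) C) = C" using openin_subset[OF opC] by auto
  have jinv: "coset n (j y) = y \<and> j y \<in> ball z r" if "y \<in> C" for y
    using j that CX by (auto simp: homeomorphic_maps_def continuous_map_def)
  have "openin (top_of_set (ball 0 1)) (\<psi> ` (V \<inter> C))"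
  proof -
    have "openin (subtopology (torus n) V) (V \<inter> C)" using opC by (simp add: openin_subtopology_Int2)
    then show ?thesis using homeomorphic_imp_open_map[OF U(6)] unfolding open_map_def by blast
  qed
  then have "open (\<psi> ` (V \<inter> C))" using openin_open_eq open_ball by blast
  moreover have "0 \<in> \<psi> ` (V \<inter> C)"
  proof -
    have "coset n z \<in> V" using U(2,4) x(2) by auto
    moreover have "coset n z \<in> C" unfolding C_def using r(1) by auto
    ultimately show ?thesis using U(7) by (metis IntI imageI)
  qed
  ultimately obtain d0 where d0: "d0 > 0" "ball 0 d0 \<subseteq> \<psi> ` (V \<inter> C)"
    using open_contains_ball by metis
  define d where "d = min d0 1"
  have d: "d > 0" "d \<le> 1" "ball 0 d \<subseteq> \<psi> ` (V \<inter> C)" using d0 by (auto simp: d_def)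
  define D where "D = ball 0 d - {0::complex}"
  have D1: "v \<in> ball 0 1" if "v \<in> D" for v using that d by (auto simp: D_def)
  have \<psi>'C: "\<psi>' v \<in> C" if "v \<in> D" for v
  proof -
    obtain y where "y \<in> V \<inter> C" "v = \<psi> y" using d(3) \<open>v \<in> D\<close> unfolding D_def by blast
    then show ?thesis using \<psi>inv by auto
  qed
  \<comment> \<open>The point of the plane near z whose local coordinate under \<psi> is v.\<close>
  define w where "w v = j (\<psi>' v)" for v
  have w: "w v \<in> ball z r" "coset n (w v) = \<psi>' v" "w v \<noteq> z" if "v \<in> D" for v
  proof -
    show 1: "w v \<in> ball z r" "coset n (w v) = \<psi>' v" using jinv \<psi>'C[OF that] by (auto simp: w_def)
    show "w v \<noteq> z"
    proof
      assume "w v = z"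
      then have "\<psi> (\<psi>' v) = 0" using 1 U(7) by simp
      then show False using \<psi>'inv D1[OF that] that by (auto simp: D_def)
    qed
  qed
  have key: "s (w v) \<in> U \<and> \<phi> (s (w v)) ^ 2 = v" if v: "v \<in> D" for v
  proof -
    have wS: "w v \<notin> S" using rS w[OF v] by blast
    define F where "F = {y \<in> topspace X. \<kappa> y = coset n (w v)}"
    have F2: "card F = 2" using fibre_card[OF wS] by (simp add: F_def)
    \<comment> \<open>The k-th roots of v give k distinct points of U in a fibre of size 2. Hence k
      = 2, the whole fibre lies in U, and so does the value of the given section.\<close>
    define Rt where "Rt = {c::complex. c ^ k = v}"
    have cRt: "card Rt = k" unfolding Rt_def by (rule card_nth_roots) (use v x(3) in \<open>auto simp: D_def\<close>)
    have Rt1: "c \<in> ball 0 1" if "c \<in> Rt" for c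
    proof -
      have "cmod c ^ k < 1" using that D1[OF v] by (auto simp: Rt_def norm_power[symmetric])
      then have "cmod c < 1" using x(3) by (metis linorder_not_le one_le_power)
      then show ?thesis by simp
    qed
    have sub: "\<phi>' ` Rt \<subseteq> F \<inter> U"
    proof
      fix y assume "y \<in> \<phi>' ` Rt"
      then obtain c where c: "c \<in> Rt" "y = \<phi>' c" by blast
      have yU: "y \<in> U" "\<phi> y = c" using \<phi>'inv Rt1 c by auto
      have "\<psi> (\<kappa> y) = v" using U(8)[OF yU(1)] yU c by (simp add: Rt_def)
      moreover have "\<kappa> y \<in> V" using U(4) yU by blast
      ultimately have "\<kappa> y = \<psi>' v" using \<psi>inv by metis
      then show "y \<in> F \<inter> U" using yU(1) w(2)[OF v] openin_subset[OF U(1)] by (auto simp: F_def)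
    qed
    have inj: "inj_on \<phi>' Rt" using \<phi>'inv Rt1 by (metis inj_onI)
    have finF: "finite F" using F2 by (metis card.infinite zero_neq_numeral)
    have "k \<le> card F" using card_mono[OF finF] sub card_image[OF inj] cRt by (metis le_inf_iff)
    then have k2: "k = 2" using F2 x(3) by simp
    have "\<phi>' ` Rt = F" by (rule card_subset_eq[OF finF]) (use sub card_image[OF inj] cRt k2 F2 in auto)
    moreover have "w v \<in> N - {z}" using r(3) w[OF v] by blast
    then have "s (w v) \<in> F" using lift_in[OF s] lift_coset[OF s] by (auto simp: F_def)
    ultimately obtain c where "c \<in> Rt" "s (w v) = \<phi>' c" by blast
    then show ?thesis using \<phi>'inv[of c] Rt1[of c] k2 by (auto simp: Rt_def)
  qed
  have "continuous_map (top_of_set D) euclidean (\<lambda>v. \<phi> (s (w v)))"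
  proof -
    have "continuous_map (top_of_set (ball 0 1)) (torus n) \<psi>'"
      using \<psi>' by (auto simp: homeomorphic_maps_def continuous_map_in_subtopology)
    then have "continuous_map (top_of_set D) (torus n) \<psi>'"
      using D1 by (meson continuous_map_from_subtopology_mono subsetI)
    then have 1: "continuous_map (top_of_set D) (subtopology (torus n) C) \<psi>'"
      using \<psi>'C by (auto simp: continuous_map_in_subtopology)
    have J: "continuous_map (subtopology (torus n) C) (top_of_set (ball z r)) j"
      using j by (simp only: homeomorphic_maps_def)
    have "continuous_map (top_of_set D) euclidean w"
      using continuous_map_into_fulltopology[OF continuous_map_compose[OF 1 J]] by (simp only: w_def[abs_def] o_def)
    then have 2: "continuous_map (top_of_set D) (top_of_set (N - {z})) w"
      using w(1,3) r(3) by (auto simp: continuous_map_in_subtopology)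
    have "continuous_map (top_of_set D) X (s \<circ> w)" using continuous_map_compose[OF 2] s by (auto simp: lift_def)
    then have 3: "continuous_map (top_of_set D) (subtopology X U) (s \<circ> w)"
      using key by (auto simp: continuous_map_in_subtopology)
    have "continuous_map (subtopology X U) euclidean \<phi>"
      using \<phi>' by (auto simp: homeomorphic_maps_def continuous_map_in_subtopology)
    from continuous_map_compose[OF 3 this] show ?thesis by (simp only: o_def)
  qed
  then have "continuous_on (ball 0 d - {0}) (\<lambda>v. \<phi> (s (w v)))" by (simp add: D_def)
  then show False using no_sqrt_punctured_disc[OF d(1)] key D_def by blast
qed

text \<open>Lifts over open sets of the plane form a \<open>plane_torsor\<close> with \<sigma> as
  involution; the domain is the whole plane, so no monodromy can arise.\<close>

lemma lift_exists:
  fixes E :: "complex \<Rightarrow> real^2"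
  assumes "continuous_on UNIV E" "\<And>u. E u \<notin> S"
  obtains s where "lift UNIV E s"
proof -
  have cont: "continuous_on U E" for U using assms(1) continuous_on_subset by blast
  interpret T: plane_torsor "\<lambda>U. lift U E" \<sigma>
  proof
    fix U :: "complex set" and G assume "open U" and
      *: "\<And>z. z \<in> U \<Longrightarrow> \<exists>V H. open V \<and> z \<in> V \<and> lift V E H \<and> (\<forall>w\<in>V \<inter> U. G w = H w)"
    show "lift U E G"
    proof (rule lift_locally)
      fix u assume "u \<in> U"
      from *[OF this] obtain V H where "open V" "u \<in> V" "lift V E H" "\<forall>w\<in>V \<inter> U. G w = H w" by blast
      then show "\<exists>V t. open V \<and> u \<in> V \<and> lift (V \<inter> U) E t \<and> (\<forall>w\<in>V \<inter> U. G w = t w)"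
        using lift_subset[OF _ Int_lower1] by blast
    qed
  next
    fix U G assume "lift U E G"
    then show "lift U E (\<lambda>z. \<sigma> (G z))" by (rule lift_\<sigma>[OF _ cont assms(2)])
  next
    fix U :: "complex set" and G H assume "convex U" "lift U E G" "lift U E H"
    then show "(\<forall>z\<in>U. G z = H z) \<or> (\<forall>z\<in>U. G z = \<sigma> (H z))"
      by (intro lift_dichotomy[OF convex_connected cont assms(2)])
  next
    fix U :: "complex set" and G assume "U \<noteq> {}" "lift U E G"
    then obtain u where u: "u \<in> U" by blast
    have "\<sigma> (G u) \<noteq> G u"
      by (rule \<sigma>_neq[OF lift_in[OF \<open>lift U E G\<close> u] lift_coset[OF \<open>lift U E G\<close> u] assms(2)])
    then show "\<exists>z\<in>U. \<sigma> (G z) \<noteq> G z" using u by blast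
  next
    fix z
    obtain x where x: "x \<in> topspace X" "\<kappa> x = coset n (E z)" using fibre_point[OF assms(2)] .
    obtain r s where s: "0 < r" "lift (ball (E z) r) (\<lambda>w. w) s" using local_section[OF x assms(2)] by metis
    have "lift (E -` ball (E z) r) E (\<lambda>v. s (E v))" by (rule lift_compose[OF s(2) cont]) auto
    moreover have "open (E -` ball (E z) r)" by (rule open_vimage[OF open_ball assms(1)])
    ultimately show "\<exists>V G. open V \<and> z \<in> V \<and> lift V E G"
      using s(1) by (metis centre_in_ball vimageI)
  qed
  show ?thesis using T.global_section that by blast
qed

end

section \<open>The punctured surface and its charts\<close>

lemma connected_compl_lattice: "connected (- lattice)"
  using path_connected_complement_countable[OF _ countable_lattice] path_connected_imp_connected by simp

lemma coset_1_eq_0: "coset 1 z = coset 1 0 \<longleftrightarrow> z \<in> lattice"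
proof -
  have "coset 1 0 = coset 1 z \<longleftrightarrow> z \<in> lattice" by (simp add: coset_eq)
  then show ?thesis by metis
qed

context double_cover begin

text \<open>The surface \<open>X\<^sup>*\<close>; by \<open>Y_iff\<close> its points are those lying
  over noninteger points of the plane.\<close>

definition Y :: "'a topology" where "Y = punctured X (pr \<circ> \<kappa>)"

lemma Y_iff:
  assumes "x \<in> topspace X" "\<kappa> x = coset n z"
  shows "x \<in> topspace Y \<longleftrightarrow> z \<notin> lattice"
  using assms by (simp add: Y_def punctured_def pr_coset coset_1_eq_0 del: One_nat_def)

lemma topspace_Y_subset: "topspace Y \<subseteq> topspace X"
  by (auto simp: Y_def punctured_def)

lemma obtain_Y:
  assumes "x \<in> topspace Y"
  obtains z where "x \<in> topspace X" "\<kappa> x = coset n z" "z \<notin> lattice" "z \<notin> S"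
proof -
  have x: "x \<in> topspace X" using assms topspace_Y_subset by blast
  obtain z where z: "\<kappa> x = coset n z" using obtain_coord[OF x] .
  then have "z \<notin> lattice" using Y_iff x assms by blast
  then show ?thesis using that x z S_lattice by blast
qed

lemma openin_Y: "openin Y U \<longleftrightarrow> openin X U \<and> U \<subseteq> topspace Y"
proof -
  have "openin X {x \<in> topspace X. \<kappa> x \<in> coset n ` (- lattice)}"
    by (intro openin_continuous_map_preimage[OF continuous_\<kappa>] coset_open open_Compl closed_subset_lattice order_refl)
  also have "{x \<in> topspace X. \<kappa> x \<in> coset n ` (- lattice)} = topspace Y"
  proof (intro set_eqI iffI)
    fix x assume "x \<in> {x \<in> topspace X. \<kappa> x \<in> coset n ` (- lattice)}"
    then show "x \<in> topspace Y" using Y_iff by auto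
  next
    fix x assume x: "x \<in> topspace Y"
    then obtain z where "x \<in> topspace X" "\<kappa> x = coset n z" "z \<notin> lattice" by (rule obtain_Y)
    then show "x \<in> {x \<in> topspace X. \<kappa> x \<in> coset n ` (- lattice)}" by auto
  qed
  finally have "openin X (topspace Y)" .
  moreover have "Y = subtopology X (topspace Y)"
    unfolding Y_def punctured_def by (simp add: subtopology_restrict Int_absorb1 Collect_conj_eq)
  ultimately show ?thesis by (metis openin_open_subtopology)
qed

lemma Y_subtopology: "Y = subtopology X (topspace Y)"
  unfolding Y_def punctured_def by (simp add: subtopology_restrict Int_absorb1 Collect_conj_eq)

text \<open>An inverse chart of the translation structure, centred at x. The bound 1/2 makes
  \<open>coset n\<close> injective on the ball, and the last clause makes s an open map.\<close>

definition chart :: "'a \<Rightarrow> real^2 \<Rightarrow> real \<Rightarrow> (real^2 \<Rightarrow> 'a) \<Rightarrow> bool" where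
  "chart x z r s \<longleftrightarrow> 0 < r \<and> r \<le> 1 / 2 \<and> ball z r \<inter> lattice = {} \<and> lift (ball z r) (\<lambda>w. w) s \<and> s z = x \<and>
     (\<forall>V. open V \<and> V \<subseteq> ball z r \<longrightarrow> openin X (s ` V))"

lemma chart_shrink: "chart x z r s \<Longrightarrow> 0 < e \<Longrightarrow> e \<le> r \<Longrightarrow> chart x z e s"
  unfolding chart_def using subset_ball[of e r z] lift_subset[of "ball z r" _ s "ball z e"] by fastforce

lemma chart_exists:
  assumes "x \<in> topspace X" "\<kappa> x = coset n z" "z \<notin> lattice"
  obtains r s where "chart x z r s"
proof -
  have "z \<notin> S" using assms(3) S_lattice by blast
  then obtain r s where s: "0 < r" "r \<le> 1 / 2" "lift (ball z r) (\<lambda>w. w) s" "s z = x"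
    "\<And>V. open V \<Longrightarrow> V \<subseteq> ball z r \<Longrightarrow> openin X (s ` V)"
    using local_section[OF assms(1,2)] by metis
  have "open (- lattice)" by (intro open_Compl closed_subset_lattice order_refl)
  then obtain e where e: "e > 0" "ball z e \<subseteq> - lattice" using open_contains_ball assms(3) by blast
  have "chart x z (min r e) s"
    unfolding chart_def using s e lift_subset[OF s(3) subset_ball, of "min r e"] subset_ball[of "min r e"]
    by (auto simp: subset_iff)
  then show ?thesis using that by blast
qed

lemma chart_in:
  assumes "chart x z r s" "w \<in> ball z r"
  shows "s w \<in> topspace X" "\<kappa> (s w) = coset n w" "s w \<in> topspace Y" "w \<notin> lattice" "w \<notin> S"
proof -
  have l: "lift (ball z r) (\<lambda>w. w) s" using assms(1) by (simp add: chart_def)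
  show 1: "s w \<in> topspace X" "\<kappa> (s w) = coset n w"
    using lift_in[OF l assms(2)] lift_coset[OF l assms(2)] by auto
  show "w \<notin> lattice" using assms by (auto simp: chart_def)
  then show "s w \<in> topspace Y" "w \<notin> S" using Y_iff[OF 1] S_lattice by auto
qed

lemma chart_centre: "chart x z r s \<Longrightarrow> z \<in> ball z r" "chart x z r s \<Longrightarrow> s z = x"
  "chart x z r s \<Longrightarrow> 0 < r" "chart x z r s \<Longrightarrow> lift (ball z r) (\<lambda>w. w) s"
  by (auto simp: chart_def)

text \<open>To follow a property on a whole fibre, both sheets need charts over the same ball;
  \<open>section_\<sigma>\<close> allows the second to be taken as the \<sigma>-image of the
  first.\<close>

lemma chart_pair:
  assumes "z \<notin> lattice"
  obtains e s where "chart (s z) z e s" "chart (\<sigma> (s z)) z e (\<lambda>w. \<sigma> (s w))"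
proof -
  have zS: "z \<notin> S" using assms S_lattice by blast
  obtain x where x: "x \<in> topspace X" "\<kappa> x = coset n z" using fibre_point[OF zS] .
  obtain r s where s: "chart x z r s" using chart_exists[OF x assms] .
  have \<sigma>x: "\<sigma> x \<in> topspace X" "\<kappa> (\<sigma> x) = coset n z" using \<sigma>[OF x zS] x by auto
  obtain r' s' where s': "chart (\<sigma> x) z r' s'" using chart_exists[OF \<sigma>x assms] .
  define q where "q = min r r'"
  have q: "chart x z q s" "chart (\<sigma> x) z q s'"
    using chart_shrink[OF s, of q] chart_shrink[OF s', of q] chart_centre(3)[OF s] chart_centre(3)[OF s']
    by (auto simp: q_def)
  have szx: "s z = x" "s' z = \<sigma> (s z)" using chart_centre(2)[OF q(1)] chart_centre(2)[OF q(2)] by auto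
  obtain e where e: "0 < e" "e \<le> q" "\<And>w. w \<in> ball z e \<Longrightarrow> w \<notin> S \<and> s' w = \<sigma> (s w)"
    using section_\<sigma>[OF chart_centre(4)[OF q(1)] chart_centre(4)[OF q(2)] chart_centre(3)[OF q(1)] zS szx(2)]
    by metis
  have c: "chart x z e s" "chart (\<sigma> x) z e s'" using chart_shrink[OF _ e(1,2)] q by auto
  have "lift (ball z e) (\<lambda>w. w) (\<lambda>w. \<sigma> (s w))"
    by (rule lift_\<sigma>[OF chart_centre(4)[OF c(1)]]) (use e(3) in auto)
  moreover have "(\<lambda>w. \<sigma> (s w)) ` V = s' ` V" if "V \<subseteq> ball z e" for V
    using e(3) that by (metis (no_types, lifting) image_cong subsetD)
  ultimately have "chart (\<sigma> x) z e (\<lambda>w. \<sigma> (s w))"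
    using c(2) e(1) szx(1) unfolding chart_def by auto
  then show ?thesis using that c(1) szx(1) by metis
qed

text \<open>A predicate that holds on exactly one sheet everywhere would be a section near a branch point.\<close>

lemma locally_constant:
  assumes "S \<noteq> {}"
    and loc: "\<And>x z r s. chart x z r s \<Longrightarrow> \<exists>e. 0 < e \<and> e \<le> r \<and> (\<forall>w\<in>ball z e. Q (s w) = Q x)"
  shows "(\<forall>x\<in>topspace Y. Q x) \<or> (\<forall>x\<in>topspace Y. \<not> Q x)"
proof -
  define F where "F z = {x \<in> topspace X. \<kappa> x = coset n z}" for z
  have fib: "F w = {s w, \<sigma> (s w)}" if "chart x z e s" "w \<in> ball z e" for x z e s w
    unfolding F_def using chart_in[OF that] \<sigma>[of "s w" w] by auto
  \<comment> \<open>Both conditions on a fibre, Q everywhere and Q nowhere, are locally constant in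
    the base point, which ranges over a connected set.\<close>
  have pair: "\<exists>T. openin (top_of_set (- lattice)) T \<and> a \<in> T \<and>
      (\<forall>w\<in>T. (\<forall>x\<in>F a. Q x) = (\<forall>x\<in>F w. Q x) \<and> (\<forall>x\<in>F a. \<not> Q x) = (\<forall>x\<in>F w. \<not> Q x))"
    if a: "a \<in> - lattice" for a
  proof -
    obtain e s where s: "chart (s a) a e s" "chart (\<sigma> (s a)) a e (\<lambda>w. \<sigma> (s w))"
      by (rule chart_pair[of a]) (use a in auto)
    obtain e1 where e1: "0 < e1" "e1 \<le> e" "\<And>w. w \<in> ball a e1 \<Longrightarrow> Q (s w) = Q (s a)"
      using loc[OF s(1)] by metis
    obtain e2 where e2: "0 < e2" "e2 \<le> e" "\<And>w. w \<in> ball a e2 \<Longrightarrow> Q (\<sigma> (s w)) = Q (\<sigma> (s a))"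
      using loc[OF s(2)] by metis
    define e' where "e' = min e1 e2"
    have e': "0 < e'" "e' \<le> e" "ball a e' \<subseteq> ball a e1" "ball a e' \<subseteq> ball a e2"
      using e1 e2 by (auto simp: e'_def)
    have "ball a e' \<subseteq> - lattice" using chart_in(4)[OF s(1)] subset_ball[OF e'(2)] by blast
    then have "openin (top_of_set (- lattice)) (ball a e')" by (simp add: open_subset)
    moreover have "(\<forall>x\<in>F a. Q x) = (\<forall>x\<in>F w. Q x) \<and> (\<forall>x\<in>F a. \<not> Q x) = (\<forall>x\<in>F w. \<not> Q x)"
      if w: "w \<in> ball a e'" for w
    proof -
      have "F a = {s a, \<sigma> (s a)}" using fib[OF s(1)] chart_centre(1)[OF s(1)] by blast
      moreover have "F w = {s w, \<sigma> (s w)}" using fib[OF s(1)] subset_ball[OF e'(2)] w by blast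
      moreover have "Q (s w) = Q (s a)" "Q (\<sigma> (s w)) = Q (\<sigma> (s a))"
        using w e'(3,4) e1(3) e2(3) by blast+
      ultimately show ?thesis by auto
    qed
    ultimately show ?thesis using e'(1) by (metis centre_in_ball)
  qed
  have const: "(\<forall>x\<in>F a. Q x) = (\<forall>x\<in>F b. Q x) \<and> (\<forall>x\<in>F a. \<not> Q x) = (\<forall>x\<in>F b. \<not> Q x)"
    if "a \<in> - lattice" "b \<in> - lattice" for a b
    by (rule connected_equivalence_relation[OF connected_compl_lattice that])
       (use pair in auto)
  show ?thesis
  proof (rule ccontr)
    assume not: "\<not> ?thesis"
    \<comment> \<open>Since neither alternative holds on Y, constancy forces each fibre to contain
      one point with Q and one without; choosing the point with Q gives the section g.\<close>
    have mixed: "\<exists>x\<in>F z. Q x" "\<exists>x\<in>F z. \<not> Q x" if z: "z \<in> - lattice" for z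
    proof -
      obtain x where x: "x \<in> topspace Y" "Q x" using not by blast
      obtain a where a: "x \<in> F a" "a \<in> - lattice" by (rule obtain_Y[OF x(1)]) (simp add: that F_def)
      show "\<exists>x\<in>F z. Q x" using const[OF a(2) z] a(1) x(2) by blast
      obtain y where y: "y \<in> topspace Y" "\<not> Q y" using not by blast
      obtain b where b: "y \<in> F b" "b \<in> - lattice" by (rule obtain_Y[OF y(1)]) (simp add: that F_def)
      show "\<exists>x\<in>F z. \<not> Q x" using const[OF b(2) z] b(1) y(2) by blast
    qed
    then obtain g where g: "\<And>z. z \<in> - lattice \<Longrightarrow> g z \<in> F z \<and> Q (g z)" by metis
    have uniq: "x = g z" if "z \<in> - lattice" "x \<in> F z" "Q x" for x z
    proof (rule ccontr)
      assume "x \<noteq> g z"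
      moreover have zS: "z \<notin> S" using that S_lattice by blast
      moreover have gz: "g z \<in> topspace X" "\<kappa> (g z) = coset n z" using g[OF that(1)] by (auto simp: F_def)
      ultimately have "x = \<sigma> (g z)" using \<sigma>_fibre[OF gz zS] that by (auto simp: F_def)
      then have "F z = {g z, x}" using \<sigma>[OF gz zS] gz by (auto simp: F_def)
      then show False using mixed(2)[OF that(1)] g[OF that(1)] that by auto
    qed
    have "lift (- lattice) (\<lambda>w. w) g"
    proof (rule lift_locally)
      fix u assume u: "u \<in> - lattice"
      have gu: "g u \<in> topspace X" "\<kappa> (g u) = coset n u" using g[OF u] by (auto simp: F_def)
      obtain r s where s: "chart (g u) u r s" using chart_exists[OF gu] u by blast
      obtain e where e: "0 < e" "e \<le> r" "\<And>w. w \<in> ball u e \<Longrightarrow> Q (s w) = Q (g u)"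
        using loc[OF s] by blast
      have se: "chart (g u) u e s" using chart_shrink[OF s e(1,2)] .
      have "g w = s w" if "w \<in> ball u e" for w
        using uniq[of w "s w"] chart_in[OF se that] e(3)[OF that] g[OF u] by (auto simp: F_def)
      moreover have "lift (ball u e \<inter> - lattice) (\<lambda>w. w) s"
        using lift_subset[OF chart_centre(4)[OF se] Int_lower1] .
      ultimately show "\<exists>V t. open V \<and> u \<in> V \<and> lift (V \<inter> - lattice) (\<lambda>w. w) t \<and> (\<forall>w\<in>V \<inter> - lattice. g w = t w)"
        using e(1) by (intro exI[of _ "ball u e"] exI[of _ s]) auto
    qed
    moreover obtain P where P: "P \<in> S" using assms(1) by blast
    moreover have "ball P 1 - {P} \<subseteq> - lattice" using lattice_dist[of P] P S_lattice by fastforce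
    ultimately have "lift (ball P 1 - {P}) (\<lambda>w. w) g" using lift_subset by blast
    then show False using no_section[OF P open_ball, of P 1] by simp
  qed
qed

lemma lift_map:
  assumes f: "continuous_map Y X f" and s: "lift U (\<lambda>w. w) s" "U \<inter> lattice = {}"
    and E: "\<And>w. w \<in> U \<Longrightarrow> \<kappa> (f (s w)) = coset n (E w)"
  shows "lift U E (\<lambda>w. f (s w))"
proof -
  have "s ` U \<subseteq> topspace Y" using Y_iff[OF lift_in[OF s(1)] lift_coset[OF s(1)]] s(2) by blast
  then have "continuous_map (top_of_set U) Y s"
    using s(1) by (subst Y_subtopology) (auto simp: lift_def continuous_map_in_subtopology)
  then have "continuous_map (top_of_set U) X (\<lambda>w. f (s w))"
    using continuous_map_compose[OF _ f] by (force simp: o_def)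
  then show ?thesis using E by (simp add: lift_def)
qed

text \<open>In a chart, \<open>lift_dichotomy\<close> shows that agreement of f and g is locally
  constant, so that \<open>locally_constant\<close> decides it on all of Y.\<close>

lemma map_dichotomy:
  assumes "S \<noteq> {}" and fg: "continuous_map Y X f" "continuous_map Y X g"
    and E: "continuous_on (- lattice) E" "\<And>z. z \<notin> lattice \<Longrightarrow> E z \<notin> S"
    and lifts: "\<And>x z. x \<in> topspace Y \<Longrightarrow> \<kappa> x = coset n z \<Longrightarrow> \<kappa> (f x) = coset n (E z)"
      "\<And>x z. x \<in> topspace Y \<Longrightarrow> \<kappa> x = coset n z \<Longrightarrow> \<kappa> (g x) = coset n (E z)"
  shows "(\<forall>x\<in>topspace Y. f x = g x) \<or> (\<forall>x\<in>topspace Y. f x = \<sigma> (g x))"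
proof -
  have in_X: "f x \<in> topspace X" "g x \<in> topspace X" if "x \<in> topspace Y" for x
    using fg that by (metis continuous_map_image_subset_topspace image_subset_iff)+
  have two: "f x = g x \<or> f x = \<sigma> (g x)" "g x \<noteq> \<sigma> (g x)" if x: "x \<in> topspace Y" for x
  proof -
    obtain z where z: "\<kappa> x = coset n z" "z \<notin> lattice" using obtain_Y[OF x] by metis
    have k: "\<kappa> (g x) = coset n (E z)" "\<kappa> (f x) = \<kappa> (g x)" using lifts[OF x z(1)] by auto
    show "f x = g x \<or> f x = \<sigma> (g x)" "g x \<noteq> \<sigma> (g x)"
      using \<sigma>_fibre[OF in_X(2)[OF x] k(1) E(2)[OF z(2)] in_X(1)[OF x] k(2)]
        \<sigma>_neq[OF in_X(2)[OF x] k(1) E(2)[OF z(2)]] by auto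
  qed
  have "(\<forall>x\<in>topspace Y. f x = g x) \<or> (\<forall>x\<in>topspace Y. \<not> f x = g x)"
  proof (rule locally_constant[OF assms(1)])
    fix x z r s assume s: "chart x z r s"
    have lat: "ball z r \<inter> lattice = {}" using s by (simp add: chart_def)
    have lf: "lift (ball z r) E (\<lambda>w. f (s w))" "lift (ball z r) E (\<lambda>w. g (s w))"
      using lift_map[OF fg(1) chart_centre(4)[OF s] lat] lift_map[OF fg(2) chart_centre(4)[OF s] lat]
        lifts[OF chart_in(3,2)[OF s]] by auto
    have "(\<forall>u\<in>ball z r. f (s u) = g (s u)) \<or> (\<forall>u\<in>ball z r. f (s u) = \<sigma> (g (s u)))"
    proof (rule lift_dichotomy[OF connected_ball _ _ lf])
      show "continuous_on (ball z r) E" by (rule continuous_on_subset[OF E(1)]) (use lat in blast)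
      show "E u \<notin> S" if "u \<in> ball z r" for u using E(2) lat that by blast
    qed
    then have "\<forall>w\<in>ball z r. (f (s w) = g (s w)) = (f x = g x)"
      using two(2) chart_in(3)[OF s] chart_centre(1,2)[OF s] by metis
    then show "\<exists>e. 0 < e \<and> e \<le> r \<and> (\<forall>w\<in>ball z e. (f (s w) = g (s w)) = (f x = g x))"
      using chart_centre(3)[OF s] by blast
  qed
  then show ?thesis using two(1) by blast
qed

end

section \<open>Monodromy around branch points\<close>

text \<open>The torus lives over \<open>real^2\<close>, whereas logarithms and the domain of
  \<open>plane_torsor\<close> are complex; \<open>vc\<close> and \<open>cv\<close> translate between
  the two.\<close>

definition vc :: "complex \<Rightarrow> real^2" where "vc z = vector [Re z, Im z]"

definition cv :: "real^2 \<Rightarrow> complex" where "cv v = Complex (v $ 1) (v $ 2)"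

lemma vc_cv [simp]: "vc (cv v) = v"
  by (simp add: vc_def cv_def vec_eq_iff forall_2)

lemma cv_vc [simp]: "cv (vc z) = z"
  by (simp add: vc_def cv_def complex_eq_iff)

lemma vc_add: "vc (z + w) = vc z + vc w"
  and vc_uminus: "vc (- z) = - vc z" by (simp_all add: vc_def vec_eq_iff forall_2)

lemma linear_vc: "linear vc"
  by (rule linearI) (simp_all add: vc_def vec_eq_iff forall_2)

lemma linear_cv: "linear cv"
  by (rule linearI) (simp_all add: cv_def complex_eq_iff)

lemma continuous_vc: "continuous_on U vc"
  by (rule linear_continuous_on) (simp add: linear_conv_bounded_linear[symmetric] linear_vc)

lemma continuous_cv: "continuous_on U cv"
  by (rule linear_continuous_on) (simp add: linear_conv_bounded_linear[symmetric] linear_cv)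

lemma dist_vc: "dist (vc z) (vc w) = dist z w"
  by (simp add: vc_def dist_vec_def L2_set_def sum_2 dist_norm cmod_def)

text \<open>Polar coordinates about \<open>z0\<close>, with the radius capped so that they are defined on the whole plane.\<close>

definition polar :: "complex \<Rightarrow> complex \<Rightarrow> complex" where
  "polar z0 \<zeta> = z0 + exp (Complex (min (Re \<zeta>) (- 1)) (Im \<zeta>))"

text \<open>The cap -1 keeps the radius at most exp (-1), below the minimal distance 1 of lattice
  points, so that no further branch point is met.\<close>

lemma polar_in: "polar z0 \<zeta> \<in> ball z0 1 - {z0}"
proof -
  have "exp (min (Re \<zeta>) (- 1)) < exp 0" by (subst exp_less_cancel_iff) simp
  then show ?thesis by (simp add: polar_def dist_norm)
qed

lemma continuous_polar: "continuous_on U (polar z0)"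
proof -
  have "continuous_on U (\<lambda>\<zeta>. complex_of_real (min (Re \<zeta>) (- 1)) + \<i> * complex_of_real (Im \<zeta>))"
    by (intro continuous_intros)
  then show ?thesis unfolding polar_def Complex_eq by (intro continuous_intros)
qed

lemma polar_period: "polar z0 (\<zeta> + 2 * of_real pi * \<i>) = polar z0 \<zeta>"
proof -
  have "Complex (min (Re \<zeta>) (- 1)) (Im \<zeta> + 2 * pi) = Complex (min (Re \<zeta>) (- 1)) (Im \<zeta>) + 2 * of_real pi * \<i>"
    by (simp add: complex_eq_iff)
  then show ?thesis by (simp add: polar_def exp_add)
qed

text \<open>Dividing by \<open>w1 - z0\<close> moves w1 to 1, where the principal logarithm is
  continuous; this gives a continuous branch near w1. Below the radius exp (-1) the cap in
  \<open>polar\<close> is inactive.\<close>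

lemma polar_branch:
  assumes "w1 \<in> ball z0 (exp (- 1)) - {z0}"
  obtains V b where "open V" "w1 \<in> V" "V \<subseteq> ball z0 (exp (- 1)) - {z0}" "continuous_on V b"
    "\<And>w. w \<in> V \<Longrightarrow> polar z0 (b w) = w"
    "\<And>w. w \<in> V \<Longrightarrow> \<exists>k::int. b w = Ln (w - z0) + of_int k * (2 * of_real pi * \<i>)"
proof -
  define q where "q w = (w - z0) / (w1 - z0)" for w
  define V where "V = (ball z0 (exp (- 1)) - {z0}) \<inter> q -` (- \<real>\<^sub>\<le>\<^sub>0)"
  define b where "b w = Ln (w1 - z0) + Ln (q w)" for w
  have w1: "w1 \<noteq> z0" using assms by simp
  have contq: "continuous_on U q" for U unfolding q_def using w1 by (intro continuous_intros) auto
  have "open (q -` (- \<real>\<^sub>\<le>\<^sub>0))"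
    by (rule open_vimage[OF _ contq]) (auto intro: open_Compl closed_nonpos_Reals_complex)
  then have oV: "open V" unfolding V_def by (intro open_Int open_delete) auto
  have "q w1 = 1" using w1 by (simp add: q_def)
  then have w1V: "w1 \<in> V" using assms by (simp add: V_def)
  have exb: "exp (b w) = w - z0" if "w \<in> V" for w using that w1 by (simp add: b_def exp_add V_def q_def)
  show ?thesis
  proof (rule that[OF oV w1V])
    show "V \<subseteq> ball z0 (exp (- 1)) - {z0}" by (auto simp: V_def)
    show "continuous_on V b"
      unfolding b_def by (intro continuous_on_add continuous_on_const continuous_on_Ln' contq) (auto simp: V_def)
    fix w assume w: "w \<in> V"
    have "cmod (w - z0) < exp (- 1)" using w by (simp add: V_def dist_norm norm_minus_commute)
    then have "exp (Re (b w)) < exp (- 1)" using exb[OF w] by (metis norm_exp_eq_Re)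
    then have "Complex (min (Re (b w)) (- 1)) (Im (b w)) = b w" by (simp add: complex_eq_iff)
    then show "polar z0 (b w) = w" using exb[OF w] by (simp add: polar_def)
    have "exp (b w) = exp (Ln (w - z0))" using exb[OF w] w by (simp add: V_def)
    then obtain k where "b w = Ln (w - z0) + (of_int (2 * k) * pi) * \<i>"
      using exp_eq[of "b w" "Ln (w - z0)"] by blast
    then show "\<exists>k::int. b w = Ln (w - z0) + of_int k * (2 * of_real pi * \<i>)"
      by (intro exI[of _ k]) (simp add: mult_ac)
  qed
qed

lemma periodic_int:
  assumes "\<And>\<zeta>. s (\<zeta> + c) = s \<zeta>"
  shows "s (\<zeta> + of_int k * c) = (s (\<zeta>::complex))"
proof (induction k rule: int_induct[where k = 0])
  case (step1 i)
  then show ?case using assms[of "\<zeta> + of_int i * c"] by (simp add: algebra_simps)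
next
  case (step2 i)
  then show ?case using assms[of "\<zeta> + of_int (i - 1) * c"] by (simp add: algebra_simps)
qed simp

context double_cover begin

text \<open>Sections are open maps, so continuity may be tested after composing with one.\<close>

lemma continuous_by_charts:
  assumes in_X: "\<And>x. x \<in> topspace Y \<Longrightarrow> f x \<in> topspace X"
    and charts: "\<And>x z r s. chart x z r s \<Longrightarrow> \<exists>e E. 0 < e \<and> e \<le> r \<and> lift (ball z e) E (\<lambda>w. f (s w))"
  shows "continuous_map Y X f"
  unfolding continuous_map_def
proof (intro conjI allI impI)
  show "f \<in> topspace Y \<rightarrow> topspace X" using in_X by blast
  fix W assume W: "openin X W"
  show "openin Y {x \<in> topspace Y. f x \<in> W}"
  proof (subst openin_subopen, intro ballI)
    fix x assume "x \<in> {x \<in> topspace Y. f x \<in> W}"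
    then have x: "x \<in> topspace Y" "f x \<in> W" by auto
    obtain z where z: "x \<in> topspace X" "\<kappa> x = coset n z" "z \<notin> lattice" using obtain_Y[OF x(1)] by metis
    obtain r s where s0: "chart x z r s" using chart_exists[OF z] .
    obtain e E where e: "0 < e" "e \<le> r" "lift (ball z e) E (\<lambda>w. f (s w))" using charts[OF s0] by blast
    have s: "chart x z e s" using chart_shrink[OF s0 e(1,2)] .
    have "openin (top_of_set (ball z e)) {w \<in> ball z e. f (s w) \<in> W}"
      using openin_continuous_map_preimage[OF _ W] e(3) unfolding lift_def by fastforce
    then have V: "open {w \<in> ball z e. f (s w) \<in> W}" (is "open ?V") using openin_open_eq open_ball by blast
    have "openin X (s ` ?V)" using s V unfolding chart_def by blast
    then have "openin Y (s ` ?V)" using chart_in(3)[OF s] by (auto simp: openin_Y)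
    moreover have "x \<in> s ` ?V" using chart_centre(1,2)[OF s] x(2) by force
    moreover have "s ` ?V \<subseteq> {x \<in> topspace Y. f x \<in> W}" using chart_in(3)[OF s] by auto
    ultimately show "\<exists>T. openin Y T \<and> x \<in> T \<and> T \<subseteq> {x \<in> topspace Y. f x \<in> W}" by blast
  qed
qed

text \<open>Otherwise \<open>s\<close> would descend to a section over a punctured neighbourhood of \<open>N z0\<close>.\<close>

lemma polar_monodromy:
  assumes N: "continuous_on UNIV N" "continuous_on UNIV N'" "\<And>z. N' (N z) = z" "\<And>v. N (N' v) = v"
    and z0: "N z0 \<in> S" "\<And>z. z \<in> ball z0 1 - {z0} \<Longrightarrow> N z \<notin> S"
    and s: "lift UNIV (\<lambda>\<zeta>. N (polar z0 \<zeta>)) s"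
  shows "s (\<zeta> + 2 * of_real pi * \<i>) = \<sigma> (s \<zeta>)"
proof -
  let ?c = "2 * complex_of_real pi * \<i>"
  have contE: "continuous_on UNIV (\<lambda>\<zeta>. N (polar z0 \<zeta>))"
    by (rule continuous_on_compose2[OF N(1) continuous_polar]) simp
  have s': "lift UNIV (\<lambda>\<zeta>. N (polar z0 \<zeta>)) (\<lambda>\<zeta>. s (\<zeta> + ?c))"
    by (rule lift_compose[OF s]) (auto simp: polar_period intro!: continuous_intros)
  have "(\<forall>\<zeta>\<in>UNIV. s (\<zeta> + ?c) = s \<zeta>) \<or> (\<forall>\<zeta>\<in>UNIV. s (\<zeta> + ?c) = \<sigma> (s \<zeta>))"
    by (rule lift_dichotomy[OF connected_UNIV contE z0(2)[OF polar_in] s' s])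
  moreover have False if eq: "\<forall>\<zeta>. s (\<zeta> + ?c) = s \<zeta>"
  proof -
    define D where "D = N' -` ball z0 (exp (- 1))"
    have D: "open D" unfolding D_def by (rule open_vimage[OF open_ball N(2)])
    have ND: "N z0 \<in> D" by (simp add: D_def N(3))
    \<comment> \<open>The principal \<open>Ln\<close> jumps across its cut, but by a period of s;
      near each point it may therefore be replaced by a continuous branch b.\<close>
    have "lift (D - {N z0}) (\<lambda>w. w) (\<lambda>w. s (Ln (N' w - z0)))"
    proof (rule lift_locally)
      fix u assume u: "u \<in> D - {N z0}"
      then have u': "N' u \<in> ball z0 (exp (- 1)) - {z0}" using N(4)[of u] by (auto simp: D_def)
      obtain V b where V: "open V" "N' u \<in> V" "V \<subseteq> ball z0 (exp (- 1)) - {z0}" "continuous_on V b"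
        "\<And>w. w \<in> V \<Longrightarrow> polar z0 (b w) = w"
        "\<And>w. w \<in> V \<Longrightarrow> \<exists>k::int. b w = Ln (w - z0) + of_int k * ?c"
        using polar_branch[OF u'] by blast
      have "lift (N' -` V) (\<lambda>w. w) (\<lambda>w. s (b (N' w)))"
      proof (rule lift_compose[OF s])
        show "continuous_on (N' -` V) (\<lambda>w. b (N' w))"
          by (rule continuous_on_compose2[OF V(4) continuous_on_subset[OF N(2)]]) auto
      qed (use V(5) N(4) in auto)
      moreover have "s (Ln (N' w - z0)) = s (b (N' w))" if "w \<in> N' -` V" for w
        using V(6)[of "N' w"] that periodic_int[of s ?c] eq by auto
      ultimately show "\<exists>V t. open V \<and> u \<in> V \<and> lift (V \<inter> (D - {N z0})) (\<lambda>w. w) t \<and>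
          (\<forall>w\<in>V \<inter> (D - {N z0}). s (Ln (N' w - z0)) = t w)"
        using open_vimage[OF V(1) N(2)] V(2) lift_subset[OF _ Int_lower1]
        by (intro exI[of _ "N' -` V"] exI[of _ "\<lambda>w. s (b (N' w))"]) auto
    qed
    then show False using no_section[OF z0(1) D ND] by blast
  qed
  ultimately show ?thesis by blast
qed

end

section \<open>Lifting linear maps\<close>

locale linear_symmetry = double_cover +
  fixes M M' :: "real^2 \<Rightarrow> real^2"
  assumes linear_M: "linear M" "linear M'"
    and M_inverse: "\<And>v. M (M' v) = v" "\<And>v. M' (M v) = v"
    and M_lattice: "\<And>v. M v \<in> lattice \<longleftrightarrow> v \<in> lattice"
    and M_S: "\<And>z. M z \<in> S \<longleftrightarrow> z \<in> S"
begin

lemma continuous_M: "continuous_on U M" "continuous_on U M'"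
  using linear_M linear_conv_bounded_linear linear_continuous_on by blast+

lemma continuous_M_vc: "continuous_on U (\<lambda>z. M (vc z))"
  by (rule continuous_on_compose2[OF continuous_M(1)[of UNIV] continuous_vc]) simp

text \<open>A bijection between the fibres over \<open>z\<close> and \<open>M z\<close> is encoded by its graph.\<close>

definition match :: "'a \<Rightarrow> 'a \<Rightarrow> ('a \<times> 'a) set" where
  "match a b = {(a, b), (\<sigma> a, \<sigma> b)}"

text \<open>Exchanging the sheets over \<open>M z\<close> gives the only other bijection between the
  two fibres.\<close>

definition flip :: "('a \<times> 'a) set \<Rightarrow> ('a \<times> 'a) set" where
  "flip g = (\<lambda>(a, b). (a, \<sigma> b)) ` g"

definition over :: "real^2 \<Rightarrow> 'a \<Rightarrow> 'a \<Rightarrow> bool" where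
  "over z a b \<longleftrightarrow> z \<notin> S \<and> a \<in> topspace X \<and> b \<in> topspace X \<and> \<kappa> a = coset n z \<and> \<kappa> b = coset n (M z)"

lemma over_facts:
  assumes "over z a b"
  shows "\<sigma> (\<sigma> a) = a" "\<sigma> (\<sigma> b) = b" "\<sigma> a \<noteq> a" "\<sigma> b \<noteq> b"
    "\<And>a' b'. over z a' b' \<Longrightarrow> (a' = a \<or> a' = \<sigma> a) \<and> (b' = b \<or> b' = \<sigma> b)"
proof -
  have a: "a \<in> topspace X" "\<kappa> a = coset n z" "z \<notin> S" and b: "b \<in> topspace X" "\<kappa> b = coset n (M z)" "M z \<notin> S"
    using assms M_S by (auto simp: over_def)
  show "\<sigma> (\<sigma> a) = a" "\<sigma> (\<sigma> b) = b" "\<sigma> a \<noteq> a" "\<sigma> b \<noteq> b"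
    using \<sigma>_\<sigma>[OF a] \<sigma>_\<sigma>[OF b] \<sigma>_neq[OF a] \<sigma>_neq[OF b] by auto
  show "(a' = a \<or> a' = \<sigma> a) \<and> (b' = b \<or> b' = \<sigma> b)" if "over z a' b'" for a' b'
    using \<sigma>_fibre[OF a, of a'] \<sigma>_fibre[OF b, of b'] that a b by (auto simp: over_def)
qed

lemma flip_match: "flip (match a b) = match a (\<sigma> b)"
  by (simp add: flip_def match_def)

lemma match_\<sigma>\<sigma>: "over z a b \<Longrightarrow> match (\<sigma> a) (\<sigma> b) = match a b"
  and match_\<sigma>: "over z a b \<Longrightarrow> match (\<sigma> a) b = match a (\<sigma> b)"
  and match_neq: "over z a b \<Longrightarrow> match a (\<sigma> b) \<noteq> match a b"
  using over_facts(1-4)[of z a b] by (auto simp: match_def doubleton_eq_iff)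

definition matching_near :: "complex set \<Rightarrow> (complex \<Rightarrow> ('a \<times> 'a) set) \<Rightarrow> complex \<Rightarrow> bool" where
  "matching_near U G z \<longleftrightarrow> (\<exists>V s t. open V \<and> z \<in> V \<and> (\<forall>w\<in>V. vc w \<notin> S) \<and> lift V vc s \<and> lift V (\<lambda>w. M (vc w)) t \<and>
     (\<forall>w\<in>V \<inter> U. G w = match (s w) (t w)))"

text \<open>At branch points the value is fixed to be \<open>{}\<close>, which \<open>flip\<close>
  leaves unchanged. Matchings are thus defined on whole convex sets, branch points included, as
  \<open>plane_torsor\<close> demands.\<close>

definition matching :: "complex set \<Rightarrow> (complex \<Rightarrow> ('a \<times> 'a) set) \<Rightarrow> bool" where
  "matching U G \<longleftrightarrow> (\<forall>z\<in>U. (vc z \<in> S \<longrightarrow> G z = {}) \<and> (vc z \<notin> S \<longrightarrow> matching_near U G z))"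

lemma matching_nearI:
  assumes "open V" "z \<in> V" "\<And>w. w \<in> V \<Longrightarrow> vc w \<notin> S" "lift V vc s" "lift V (\<lambda>w. M (vc w)) t"
    "\<And>w. w \<in> V \<Longrightarrow> w \<in> U \<Longrightarrow> G w = match (s w) (t w)"
  shows "matching_near U G z"
  unfolding matching_near_def using assms by (intro exI[of _ V] exI[of _ s] exI[of _ t]) auto

lemma matching_empty: "matching U G \<Longrightarrow> z \<in> U \<Longrightarrow> vc z \<in> S \<Longrightarrow> G z = {}"
  by (simp add: matching_def)

lemma matching_at:
  assumes "matching U G" "z \<in> U" "vc z \<notin> S"
  obtains V s t where "open V" "z \<in> V" "\<And>w. w \<in> V \<Longrightarrow> vc w \<notin> S" "lift V vc s" "lift V (\<lambda>w. M (vc w)) t"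
    "\<And>w. w \<in> V \<Longrightarrow> w \<in> U \<Longrightarrow> G w = match (s w) (t w)" "\<And>w. w \<in> V \<Longrightarrow> over (vc w) (s w) (t w)"
proof -
  from assms(1)[unfolded matching_def matching_near_def, THEN bspec, OF assms(2), THEN conjunct2, THEN mp, OF assms(3)]
  obtain V s t where V: "open V" "z \<in> V" "\<forall>w\<in>V. vc w \<notin> S" "lift V vc s" "lift V (\<lambda>w. M (vc w)) t"
    "\<forall>w\<in>V \<inter> U. G w = match (s w) (t w)" by (elim exE conjE) (rule that)
  have ov: "over (vc w) (s w) (t w)" if "w \<in> V" for w
    unfolding over_def using lift_in[OF V(4) that] lift_coset[OF V(4) that] lift_in[OF V(5) that]
      lift_coset[OF V(5) that] V(3) that by auto
  have eq: "G w = match (s w) (t w)" if "w \<in> V" "w \<in> U" for w using V(6) that by blast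
  show ?thesis by (rule that[OF V(1,2) bspec[OF V(3)] V(4,5) eq ov])
qed

lemma matching_flip:
  assumes "matching U G"
  shows "matching U (\<lambda>z. flip (G z))"
  unfolding matching_def
proof (intro ballI conjI impI)
  fix z assume z: "z \<in> U"
  show "flip (G z) = {}" if "vc z \<in> S" using matching_empty[OF assms z that] by (simp add: flip_def)
  show "matching_near U (\<lambda>w. flip (G w)) z" if zS: "vc z \<notin> S"
  proof -
    obtain V s t where V: "open V" "z \<in> V" "\<And>w. w \<in> V \<Longrightarrow> vc w \<notin> S" "lift V vc s" "lift V (\<lambda>w. M (vc w)) t"
      "\<And>w. w \<in> V \<Longrightarrow> w \<in> U \<Longrightarrow> G w = match (s w) (t w)"
      by (rule matching_at[OF assms z zS]) (rule that; assumption)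
    have "lift V (\<lambda>w. M (vc w)) (\<lambda>w. \<sigma> (t w))"
      by (rule lift_\<sigma>[OF V(5) continuous_M_vc]) (use V(3) M_S in auto)
    then show ?thesis by (intro matching_nearI[OF V(1,2) _ V(4)]) (use V(3,6) flip_match in auto)
  qed
qed

lemma matching_locally:
  assumes "\<And>z. z \<in> U \<Longrightarrow> \<exists>V H. open V \<and> z \<in> V \<and> matching V H \<and> (\<forall>w\<in>V \<inter> U. G w = H w)"
  shows "matching U G"
  unfolding matching_def
proof (intro ballI conjI impI)
  fix z assume z: "z \<in> U"
  obtain V H where V: "open V" "z \<in> V" "matching V H" "\<forall>w\<in>V \<inter> U. G w = H w"
    using assms[OF z] by blast
  show "G z = {}" if "vc z \<in> S" using matching_empty[OF V(3,2) that] V(2,4) z by blast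
  show "matching_near U G z" if zS: "vc z \<notin> S"
  proof -
    obtain W s t where W: "open W" "z \<in> W" "\<And>w. w \<in> W \<Longrightarrow> vc w \<notin> S" "lift W vc s" "lift W (\<lambda>w. M (vc w)) t"
      "\<And>w. w \<in> W \<Longrightarrow> w \<in> V \<Longrightarrow> H w = match (s w) (t w)"
      by (rule matching_at[OF V(3,2) zS]) (rule that; assumption)
    show ?thesis
      by (rule matching_nearI[OF _ _ _ lift_subset[OF W(4) Int_lower1] lift_subset[OF W(5) Int_lower1], of V])
        (use W V in auto)
  qed
qed

lemma countable_vc_S: "countable {z. vc z \<in> S}"
proof -
  have "z \<in> cv ` lattice" if "vc z \<in> S" for z using subsetD[OF S_lattice that] by (metis cv_vc imageI)
  then have "{z. vc z \<in> S} \<subseteq> cv ` lattice" by blast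
  then show ?thesis by (rule countable_subset[OF _ countable_image[OF countable_lattice]])
qed

lemma matching_dichotomy_at:
  assumes "matching U G" "matching U H" "z \<in> U" "vc z \<notin> S"
  shows "G z = H z \<or> G z = flip (H z)" "flip (H z) \<noteq> H z"
proof -
  obtain s t where a: "G z = match (s z) (t z)" "over (vc z) (s z) (t z)"
    by (rule matching_at[OF assms(1,3,4)]) (use assms(3) in auto)
  obtain s' t' where b: "H z = match (s' z) (t' z)" "over (vc z) (s' z) (t' z)"
    by (rule matching_at[OF assms(2,3,4)]) (use assms(3) in auto)
  show "flip (H z) \<noteq> H z" using b match_neq flip_match by simp
  show "G z = H z \<or> G z = flip (H z)"
    using over_facts(5)[OF b(2) a(2)] a b match_\<sigma>[OF b(2)] match_\<sigma>\<sigma>[OF b(2)] flip_match by auto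
qed

text \<open>Without the countable set of branch points U stays connected, and there agreement is
  locally constant; at the branch points both matchings are \<open>{}\<close>.\<close>

lemma matching_dichotomy:
  assumes U: "open U" "convex U" and G: "matching U G" "matching U H"
  shows "(\<forall>z\<in>U. G z = H z) \<or> (\<forall>z\<in>U. G z = flip (H z))"
proof -
  define U' where "U' = U - {z. vc z \<in> S}"
  have "connected U'" unfolding U'_def
    by (rule connected_open_diff_countable) (use U countable_vc_S convex_connected in auto)
  have loc: "\<exists>T. openin (top_of_set U') T \<and> a \<in> T \<and> (\<forall>w\<in>T. (G a = H a) = (G w = H w))" if "a \<in> U'" for a
  proof -
    have a: "a \<in> U" "vc a \<notin> S" using that by (auto simp: U'_def)
    obtain V s t where V: "open V" "a \<in> V" "\<And>w. w \<in> V \<Longrightarrow> vc w \<notin> S" "lift V vc s" "lift V (\<lambda>w. M (vc w)) t"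
      "\<And>w. w \<in> V \<Longrightarrow> w \<in> U \<Longrightarrow> G w = match (s w) (t w)" "\<And>w. w \<in> V \<Longrightarrow> over (vc w) (s w) (t w)"
      by (rule matching_at[OF G(1) a]) (rule that; assumption)
    obtain V' s' t' where V': "open V'" "a \<in> V'" "\<And>w. w \<in> V' \<Longrightarrow> vc w \<notin> S" "lift V' vc s'" "lift V' (\<lambda>w. M (vc w)) t'"
      "\<And>w. w \<in> V' \<Longrightarrow> w \<in> U \<Longrightarrow> H w = match (s' w) (t' w)" "\<And>w. w \<in> V' \<Longrightarrow> over (vc w) (s' w) (t' w)"
      by (rule matching_at[OF G(2) a]) (rule that; assumption)
    have "open (V \<inter> V' \<inter> U)" "a \<in> V \<inter> V' \<inter> U" using V(1,2) V'(1,2) U(1) a by auto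
    then obtain e where e: "e > 0" "ball a e \<subseteq> V \<inter> V' \<inter> U" using open_contains_ball by metis
    have sub: "ball a e \<subseteq> V" "ball a e \<subseteq> V'" "ball a e \<subseteq> U" using e by auto
    have nS: "vc w \<notin> S" "M (vc w) \<notin> S" if "w \<in> ball a e" for w using V(3) sub that M_S by blast+
    have ds: "(\<forall>u\<in>ball a e. s u = s' u) \<or> (\<forall>u\<in>ball a e. s u = \<sigma> (s' u))"
      by (rule lift_dichotomy[OF connected_ball continuous_vc nS(1) lift_subset[OF V(4) sub(1)] lift_subset[OF V'(4) sub(2)]])
    have dt: "(\<forall>u\<in>ball a e. t u = t' u) \<or> (\<forall>u\<in>ball a e. t u = \<sigma> (t' u))"
      by (rule lift_dichotomy[OF connected_ball continuous_M_vc nS(2) lift_subset[OF V(5) sub(1)] lift_subset[OF V'(5) sub(2)]])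
    have m: "G w = match (s w) (t w)" "H w = match (s' w) (t' w)" "over (vc w) (s' w) (t' w)" if "w \<in> ball a e" for w
      using V(6) V'(6,7) sub that by blast+
    have "(\<forall>u\<in>ball a e. G u = H u) \<or> (\<forall>u\<in>ball a e. G u = flip (H u))"
      using ds dt m match_\<sigma>[OF m(3)] match_\<sigma>\<sigma>[OF m(3)] flip_match by auto
    then have "\<forall>w\<in>ball a e. (G a = H a) = (G w = H w)"
    proof
      assume "\<forall>u\<in>ball a e. G u = H u"
      then show ?thesis using e(1) by (metis centre_in_ball)
    next
      assume f: "\<forall>u\<in>ball a e. G u = flip (H u)"
      have "G w \<noteq> H w" if "w \<in> ball a e" for w
        using f that matching_dichotomy_at(2)[OF G] sub(3) nS by (metis subsetD)
      then show ?thesis using e(1) by (metis centre_in_ball)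
    qed
    moreover have "openin (top_of_set U') (ball a e)"
      by (rule open_subset) (use sub(3) nS in \<open>auto simp: U'_def\<close>)
    ultimately show ?thesis using e(1) by (metis centre_in_ball)
  qed
  have const: "(G a = H a) = (G b = H b)" if "a \<in> U'" "b \<in> U'" for a b
    by (rule connected_equivalence_relation[OF \<open>connected U'\<close> that]) (use loc in auto)
  have S: "G z = H z" "G z = flip (H z)" if "z \<in> U" "z \<notin> U'" for z
    using matching_empty[OF G(1)] matching_empty[OF G(2)] that by (auto simp: U'_def flip_def)
  have two: "G z = H z \<or> G z = flip (H z)" if "z \<in> U'" for z
    using matching_dichotomy_at(1)[OF G] that by (auto simp: U'_def)
  show ?thesis
  proof (cases "\<exists>a\<in>U'. G a = H a")
    case True
    then show ?thesis using const S(1) by blast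
  next
    case False
    then show ?thesis using two S(2) by blast
  qed
qed

lemma matching_exists_regular:
  assumes "vc z \<notin> S"
  shows "\<exists>V G. open V \<and> z \<in> V \<and> matching V G"
proof -
  have *: "\<exists>r s. 0 < r \<and> lift (ball v r) (\<lambda>w. w) s \<and> ball v r \<inter> S = {}" if v: "v \<notin> S" for v
  proof -
    obtain x where x: "x \<in> topspace X" "\<kappa> x = coset n v" using fibre_point[OF v] .
    show ?thesis by (rule local_section[OF x v]) blast
  qed
  obtain r s where s: "0 < r" "lift (ball (vc z) r) (\<lambda>w. w) s" "ball (vc z) r \<inter> S = {}" using *[OF assms] by blast
  have "M (vc z) \<notin> S" using assms M_S by blast
  then obtain q t where t: "0 < q" "lift (ball (M (vc z)) q) (\<lambda>w. w) t" using * by blast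
  define V where "V = vc -` ball (vc z) r \<inter> (\<lambda>w. M (vc w)) -` ball (M (vc z)) q"
  have V: "open V" unfolding V_def by (intro open_Int open_vimage open_ball continuous_vc continuous_M_vc)
  have zV: "z \<in> V" using s(1) t(1) by (simp add: V_def)
  have ls: "lift V vc (\<lambda>w. s (vc w))" by (rule lift_compose[OF s(2) continuous_vc]) (auto simp: V_def)
  have lt: "lift V (\<lambda>w. M (vc w)) (\<lambda>w. t (M (vc w)))"
    by (rule lift_compose[OF t(2) continuous_M_vc]) (auto simp: V_def)
  have nS: "vc w \<notin> S" if "w \<in> V" for w using s(3) that by (auto simp: V_def)
  have "matching V (\<lambda>w. match (s (vc w)) (t (M (vc w))))" unfolding matching_def matching_near_def using V ls lt nS by blast
  then show ?thesis using V zV by blast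
qed

text \<open>Around a branch point both sheets are exchanged by a full turn, upstairs and over \<open>M\<close>, so that the
  matching is single-valued.\<close>

lemma matching_exists_branch:
  assumes "vc z0 \<in> S"
  shows "\<exists>V G. open V \<and> z0 \<in> V \<and> matching V G"
proof -
  let ?c = "2 * complex_of_real pi * \<i>"
  have nS: "vc z \<notin> S" "M (vc z) \<notin> S" if "z \<in> ball z0 1 - {z0}" for z
  proof -
    have "vc z \<noteq> vc z0" using that by (metis DiffD2 cv_vc singletonI)
    moreover have "dist (vc z0) (vc z) < 1" using that by (simp add: dist_vc)
    ultimately show "vc z \<notin> S" using lattice_dist[of "vc z0" "vc z"] assms S_lattice by auto
    then show "M (vc z) \<notin> S" using M_S by blast
  qed
  have contE: "continuous_on UNIV (\<lambda>\<zeta>. vc (polar z0 \<zeta>))" "continuous_on UNIV (\<lambda>\<zeta>. M (vc (polar z0 \<zeta>)))"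
    by (rule continuous_on_compose2[OF continuous_vc[of UNIV] continuous_polar], simp,
        rule continuous_on_compose2[OF continuous_M_vc[of UNIV] continuous_polar], simp)
  obtain s where s: "lift UNIV (\<lambda>\<zeta>. vc (polar z0 \<zeta>)) s"
    using lift_exists[OF contE(1) nS(1)[OF polar_in]] .
  obtain t where t: "lift UNIV (\<lambda>\<zeta>. M (vc (polar z0 \<zeta>))) t"
    using lift_exists[OF contE(2) nS(2)[OF polar_in]] .
  have s\<sigma>: "s (\<zeta> + ?c) = \<sigma> (s \<zeta>)" for \<zeta>
    by (rule polar_monodromy[OF continuous_vc continuous_cv _ _ assms nS(1) s]) auto
  have t\<sigma>: "t (\<zeta> + ?c) = \<sigma> (t \<zeta>)" for \<zeta>
  proof (rule polar_monodromy[of "\<lambda>z. M (vc z)" "\<lambda>v. cv (M' v)", OF continuous_M_vc _ _ _ _ nS(2) t])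
    show "continuous_on UNIV (\<lambda>v. cv (M' v))"
      by (rule continuous_on_compose2[OF continuous_cv[of UNIV] continuous_M(2)]) simp
  qed (use M_inverse assms M_S in auto)
  have ov: "over (vc (polar z0 \<zeta>)) (s \<zeta>) (t \<zeta>)" for \<zeta>
    unfolding over_def using lift_in[OF s] lift_in[OF t] lift_coset[OF s] lift_coset[OF t] nS(1)[OF polar_in] by simp
  define Q where "Q \<zeta> = match (s \<zeta>) (t \<zeta>)" for \<zeta>
  have per: "Q (\<zeta> + ?c) = Q \<zeta>" for \<zeta>
    unfolding Q_def s\<sigma> t\<sigma> by (rule match_\<sigma>\<sigma>[OF ov])
  define V0 where "V0 = ball z0 (exp (- 1))"
  define G where "G z = (if z = z0 then {} else Q (Ln (z - z0)))" for z
  have "exp (- 1) < exp (0::real)" by (subst exp_less_cancel_iff) simp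
  then have V01: "V0 \<subseteq> ball z0 1" unfolding V0_def by (intro subset_ball) simp
  have "matching V0 G" unfolding matching_def
  proof (intro ballI conjI impI)
    fix z assume z: "z \<in> V0"
    show "G z = {}" if "vc z \<in> S" using that nS(1)[of z] z V01 by (auto simp: G_def)
    show "matching_near V0 G z" if "vc z \<notin> S"
    proof -
      have z': "z \<in> ball z0 (exp (- 1)) - {z0}" using z that assms by (auto simp: V0_def)
      obtain V b where V: "open V" "z \<in> V" "V \<subseteq> ball z0 (exp (- 1)) - {z0}" "continuous_on V b"
        "\<And>w. w \<in> V \<Longrightarrow> polar z0 (b w) = w"
        "\<And>w. w \<in> V \<Longrightarrow> \<exists>k::int. b w = Ln (w - z0) + of_int k * ?c"
        using polar_branch[OF z'] by blast
      have "lift V vc (\<lambda>w. s (b w))" by (rule lift_compose[OF s V(4)]) (use V(5) in auto)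
      moreover have "lift V (\<lambda>w. M (vc w)) (\<lambda>w. t (b w))" by (rule lift_compose[OF t V(4)]) (use V(5) in auto)
      moreover have "vc w \<notin> S" if "w \<in> V" for w using nS(1)[of w] V(3) V01 that unfolding V0_def by blast
      moreover have "G w = match (s (b w)) (t (b w))" if w: "w \<in> V" for w
      proof -
        obtain k where "b w = Ln (w - z0) + of_int k * ?c" using V(6)[OF w] by blast
        then have "Q (b w) = Q (Ln (w - z0))" using periodic_int[of Q ?c] per by metis
        then show ?thesis using V(3) w by (auto simp: G_def Q_def)
      qed
      ultimately show ?thesis unfolding matching_near_def using V(1,2) by blast
    qed
  qed
  moreover have "open V0" "z0 \<in> V0" by (simp_all add: V0_def)
  ultimately show ?thesis by blast
qed

lemma global_matching: "\<exists>G. matching UNIV G"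
proof -
  interpret T: plane_torsor matching flip
  proof
    fix U :: "complex set" and G
    assume "\<And>z. z \<in> U \<Longrightarrow> \<exists>V H. open V \<and> z \<in> V \<and> matching V H \<and> (\<forall>w\<in>V \<inter> U. G w = H w)"
    then show "matching U G" by (rule matching_locally)
  next
    fix U G assume "matching U G"
    then show "matching U (\<lambda>z. flip (G z))" by (rule matching_flip)
  next
    fix U :: "complex set" and G H assume "open U" "convex U" "matching U G" "matching U H"
    then show "(\<forall>z\<in>U. G z = H z) \<or> (\<forall>z\<in>U. G z = flip (H z))" by (rule matching_dichotomy)
  next
    fix U :: "complex set" and G assume U: "open U" "U \<noteq> {}" "matching U G"
    then obtain u e where "e > 0" "ball u e \<subseteq> U" by (meson all_not_in_conv open_contains_ball)
    \<comment> \<open>An uncountable set cannot lie in the countable branch set, and at every other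
      point \<open>flip\<close> moves the matching.\<close>
    then have "uncountable U" using uncountable_ball countable_subset by metis
    then obtain z where "z \<in> U" "vc z \<notin> S"
      using countable_vc_S countable_subset by (metis (mono_tags) mem_Collect_eq subsetI)
    then show "\<exists>z\<in>U. flip (G z) \<noteq> G z" using matching_dichotomy_at(2)[OF U(3,3)] by blast
  next
    fix z show "\<exists>V G. open V \<and> z \<in> V \<and> matching V G"
      using matching_exists_regular matching_exists_branch by blast
  qed
  show ?thesis by (rule T.global_section)
qed

end

text \<open>In the application h is the square of the lift c, which lies over z to -z, and
  \<open>T z\<close> says that z represents O or M, so that \<open>h_fix\<close> describes the fixed
  points of h.\<close>

locale involution_cover = double_cover +
  fixes h :: "'a \<Rightarrow> 'a" and T :: "real^2 \<Rightarrow> bool"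
  assumes h: "continuous_map X X h" "inj_on h (topspace X)"
    and h_\<kappa>: "\<And>x z. x \<in> topspace X \<Longrightarrow> \<kappa> x = coset n z \<Longrightarrow> \<kappa> (h x) = coset n (- z)"
    and h_fix: "\<And>x z. x \<in> topspace X \<Longrightarrow> \<kappa> x = coset n z \<Longrightarrow> h x = x \<longleftrightarrow> T z"
    and T_0: "T 0"
    and S_uminus: "\<And>z. - z \<in> S \<longleftrightarrow> z \<in> S"
    and S_2_torsion: "\<And>z. coset n (- z) = coset n z \<Longrightarrow> z \<notin> S"
begin

lemma h_in: "x \<in> topspace X \<Longrightarrow> h x \<in> topspace X"
  using h(1) by (metis continuous_map_image_subset_topspace image_subset_iff)

lemma h_\<sigma>:
  assumes x: "x \<in> topspace X" "\<kappa> x = coset n z" "z \<notin> S"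
  shows "h (\<sigma> x) = \<sigma> (h x)"
proof -
  note s = \<sigma>_in[OF x] \<sigma>_\<kappa>[OF x] \<sigma>_neq[OF x]
  have "h (\<sigma> x) \<noteq> h x" using s x(1) h(2) by (auto dest: inj_onD)
  moreover have "\<kappa> (h (\<sigma> x)) = \<kappa> (h x)" using h_\<kappa> s x by metis
  moreover have "- z \<notin> S" using x(3) S_uminus by simp
  ultimately show ?thesis using \<sigma>_fibre[OF h_in[OF x(1)] h_\<kappa>[OF x(1,2)]] h_in[OF s(1)] by blast
qed

lemma lift_h:
  assumes "lift U E s"
  shows "lift U (\<lambda>u. - E u) (\<lambda>u. h (s u))"
proof -
  have "continuous_map (top_of_set U) X (h \<circ> s)"
    using assms h(1) continuous_map_compose unfolding lift_def by metis
  then show ?thesis using h_\<kappa>[OF lift_in[OF assms] lift_coset[OF assms]] by (simp add: lift_def o_def)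
qed

lemma S_coset: "coset n z = coset n w \<Longrightarrow> z \<in> S \<longleftrightarrow> w \<in> S"
  by (simp add: S_def)

lemma coset_shift: "v \<in> lattice \<Longrightarrow> coset n (z + real n *\<^sub>R v) = coset n z"
  using coset_eq by metis

end

text \<open>\<open>T_M\<close> is the condition modulo 2 in abstract form: the linear map
  \<open>M\<close> preserves the set of points that lie under fixed points of h.\<close>

locale involution_symmetry = linear_symmetry n X \<kappa> B M M' + involution_cover n X \<kappa> B h T
  for n and X :: "'a topology" and \<kappa> B M M' h T +
  assumes T_M: "\<And>z. T (M z) \<longleftrightarrow> T z"
begin

lemma h_match:
  assumes "over z a b"
  shows "map_prod h h ` match a b = match (h a) (h b)"
proof -
  have "M z \<notin> S" using assms M_S by (simp add: over_def)
  then have "h (\<sigma> a) = \<sigma> (h a)" "h (\<sigma> b) = \<sigma> (h b)"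
    using assms h_\<sigma>[of a z] h_\<sigma>[of b "M z"] by (auto simp: over_def)
  then show ?thesis by (simp add: match_def)
qed

lemma M_uminus: "M (- z) = - M z"
  and M_add: "M (z + w) = M z + M w"
  and M_scale: "M (c *\<^sub>R z) = c *\<^sub>R M z"
  and M_zero: "M 0 = 0" using linear_M(1) by (simp_all add: linear_neg linear_add linear_scale linear_0)

lemma coset_M: "coset n z = coset n w \<Longrightarrow> coset n (M z) = coset n (M w)"
  unfolding coset_eq using M_add M_scale M_lattice by metis

lemma vc_shift: "vc (w + cv (real n *\<^sub>R v)) = vc w + real n *\<^sub>R v"
  by (simp add: vc_add)

text \<open>Used for the translation by a period, with \<eta> the identity, and for the negation of
  the plane, with h for \<eta>: in both cases \<eta> carries the two fibres belonging to
  \<open>\<alpha> z\<close> to those belonging to z.\<close>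

lemma matching_transform:
  assumes G: "matching UNIV G" and \<alpha>: "continuous_on UNIV \<alpha>" "\<And>w. vc (\<alpha> w) \<in> S \<longleftrightarrow> vc w \<in> S"
    and \<eta>: "\<And>V s. lift V vc s \<Longrightarrow> lift (\<alpha> -` V) vc (\<lambda>w. \<eta> (s (\<alpha> w)))"
      "\<And>V t. lift V (\<lambda>w. M (vc w)) t \<Longrightarrow> lift (\<alpha> -` V) (\<lambda>w. M (vc w)) (\<lambda>w. \<eta> (t (\<alpha> w)))"
      "\<And>z a b. over z a b \<Longrightarrow> map_prod \<eta> \<eta> ` match a b = match (\<eta> a) (\<eta> b)"
  shows "matching UNIV (\<lambda>z. map_prod \<eta> \<eta> ` G (\<alpha> z))"
  unfolding matching_def
proof (intro ballI conjI impI)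
  fix z :: complex
  show "map_prod \<eta> \<eta> ` G (\<alpha> z) = {}" if "vc z \<in> S" using matching_empty[OF G, of "\<alpha> z"] that \<alpha>(2) by simp
  assume "vc z \<notin> S"
  then have zS: "vc (\<alpha> z) \<notin> S" using \<alpha>(2) by simp
  obtain V s t where V: "open V" "\<alpha> z \<in> V" "\<And>w. w \<in> V \<Longrightarrow> vc w \<notin> S" "lift V vc s" "lift V (\<lambda>w. M (vc w)) t"
    "\<And>w. w \<in> V \<Longrightarrow> w \<in> UNIV \<Longrightarrow> G w = match (s w) (t w)" "\<And>w. w \<in> V \<Longrightarrow> over (vc w) (s w) (t w)"
    by (rule matching_at[OF G UNIV_I zS]) (rule that; assumption)
  show "matching_near UNIV (\<lambda>w. map_prod \<eta> \<eta> ` G (\<alpha> w)) z"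
  proof (rule matching_nearI[OF open_vimage[OF V(1) \<alpha>(1)] _ _ \<eta>(1)[OF V(4)] \<eta>(2)[OF V(5)]])
    fix w assume w: "w \<in> \<alpha> -` V"
    then show "vc w \<notin> S" using V(3) \<alpha>(2) by blast
    show "map_prod \<eta> \<eta> ` G (\<alpha> w) = match (\<eta> (s (\<alpha> w))) (\<eta> (t (\<alpha> w)))"
      using \<eta>(3)[OF V(7)] V(6) w by simp
  qed (use V(2) in simp)
qed

lemma matching_shift:
  assumes G: "matching UNIV G" and v: "v \<in> lattice"
  shows "matching UNIV (\<lambda>z. G (z + cv (real n *\<^sub>R v)))"
proof -
  define \<alpha> where "\<alpha> w = w + cv (real n *\<^sub>R v)" for w
  have \<alpha>: "continuous_on U \<alpha>" for U unfolding \<alpha>_def by (intro continuous_intros)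
  have c: "coset n (vc (\<alpha> w)) = coset n (vc w)" for w by (simp add: \<alpha>_def vc_shift coset_shift v)
  have "matching UNIV (\<lambda>z. map_prod id id ` G (\<alpha> z))"
  proof (rule matching_transform[OF G \<alpha> S_coset[OF c]])
    show "lift (\<alpha> -` V) vc (\<lambda>w. id (s (\<alpha> w)))" if "lift V vc s" for V s
      using lift_compose[OF that \<alpha> _ c, of "\<alpha> -` V"] by auto
    show "lift (\<alpha> -` V) (\<lambda>w. M (vc w)) (\<lambda>w. id (t (\<alpha> w)))" if "lift V (\<lambda>w. M (vc w)) t" for V t
      using lift_compose[OF that \<alpha> _ coset_M[OF c], of "\<alpha> -` V"] by auto
  qed (simp add: map_prod.id)
  then show ?thesis by (simp add: map_prod.id \<alpha>_def)
qed

lemma matching_h: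
  assumes G: "matching UNIV G"
  shows "matching UNIV (\<lambda>z. map_prod h h ` G (- z))"
proof (rule matching_transform[OF G _ _ _ _ h_match])
  have cont: "continuous_on U (uminus :: complex \<Rightarrow> complex)" for U by (intro continuous_intros)
  show "continuous_on UNIV (uminus :: complex \<Rightarrow> complex)" by (rule cont)
  show "vc (- w) \<in> S \<longleftrightarrow> vc w \<in> S" for w by (simp add: vc_uminus S_uminus)
  show "lift (uminus -` V) vc (\<lambda>w. h (s (- w)))" if "lift V vc s" for V s
    by (rule lift_compose[OF lift_h[OF that] cont]) (auto simp: vc_uminus)
  show "lift (uminus -` V) (\<lambda>w. M (vc w)) (\<lambda>w. h (t (- w)))" if "lift V (\<lambda>w. M (vc w)) t" for V t
    by (rule lift_compose[OF lift_h[OF that] cont]) (auto simp: vc_uminus M_uminus)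
qed

lemma matching_value:
  assumes "matching UNIV G" "vc z \<notin> S"
  obtains a b where "G z = match a b" "over (vc z) a b"
  by (rule matching_at[OF assms(1) UNIV_I assms(2)]) (use that in auto)

text \<open>The sign by which a matching changes along \<open>n v\<close> is read off at the \<open>2\<close>-torsion point
  \<open>n v / 2\<close>, where the symmetry by \<open>h\<close> compares the values at \<open>n v / 2\<close> and \<open>- n v / 2\<close>.\<close>

lemma matching_periodic:
  assumes G: "matching UNIV G" and v: "v \<in> lattice"
  shows "G (z + cv (real n *\<^sub>R v)) = G z"
proof -
  let ?\<nu> = "cv (real n *\<^sub>R v)"
  \<comment> \<open>At minus half the period, translation by the period is the same as
    negation.\<close>
  define z0 where "z0 = - ?\<nu> / 2"
  have z0: "vc z0 + real n *\<^sub>R v = - vc z0" "z0 + ?\<nu> = - z0"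
  proof -
    show *: "z0 + ?\<nu> = - z0" by (simp add: z0_def)
    show "vc z0 + real n *\<^sub>R v = - vc z0" using arg_cong[OF *, of vc] by (simp add: vc_add vc_uminus)
  qed
  have tors: "coset n (- vc z0) = coset n (vc z0)" using coset_shift[OF v, of "vc z0"] z0 by simp
  have torsM: "coset n (- M (vc z0)) = coset n (M (vc z0))" using coset_M[OF tors] by (simp add: M_uminus)
  have z0S: "vc z0 \<notin> S" using S_2_torsion[OF tors] .
  have vc0: "vc 0 = 0" by (simp add: vc_def vec_eq_iff forall_2)
  \<comment> \<open>Transport by h gives a matching again. Since h fixes all points over 0, it
    agrees with G at 0 and hence everywhere.\<close>
  have h_eq: "map_prod h h ` G (- z) = G z" for z
  proof -
    have 0: "vc 0 \<notin> S" unfolding vc0 by (rule S_2_torsion) simp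
    obtain a b where ab: "G 0 = match a b" "over (vc 0) a b" using matching_value[OF G 0] .
    then have "h a = a" "h b = b" using h_fix[of a 0] h_fix[of b 0] T_0 by (auto simp: over_def vc0 M_zero)
    then have "map_prod h h ` G (- 0) = G 0" using h_match[OF ab(2)] ab(1) by simp
    moreover have "flip (G 0) \<noteq> G 0" using matching_dichotomy_at(2)[OF G G UNIV_I 0] .
    ultimately show ?thesis using matching_dichotomy[OF open_UNIV convex_UNIV matching_h[OF G] G] by (metis UNIV_I)
  qed
  obtain a b where ab: "G z0 = match a b" "over (vc z0) a b" using matching_value[OF G z0S] .
  have "match (h a) (h b) = match a b"
  proof -
    have a: "a \<in> topspace X" "\<kappa> a = coset n (vc z0)" and b: "b \<in> topspace X" "\<kappa> b = coset n (M (vc z0))"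
      using ab(2) by (auto simp: over_def)
    have "over (vc z0) (h a) (h b)"
      unfolding over_def using z0S h_in[OF a(1)] h_in[OF b(1)] h_\<kappa>[OF a] h_\<kappa>[OF b] tors torsM
      by (metis (no_types))
    then have "h a = a \<or> h a = \<sigma> a" "h b = b \<or> h b = \<sigma> b" using over_facts(5)[OF ab(2)] by auto
    \<comment> \<open>Over a 2-torsion point outside S, h fixes or exchanges the two sheets, and by
      \<open>T_M\<close> it does the same over z0 and over its image; either way the bijection is
      unchanged.\<close>
    moreover have "h a = a \<longleftrightarrow> h b = b" using h_fix[OF a] h_fix[OF b] T_M by simp
    ultimately show ?thesis using match_\<sigma>\<sigma>[OF ab(2)] over_facts(3,4)[OF ab(2)] by metis
  qed
  then have "G (- z0) = G z0" using h_eq[of "- z0"] h_match[OF ab(2)] ab(1) by simp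
  then have "G (z0 + ?\<nu>) = G z0" by (simp only: z0(2))
  moreover have "flip (G z0) \<noteq> G z0" using matching_dichotomy_at(2)[OF G G UNIV_I z0S] .
  ultimately show ?thesis
    using matching_dichotomy[OF open_UNIV convex_UNIV matching_shift[OF G v] G] by (metis UNIV_I)
qed

text \<open>The global matching assigns to x its partner over \<open>M z\<close>, and by
  \<open>matching_periodic\<close> the partner does not depend on the representative z of
  \<open>\<kappa> x\<close>.\<close>

theorem symmetry_lifts:
  obtains f where "continuous_map Y X f"
    "\<And>x z. x \<in> topspace Y \<Longrightarrow> \<kappa> x = coset n z \<Longrightarrow> \<kappa> (f x) = coset n (M z)"
proof -
  obtain G where G: "matching UNIV G" using global_matching by blast
  define f where "f x = (SOME b. \<exists>z. \<kappa> x = coset n (vc z) \<and> (x, b) \<in> G z)" for x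
  have f_eq: "f x = b" if x: "x \<in> topspace Y" "\<kappa> x = coset n (vc z)" "(x, b) \<in> G z" for x z b
    unfolding f_def
  proof (rule some_equality)
    show "\<exists>z. \<kappa> x = coset n (vc z) \<and> (x, b) \<in> G z" using x by blast
    fix b' assume "\<exists>z. \<kappa> x = coset n (vc z) \<and> (x, b') \<in> G z"
    then obtain z' where z': "\<kappa> x = coset n (vc z')" "(x, b') \<in> G z'" by blast
    then obtain v where v: "v \<in> lattice" "vc z' = vc z + real n *\<^sub>R v" using x(2) coset_eq by metis
    have "z' = z + cv (real n *\<^sub>R v)" using v(2) by (metis cv_vc vc_shift)
    then have "G z' = G z" using matching_periodic[OF G v(1)] by simp
    moreover have "vc z \<notin> S" using Y_iff[of x "vc z"] x(1,2) topspace_Y_subset S_lattice by blast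
    then obtain a c where ac: "G z = match a c" "over (vc z) a c" using matching_value[OF G] by metis
    ultimately show "b' = b" using z'(2) x(3) over_facts(3)[OF ac(2)] by (auto simp: match_def)
  qed
  have f\<kappa>: "f x \<in> topspace X \<and> \<kappa> (f x) = coset n (M z)" if x: "x \<in> topspace Y" "\<kappa> x = coset n z" for x z
  proof -
    have zS: "vc (cv z) \<notin> S" using Y_iff[of x z] x topspace_Y_subset S_lattice by auto
    obtain a c where ac: "G (cv z) = match a c" "over (vc (cv z)) a c" using matching_value[OF G zS] .
    have a: "a \<in> topspace X" "\<kappa> a = coset n z" "z \<notin> S" and c: "c \<in> topspace X" "\<kappa> c = coset n (M z)" "M z \<notin> S"
      using ac(2) M_S by (auto simp: over_def)
    have "x = a \<or> x = \<sigma> a" using \<sigma>_fibre[OF a, of x] a x topspace_Y_subset by auto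
    then obtain b where b: "(x, b) \<in> match a c" "b = c \<or> b = \<sigma> c" by (auto simp: match_def)
    have "f x = b" using f_eq[of x "cv z" b] x b(1) ac(1) by simp
    then show ?thesis using b(2) c(1,2) \<sigma>_in[OF c] \<sigma>_\<kappa>[OF c] by metis
  qed
  have "continuous_map Y X f"
  proof (rule continuous_by_charts)
    fix x assume "x \<in> topspace Y"
    then show "f x \<in> topspace X" using f\<kappa> by (metis obtain_Y)
  next
    fix x z r s assume s: "chart x z r s"
    have zS: "vc (cv z) \<notin> S" using chart_in(5)[OF s chart_centre(1)[OF s]] by simp
    obtain V s' t where V: "open V" "cv z \<in> V" "\<And>w. w \<in> V \<Longrightarrow> vc w \<notin> S" "lift V vc s'" "lift V (\<lambda>w. M (vc w)) t"
      "\<And>w. w \<in> V \<Longrightarrow> w \<in> UNIV \<Longrightarrow> G w = match (s' w) (t w)"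
      "\<And>w. w \<in> V \<Longrightarrow> over (vc w) (s' w) (t w)"
      by (rule matching_at[OF G UNIV_I zS]) (rule that; assumption)
    have "open (cv -` V)" by (rule open_vimage[OF V(1) continuous_cv])
    then obtain e0 where e0: "e0 > 0" "ball z e0 \<subseteq> cv -` V" using V(2) by (meson open_contains_ball vimageI2)
    define e where "e = min e0 r"
    have e: "0 < e" "e \<le> r" "cv ` ball z e \<subseteq> V" using e0 chart_centre(3)[OF s] by (auto simp: e_def)
    have sub: "ball z e \<subseteq> ball z r" using e(2) by (rule subset_ball)
    have ls: "lift (ball z e) (\<lambda>w. w) (\<lambda>w. s' (cv w))"
      by (rule lift_compose[OF V(4) continuous_cv e(3)]) simp
    have lt: "lift (ball z e) M (\<lambda>w. t (cv w))" by (rule lift_compose[OF V(5) continuous_cv e(3)]) simp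
    have nS: "w \<notin> S" "M w \<notin> S" if "w \<in> ball z e" for w using chart_in(5)[OF s] sub that M_S by blast+
    have lt': "lift (ball z e) M (\<lambda>w. \<sigma> (t (cv w)))"
      by (rule lift_\<sigma>[OF lt continuous_M(1) nS(2)])
    have "(\<forall>w\<in>ball z e. s w = s' (cv w)) \<or> (\<forall>w\<in>ball z e. s w = \<sigma> (s' (cv w)))"
      by (rule lift_dichotomy[OF connected_ball continuous_on_id nS(1) lift_subset[OF chart_centre(4)[OF s] sub] ls])
    moreover have "f (s w) = b" if w: "w \<in> ball z e" and b: "(s w, b) \<in> match (s' (cv w)) (t (cv w))" for w b
    proof (rule f_eq)
      have wr: "w \<in> ball z r" using w sub by blast
      show "s w \<in> topspace Y" "\<kappa> (s w) = coset n (vc (cv w))" using chart_in(2,3)[OF s wr] by simp_all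
      have "cv w \<in> V" using w e(3) by blast
      then show "(s w, b) \<in> G (cv w)" using b V(6) by simp
    qed
    ultimately have "(\<forall>w\<in>ball z e. f (s w) = t (cv w)) \<or> (\<forall>w\<in>ball z e. f (s w) = \<sigma> (t (cv w)))"
      by (auto simp: match_def)
    then have "lift (ball z e) M (\<lambda>w. f (s w))"
    proof
      assume "\<forall>w\<in>ball z e. f (s w) = t (cv w)"
      then show ?thesis by (intro lift_locally exI[of _ UNIV] exI[of _ "\<lambda>w. t (cv w)"]) (use lt in auto)
    next
      assume "\<forall>w\<in>ball z e. f (s w) = \<sigma> (t (cv w))"
      then show ?thesis by (intro lift_locally exI[of _ UNIV] exI[of _ "\<lambda>w. \<sigma> (t (cv w))"]) (use lt' in auto)
    qed
    then show "\<exists>e E. 0 < e \<and> e \<le> r \<and> lift (ball z e) E (\<lambda>w. f (s w))" using e by blast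
  qed
  then show ?thesis using that f\<kappa> by blast
qed

end

section \<open>Affine diffeomorphisms\<close>

lemma coset_add_cong: "coset m a = coset m b \<longleftrightarrow> coset m (a + c) = coset m (b + c)"
  by (simp add: coset_eq algebra_simps)

lemma affine_diffeo_inverse:
  assumes f: "affine_diffeo Z D A f" and g: "homeomorphic_maps Z Z f g"
    and A': "A ** A' = mat 1" "A' ** A = mat 1"
  shows "affine_diffeo Z D A' g"
  unfolding affine_diffeo_def
proof (intro conjI allI impI ballI)
  show "invertible A'" using A' unfolding invertible_def by blast
  show "homeomorphic_map Z Z g" using g homeomorphic_maps_sym homeomorphic_maps_map by blast
  fix U \<phi> V \<psi> y
  assume ch: "translation_chart Z D U \<phi> \<and> translation_chart Z D V \<psi>" and y: "y \<in> U" "g y \<in> V"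
  have sub: "U \<subseteq> topspace Z" "V \<subseteq> topspace Z" using ch openin_subset by (auto simp: translation_chart_def)
  have fg: "f (g u) = u" "g (f u) = u" if "u \<in> topspace Z" for u
    using g that by (simp_all add: homeomorphic_maps_def)
  obtain N b where N: "openin Z N" "g y \<in> N" "N \<subseteq> V" "f ` N \<subseteq> U" "\<And>u. u \<in> N \<Longrightarrow> \<phi> (f u) = A *v \<psi> u + b"
  proof -
    have fy: "f (g y) \<in> U" using fg(1)[OF subsetD[OF sub(1) y(1)]] y(1) by simp
    note f[unfolded affine_diffeo_def, THEN conjunct2, THEN conjunct2, rule_format, of V \<psi> U \<phi>, OF _ y(2) fy]
    with ch that show ?thesis by blast
  qed
  have gf: "g (f u) = u" if "u \<in> N" for u using fg(2) N(3) sub(2) that by blast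
  have "homeomorphic_map Z Z f" using f by (simp add: affine_diffeo_def)
  then have "openin Z (f ` N)" using homeomorphic_imp_open_map N(1) by (metis open_map_def)
  moreover have "\<psi> (g u) = A' *v \<phi> u + - (A' *v b)" if u: "u \<in> f ` N" for u
  proof -
    obtain x where x: "x \<in> N" "u = f x" using u by blast
    have "A' *v \<phi> u = A' *v (A *v \<psi> x) + A' *v b"
      using N(5)[OF x(1)] x(2) by (simp add: matrix_vector_right_distrib)
    then show ?thesis using x gf A'(2) by (simp add: matrix_vector_mul_assoc)
  qed
  moreover have "y \<in> f ` N" using N(2) fg(1) sub(1) y(1) by (metis imageI subsetD)
  moreover have "g ` f ` N \<subseteq> V" using gf N(3) by auto
  ultimately show "\<exists>N b. openin Z N \<and> y \<in> N \<and> N \<subseteq> U \<and> g ` N \<subseteq> V \<and> (\<forall>u\<in>N. \<psi> (g u) = A' *v \<phi> u + b)"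
    using N(4) by blast
qed

section \<open>Affine maps in charts and along segments\<close>

context double_cover begin

text \<open>Connects sections with the charts in the definition of affine maps: s followed by
  \<kappa> and \<open>pr\<close> is \<open>coset 1\<close>, so the inverse of s is a translation
  chart.\<close>

lemma chart_translation:
  assumes s: "chart x z r s"
  obtains g where "translation_chart Y (pr \<circ> \<kappa>) (s ` ball z r) g" "\<And>w. w \<in> ball z r \<Longrightarrow> g (s w) = w"
proof -
  let ?U = "s ` ball z r"
  have opX: "openin X (s ` V)" if "open V" "V \<subseteq> ball z r" for V using s that by (simp add: chart_def)
  have op: "openin Y (s ` V)" if "open V" "V \<subseteq> ball z r" for V
    using opX[OF that] chart_in(3)[OF s] that(2) by (auto simp: openin_Y)
  have U: "openin Y ?U" using op by blast
  have top: "topspace (subtopology Y ?U) = ?U" using openin_subset[OF U] by auto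
  have sub: "subtopology Y ?U = subtopology X ?U"
    using openin_subset[OF U] by (subst Y_subtopology) (simp add: subtopology_subtopology Int_absorb1)
  have "homeomorphic_map (top_of_set (ball z r)) (subtopology Y ?U) s"
  proof (rule bijective_open_imp_homeomorphic_map)
    show "continuous_map (top_of_set (ball z r)) (subtopology Y ?U) s"
      using chart_centre(4)[OF s] unfolding sub by (auto simp: lift_def continuous_map_in_subtopology)
    show "open_map (top_of_set (ball z r)) (subtopology Y ?U) s" unfolding open_map_def
    proof safe
      fix V assume "openin (top_of_set (ball z r)) V"
      then have "open V" "V \<subseteq> ball z r" using openin_open_eq open_ball by blast+
      then show "openin (subtopology Y ?U) (s ` V)" unfolding openin_open_subtopology[OF U] using op by blast
    qed
    show "s ` topspace (top_of_set (ball z r)) = topspace (subtopology Y ?U)" using top by simp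
    show "inj_on s (topspace (top_of_set (ball z r)))"
    proof (rule inj_onI)
      fix a b assume "a \<in> topspace (top_of_set (ball z r))" "b \<in> topspace (top_of_set (ball z r))" and eq: "s a = s b"
      then have ab: "a \<in> ball z r" "b \<in> ball z r" by auto
      have "coset n a = coset n b" using chart_in(2)[OF s ab(1)] chart_in(2)[OF s ab(2)] eq by simp
      moreover have "r \<le> 1 / 2" using s by (simp add: chart_def)
      ultimately show "a = b" using coset_ball_inj[OF n_pos _ ab] by blast
    qed
  qed
  then obtain g where g: "homeomorphic_maps (top_of_set (ball z r)) (subtopology Y ?U) s g"
    using homeomorphic_map_maps by blast
  have gs: "g (s w) = w" if "w \<in> ball z r" for w using g that by (simp add: homeomorphic_maps_def)
  have "homeomorphic_map (subtopology Y ?U) (top_of_set (ball z r)) g"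
    using g homeomorphic_maps_sym homeomorphic_maps_map by blast
  moreover have "\<forall>u\<in>?U. coset 1 (g u) = (pr \<circ> \<kappa>) u"
    using gs chart_in(2)[OF s] by (auto simp: pr_coset)
  ultimately have "translation_chart Y (pr \<circ> \<kappa>) ?U g"
    unfolding translation_chart_def using U open_ball by blast
  then show ?thesis using that gs by blast
qed

text \<open>The affine condition is restated with positions modulo n instead of modulo 1, and with
  displacements only: if the base point moves by v, the image moves by A v from whichever
  representative w was chosen.\<close>

definition affine_along :: "(real^2 \<Rightarrow> real^2) \<Rightarrow> ('a \<Rightarrow> 'a) \<Rightarrow> bool" where
  "affine_along A f \<longleftrightarrow> continuous_map Y Y f \<and>
     (\<forall>x z r s w. chart x z r s \<longrightarrow> \<kappa> (f x) = coset n w \<longrightarrow>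
        (\<exists>e. 0 < e \<and> e \<le> r \<and> (\<forall>v\<in>ball 0 e. \<kappa> (f (s (z + v))) = coset n (w + A v))))"

lemma affine_alongE:
  assumes "affine_along A f" "chart x z r s" "\<kappa> (f x) = coset n w"
  obtains e where "0 < e" "e \<le> r" "\<And>v. v \<in> ball 0 e \<Longrightarrow> \<kappa> (f (s (z + v))) = coset n (w + A v)"
  using assms unfolding affine_along_def by metis

lemma affine_along_in: "affine_along A f \<Longrightarrow> x \<in> topspace Y \<Longrightarrow> f x \<in> topspace Y"
  unfolding affine_along_def by (metis continuous_map_image_subset_topspace image_subset_iff)

lemma affine_along_cont: "affine_along A f \<Longrightarrow> continuous_map Y X f"
  unfolding affine_along_def using continuous_map_into_fulltopology Y_subtopology by metis

lemma affine_diffeo_along: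
  assumes "affine_diffeo Y (pr \<circ> \<kappa>) A f"
  shows "affine_along (\<lambda>v. A *v v) f"
  unfolding affine_along_def
proof (intro conjI allI impI)
  show f: "continuous_map Y Y f" using assms homeomorphic_imp_continuous_map unfolding affine_diffeo_def by blast
  fix x z r s w assume s: "chart x z r s" and w: "\<kappa> (f x) = coset n w"
  have xY: "x \<in> topspace Y" using chart_in(3)[OF s] chart_centre[OF s] by blast
  then have fY: "f x \<in> topspace Y" using f by (metis continuous_map_image_subset_topspace image_subset_iff)
  then have fX: "f x \<in> topspace X" using topspace_Y_subset by blast
  have wl: "w \<notin> lattice" using Y_iff[OF fX w] fY by blast
  obtain r' s' where s': "chart (f x) w r' s'" using chart_exists[OF fX w wl] .
  obtain g where g: "translation_chart Y (pr \<circ> \<kappa>) (s ` ball z r) g" "\<And>w. w \<in> ball z r \<Longrightarrow> g (s w) = w"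
    using chart_translation[OF s] by blast
  obtain g' where g': "translation_chart Y (pr \<circ> \<kappa>) (s' ` ball w r') g'" "\<And>v. v \<in> ball w r' \<Longrightarrow> g' (s' v) = v"
    using chart_translation[OF s'] by blast
  have xU: "x \<in> s ` ball z r" using chart_centre(1,2)[OF s] by (metis imageI)
  have fU: "f x \<in> s' ` ball w r'" using chart_centre(1,2)[OF s'] by (metis imageI)
  obtain N b where N: "openin Y N" "x \<in> N" "N \<subseteq> s ` ball z r" "f ` N \<subseteq> s' ` ball w r'"
    "\<And>u. u \<in> N \<Longrightarrow> g' (f u) = A *v g u + b"
    using assms g(1) g'(1) xU fU unfolding affine_diffeo_def by metis
  have gx: "g x = z" using g(2) chart_centre(1,2)[OF s] by metis
  have gfx: "g' (f x) = w" using g'(2) chart_centre(1,2)[OF s'] by metis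
  \<comment> \<open>Evaluation at x fixes the constant of the affine formula, after which only
    displacements remain.\<close>
  have b: "w = A *v z + b" using N(5)[OF N(2)] gx gfx by simp
  have "openin X N" using N(1) openin_Y by blast
  then have "openin (top_of_set (ball z r)) {w \<in> ball z r. s w \<in> N}"
    using openin_continuous_map_preimage[of "top_of_set (ball z r)" X s N] chart_centre(4)[OF s]
    by (simp add: lift_def)
  then have "open {w \<in> ball z r. s w \<in> N}" using openin_open_eq open_ball by blast
  moreover have "z \<in> {w \<in> ball z r. s w \<in> N}" using chart_centre(1,2)[OF s] N(2) by auto
  ultimately obtain e where e: "e > 0" "ball z e \<subseteq> {w \<in> ball z r. s w \<in> N}"
    by (meson open_contains_ball_eq)
  have "\<kappa> (f (s (z + v))) = coset n (w + A *v v)" if v: "v \<in> ball 0 (min e r)" for v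
  proof -
    have zv: "z + v \<in> ball z e" "z + v \<in> ball z r" using v by (auto simp: dist_norm)
    then have sN: "s (z + v) \<in> N" using e(2) by blast
    then obtain w' where w': "w' \<in> ball w r'" "f (s (z + v)) = s' w'" using N(4) by blast
    have "w' = A *v (z + v) + b" using N(5)[OF sN] g'(2)[OF w'(1)] w'(2) g(2)[OF zv(2)] by simp
    then have "w' = w + A *v v" using b by (simp add: matrix_vector_right_distrib)
    then show ?thesis using chart_in(2)[OF s' w'(1)] w'(2) by simp
  qed
  then show "\<exists>e. 0 < e \<and> e \<le> r \<and> (\<forall>v\<in>ball 0 e. \<kappa> (f (s (z + v))) = coset n (w + A *v v))"
    using e(1) chart_centre(3)[OF s] by (intro exI[of _ "min e r"]) auto
qed

text \<open>The segment from z lifts to a path in Y. By continuity along [0, 1] its image under f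
  lies over the segment from w in direction A v, and points of Y never lie over the lattice.\<close>

lemma segment:
  assumes f: "affine_along A f" and A: "linear A"
    and x: "x \<in> topspace Y" "\<kappa> x = coset n z" "\<kappa> (f x) = coset n w"
    and seg: "\<And>t. t \<in> {0..1} \<Longrightarrow> z + t *\<^sub>R v \<notin> lattice"
    and t: "t \<in> {0..1}"
  shows "w + t *\<^sub>R A v \<notin> lattice"
proof -
  \<comment> \<open>Clamping the parameter extends the segment to a map on the whole plane, to which
    \<open>lift_exists\<close> applies.\<close>
  define E where "E \<zeta> = z + max 0 (min 1 (Re \<zeta>)) *\<^sub>R v" for \<zeta>
  have cE: "continuous_on UNIV E" unfolding E_def by (intro continuous_intros)
  have ES: "E \<zeta> \<notin> S" for \<zeta> using seg[of "max 0 (min 1 (Re \<zeta>))"] S_lattice by (auto simp: E_def)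
  obtain s0 where s0: "lift UNIV E s0" using lift_exists[OF cE ES] .
  have E0: "E 0 = z" by (simp add: E_def)
  have k0: "s0 0 \<in> topspace X" "\<kappa> (s0 0) = coset n z" using lift_in[OF s0] lift_coset[OF s0] E0 by auto
  have zS: "z \<notin> S" using ES[of 0] E0 by simp
  have "x = s0 0 \<or> x = \<sigma> (s0 0)" using \<sigma>_fibre[OF k0 zS, of x] x topspace_Y_subset k0(2) by auto
  then obtain s where s: "lift UNIV E s" "s 0 = x" using s0 lift_\<sigma>[OF s0 cE ES] by metis
  define \<gamma> where "\<gamma> t = s (complex_of_real t)" for t
  have l: "lift {0..1} (\<lambda>t. z + t *\<^sub>R v) \<gamma>"
    unfolding \<gamma>_def by (rule lift_compose[OF s(1)]) (auto simp: E_def intro!: continuous_intros)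
  have c: "continuous_on {0..1} (\<lambda>t. z + t *\<^sub>R v)" by (intro continuous_intros)
  have \<gamma>: "\<gamma> t \<in> topspace X" "\<kappa> (\<gamma> t) = coset n (z + t *\<^sub>R v)" "\<gamma> t \<in> topspace Y" if "t \<in> {0..1}" for t
    using lift_in[OF l that] lift_coset[OF l that] Y_iff[OF lift_in[OF l that] lift_coset[OF l that]] seg[OF that] by auto
  define Q where "Q t \<longleftrightarrow> \<kappa> (f (\<gamma> t)) = coset n (w + t *\<^sub>R A v)" for t
  have loc: "\<exists>T. openin (top_of_set {0..1}) T \<and> a \<in> T \<and> (\<forall>t\<in>T. Q a = Q t)" if a: "a \<in> {0..1}" for a
  proof -
    have fa: "f (\<gamma> a) \<in> topspace X" using affine_along_in[OF f \<gamma>(3)[OF a]] topspace_Y_subset by blast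
    obtain w' where w': "\<kappa> (f (\<gamma> a)) = coset n w'" using obtain_coord[OF fa] .
    obtain r l0 where l0: "chart (\<gamma> a) (z + a *\<^sub>R v) r l0" using chart_exists[OF \<gamma>(1,2)[OF a] seg[OF a]] .
    obtain e where e: "0 < e" "e \<le> r" "\<And>u. u \<in> ball 0 e \<Longrightarrow> \<kappa> (f (l0 (z + a *\<^sub>R v + u))) = coset n (w' + A u)"
      by (rule affine_alongE[OF f l0 w'], rule that; assumption)
    have le: "chart (\<gamma> a) (z + a *\<^sub>R v) e l0" using chart_shrink[OF l0 e(1,2)] .
    have props: "e \<le> 1 / 2" "openin X (l0 ` ball (z + a *\<^sub>R v) e)" using le by (auto simp: chart_def)
    obtain V where V: "open V" "a \<in> V"
      "\<And>t. t \<in> V \<inter> {0..1} \<Longrightarrow> z + t *\<^sub>R v \<in> ball (z + a *\<^sub>R v) e \<and> \<gamma> t = l0 (z + t *\<^sub>R v)"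
      by (rule lift_near[OF l c a chart_centre(4)[OF le] chart_centre(2)[OF le] e(1) props], rule that; assumption)
    have "Q t = Q a" if t: "t \<in> V \<inter> {0..1}" for t
    proof -
      let ?u = "(t - a) *\<^sub>R v"
      have zt: "z + t *\<^sub>R v = z + a *\<^sub>R v + ?u" by (simp add: algebra_simps)
      have "?u \<in> ball 0 e" using V(3)[OF t] unfolding zt by (simp add: dist_norm)
      then have 1: "\<kappa> (f (\<gamma> t)) = coset n (w' + A ?u)" using e(3) V(3)[OF t] zt by simp
      have 2: "w + t *\<^sub>R A v = (w + a *\<^sub>R A v) + A ?u"
        by (simp only: linear_scale[OF A]) (simp add: algebra_simps)
      have "Q t \<longleftrightarrow> coset n (w' + A ?u) = coset n ((w + a *\<^sub>R A v) + A ?u)"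
        unfolding Q_def 1 2 ..
      also have "\<dots> \<longleftrightarrow> coset n w' = coset n (w + a *\<^sub>R A v)" by (rule coset_add_cong[symmetric])
      also have "\<dots> \<longleftrightarrow> Q a" unfolding Q_def w' ..
      finally show ?thesis .
    qed
    moreover have "openin (top_of_set {0..1}) ({0..1} \<inter> V)" using V(1) by (rule openin_open_Int)
    ultimately show ?thesis using V(2) a by blast
  qed
  have "Q 0 = Q t"
    by (rule connected_equivalence_relation[of "{0..1::real}" 0 t "\<lambda>a b. Q a = Q b"]) (use loc t in auto)
  moreover have "Q 0" using s(2) x(3) by (simp add: Q_def \<gamma>_def)
  ultimately have Qt: "\<kappa> (f (\<gamma> t)) = coset n (w + t *\<^sub>R A v)" by (simp add: Q_def)
  have "f (\<gamma> t) \<in> topspace Y" using affine_along_in[OF f \<gamma>(3)[OF t]] .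
  then show ?thesis using Y_iff[OF _ Qt] topspace_Y_subset by blast
qed

text \<open>The ordinate of a lattice point met on the way would make t rational, because
  \<open>m $ 2\<close> is not 1/2; the abscissa would then express \<alpha> rationally.\<close>

lemma irrational_visible:
  fixes \<alpha> :: real
  assumes \<alpha>: "\<alpha> \<notin> \<rat>" and m: "m \<in> lattice" and t: "0 \<le> t" "t < 1"
  shows "vector [\<alpha>, 1 / 2] + t *\<^sub>R (m - vector [\<alpha>, 1 / 2]) \<notin> lattice"
proof
  assume "vector [\<alpha>, 1 / 2] + t *\<^sub>R (m - vector [\<alpha>, 1 / 2]) \<in> lattice"
  then have "\<alpha> + t * (m $ 1 - \<alpha>) \<in> \<int>" "1 / 2 + t * (m $ 2 - 1 / 2) \<in> \<int>"
    by (auto simp: lattice_def forall_2)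
  moreover have "m $ 1 \<in> \<int>" "m $ 2 \<in> \<int>" using m by (auto simp: lattice_def)
  ultimately obtain k1 k2 m1 m2 :: int where k: "\<alpha> + t * (m1 - \<alpha>) = k1" "1 / 2 + t * (m2 - 1 / 2) = k2"
    by (metis Ints_cases)
  have m2: "real_of_int m2 - 1 / 2 \<noteq> 0"
  proof
    assume "real_of_int m2 - 1 / 2 = 0"
    then have "real_of_int (2 * m2) = real_of_int 1" by simp
    then have "2 * m2 = 1" by linarith
    then show False by presburger
  qed
  then have "t = (k2 - 1 / 2) / (m2 - 1 / 2)" using k(2) by (simp add: field_simps)
  then have tQ: "t \<in> \<rat>" by simp
  have "\<alpha> = (k1 - t * m1) / (1 - t)" using k(1) t(2) by (simp add: field_simps)
  then show False using tQ \<alpha> by (metis Rats_1 Rats_diff Rats_divide Rats_mult Rats_of_int)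
qed

text \<open>If the end point were not in the lattice, the whole closed image segment would avoid the
  lattice, and \<open>segment\<close> for the inverse map g would show that m is not a lattice
  point.\<close>

lemma lattice_image:
  assumes f: "affine_along A f" and g: "affine_along A' g"
    and gf: "\<And>y. y \<in> topspace Y \<Longrightarrow> g (f y) = y"
    and A: "linear A" "linear A'" "\<And>v. A' (A v) = v"
    and x: "x \<in> topspace Y" "\<kappa> x = coset n z" "\<kappa> (f x) = coset n w"
    and m: "m \<in> lattice" and visible: "\<And>t. 0 \<le> t \<Longrightarrow> t < 1 \<Longrightarrow> z + t *\<^sub>R (m - z) \<notin> lattice"
  shows "w + A (m - z) \<in> lattice"
proof (rule ccontr)
  assume no: "w + A (m - z) \<notin> lattice"
  have seg: "w + t *\<^sub>R A (m - z) \<notin> lattice" if t: "t \<in> {0..1}" for t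
  proof (cases "t = 1")
    case True
    then show ?thesis using no by simp
  next
    case False
    \<comment> \<open>\<open>segment\<close> asks for a closed segment off the lattice, so the one
      ending at the parameter t < 1 is used.\<close>
    have "w + 1 *\<^sub>R A (t *\<^sub>R (m - z)) \<notin> lattice"
    proof (rule segment[OF f A(1) x])
      fix u :: real assume u: "u \<in> {0..1}"
      then have "u * t \<le> 1 * t" using t by (intro mult_right_mono) auto
      then have "0 \<le> u * t" "u * t < 1" using t u False by auto
      then show "z + u *\<^sub>R t *\<^sub>R (m - z) \<notin> lattice" using visible[of "u * t"] by simp
    qed simp
    then show ?thesis using A(1) by (simp add: linear_scale)
  qed
  have fx: "f x \<in> topspace Y" using affine_along_in[OF f x(1)] .
  have "z + 1 *\<^sub>R A' (A (m - z)) \<notin> lattice" by (rule segment[OF g A(2) fx x(3) _ seg]) (use gf x in auto)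
  then show False using A(3) m by simp
qed

text \<open>Every lattice point m is visible from z, so \<open>w + A (m - z)\<close> is a lattice
  point; m = 0 yields b, and differences yield A m.\<close>

lemma affine_lattice:
  assumes f: "affine_along A f" and g: "affine_along A' g"
    and gf: "\<And>y. y \<in> topspace Y \<Longrightarrow> g (f y) = y"
    and A: "linear A" "linear A'" "\<And>v. A' (A v) = v"
  obtains x z b where "x \<in> topspace Y" "\<kappa> x = coset n z" "b \<in> lattice" "\<kappa> (f x) = coset n (A z + b)"
    "\<And>m. m \<in> lattice \<Longrightarrow> A m \<in> lattice"
proof -
  obtain \<alpha> :: real where \<alpha>: "\<alpha> \<notin> \<rat>"
    using uncountable_UNIV_real countable_rat by (metis UNIV_eq_I)
  define z :: "real^2" where "z = vector [\<alpha>, 1 / 2]"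
  have vis: "z + t *\<^sub>R (m - z) \<notin> lattice" if "m \<in> lattice" "0 \<le> t" "t < 1" for m t
    unfolding z_def by (rule irrational_visible[OF \<alpha> that])
  have zl: "z \<notin> lattice" using vis[OF lattice_0, of 0] by simp
  obtain e s where s: "chart (s z) z e s" using chart_pair[OF zl] by blast
  define x where "x = s z"
  have x: "x \<in> topspace Y" "\<kappa> x = coset n z" using chart_in[OF s chart_centre(1)[OF s]] by (auto simp: x_def)
  obtain w where w: "\<kappa> (f x) = coset n w"
    using obtain_coord affine_along_in[OF f x(1)] topspace_Y_subset by blast
  have all: "w + A (m - z) \<in> lattice" if "m \<in> lattice" for m
    by (rule lattice_image[OF f g gf A x w that vis[OF that]])
  have "w + A (0 - z) \<in> lattice" using all lattice_0 by blast
  then have b: "w - A z \<in> lattice" using A(1) by (simp add: linear_neg)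
  have "A m \<in> lattice" if "m \<in> lattice" for m
  proof -
    have "A m = (w + A (m - z)) - (w - A z)" using A(1) by (simp add: linear_diff)
    then show ?thesis using lattice_diff[OF all[OF that] b] by simp
  qed
  then show ?thesis using that[of x z "w - A z"] x w b by simp
qed

text \<open>Whether the formula holds at x is a locally constant condition, and it is independent of
  the representative z because A maps n Z^2 into itself.\<close>

lemma affine_global:
  assumes ne: "S \<noteq> {}" and f: "affine_along A f" and A: "linear A" "\<And>m. m \<in> lattice \<Longrightarrow> A m \<in> lattice"
    and x0: "x0 \<in> topspace Y" "\<kappa> x0 = coset n z0" "\<kappa> (f x0) = coset n (A z0 + b)"
    and x: "x \<in> topspace Y" "\<kappa> x = coset n z"
  shows "\<kappa> (f x) = coset n (A z + b)"
proof -
  have cA: "coset n (A z + b) = coset n (A z' + b)" if zz: "coset n z = coset n z'" for z z'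
  proof -
    obtain v where v: "v \<in> lattice" "z' = z + real n *\<^sub>R v" using zz coset_eq by blast
    then have "A z' + b = (A z + b) + real n *\<^sub>R A v" using A(1) by (simp add: linear_add linear_scale)
    then show ?thesis using A(2)[OF v(1)] coset_eq by blast
  qed
  define Q where "Q x \<longleftrightarrow> (\<forall>z. \<kappa> x = coset n z \<longrightarrow> \<kappa> (f x) = coset n (A z + b))" for x
  have Q: "Q x \<longleftrightarrow> \<kappa> (f x) = coset n (A z + b)" if "\<kappa> x = coset n z" for x z
    using cA that unfolding Q_def by metis
  have "(\<forall>x\<in>topspace Y. Q x) \<or> (\<forall>x\<in>topspace Y. \<not> Q x)"
  proof (rule locally_constant[OF ne])
    fix x z r s assume s: "chart x z r s"
    have xz: "x \<in> topspace Y" "\<kappa> x = coset n z"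
      using chart_in[OF s chart_centre(1)[OF s]] chart_centre(2)[OF s] by auto
    obtain w where w: "\<kappa> (f x) = coset n w"
      using obtain_coord affine_along_in[OF f xz(1)] topspace_Y_subset by blast
    obtain e where e: "0 < e" "e \<le> r" "\<And>v. v \<in> ball 0 e \<Longrightarrow> \<kappa> (f (s (z + v))) = coset n (w + A v)"
      by (rule affine_alongE[OF f s w], rule that; assumption)
    have "Q (s u) = Q x" if u: "u \<in> ball z e" for u
    proof -
      have ur: "u \<in> ball z r" using u subset_ball[OF e(2)] by blast
      have "u - z \<in> ball 0 e" using u by (simp add: dist_norm norm_minus_commute)
      then have 1: "\<kappa> (f (s u)) = coset n (w + A (u - z))" using e(3)[of "u - z"] by simp
      have 2: "A u + b = (A z + b) + A (u - z)" using A(1) by (simp add: linear_diff)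
      have "Q (s u) \<longleftrightarrow> coset n (w + A (u - z)) = coset n ((A z + b) + A (u - z))"
        unfolding Q[OF chart_in(2)[OF s ur]] 1 2 ..
      also have "\<dots> \<longleftrightarrow> coset n w = coset n (A z + b)" by (rule coset_add_cong[symmetric])
      finally have "Q (s u) \<longleftrightarrow> coset n w = coset n (A z + b)" .
      then show ?thesis using Q[OF xz(2)] w by simp
    qed
    then show "\<exists>e. 0 < e \<and> e \<le> r \<and> (\<forall>u\<in>ball z e. Q (s u) = Q x)" using e(1,2) by blast
  qed
  moreover have "Q x0" using Q x0 by blast
  ultimately show ?thesis using x0(1) x Q by blast
qed

section \<open>Maps of the punctured surface over linear and affine maps\<close>

lemma continuous_Y_in: "continuous_map Y X f \<Longrightarrow> x \<in> topspace Y \<Longrightarrow> f x \<in> topspace X"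
  by (metis continuous_map_image_subset_topspace image_subset_iff)

lemma continuous_into_Y:
  assumes "continuous_map Y X f" "\<And>x. x \<in> topspace Y \<Longrightarrow> f x \<in> topspace Y"
  shows "continuous_map Y Y f"
proof -
  have "continuous_map Y (subtopology X (topspace Y)) f"
    using assms by (simp add: continuous_map_in_subtopology image_subset_iff_funcset[symmetric] image_subset_iff)
  then show ?thesis using Y_subtopology by simp
qed

lemma lift_map_Y:
  assumes "continuous_map Y X f" "\<And>z. M z \<in> lattice \<longleftrightarrow> z \<in> lattice"
    "\<And>x z. x \<in> topspace Y \<Longrightarrow> \<kappa> x = coset n z \<Longrightarrow> \<kappa> (f x) = coset n (M z)"
  shows "continuous_map Y Y f"
proof (rule continuous_into_Y[OF assms(1)])
  fix x assume x: "x \<in> topspace Y"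
  then obtain z where z: "\<kappa> x = coset n z" "z \<notin> lattice" using obtain_Y by metis
  show "f x \<in> topspace Y" using Y_iff[OF continuous_Y_in[OF assms(1) x] assms(3)[OF x z(1)]] assms(2) z(2) by simp
qed

lemma continuous_id_Y: "continuous_map Y X (\<lambda>x. x)"
proof -
  have "continuous_map (subtopology X (topspace Y)) X id" by (simp add: continuous_map_from_subtopology)
  then show ?thesis using Y_subtopology by (simp add: id_def)
qed

lemma \<sigma>_Y:
  assumes "x \<in> topspace Y"
  shows "\<sigma> x \<in> topspace Y" "\<sigma> (\<sigma> x) = x" "\<kappa> (\<sigma> x) = \<kappa> x"
proof -
  obtain z where z: "x \<in> topspace X" "\<kappa> x = coset n z" "z \<notin> lattice" "z \<notin> S" using obtain_Y[OF assms] .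
  show "\<sigma> (\<sigma> x) = x" "\<kappa> (\<sigma> x) = \<kappa> x" using \<sigma>_\<sigma>[OF z(1,2,4)] \<sigma>_\<kappa>[OF z(1,2,4)] by auto
  then show "\<sigma> x \<in> topspace Y" using Y_iff[OF \<sigma>_in[OF z(1,2,4)], of z] z by simp
qed

lemma continuous_\<sigma>: "continuous_map Y Y \<sigma>"
proof (rule continuous_into_Y[OF continuous_by_charts])
  show "\<sigma> x \<in> topspace X" if "x \<in> topspace Y" for x using \<sigma>_Y(1)[OF that] topspace_Y_subset by blast
  fix x z r s assume s: "chart x z r s"
  have "lift (ball z r) (\<lambda>w. w) (\<lambda>w. \<sigma> (s w))"
    by (rule lift_\<sigma>[OF chart_centre(4)[OF s] continuous_on_id chart_in(5)[OF s]])
  then show "\<exists>e E. 0 < e \<and> e \<le> r \<and> lift (ball z e) E (\<lambda>w. \<sigma> (s w))" using chart_centre(3)[OF s] by blast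
qed (rule \<sigma>_Y(1))

lemma deck_map:
  assumes "S \<noteq> {}" "continuous_map Y X f" "\<And>x. x \<in> topspace Y \<Longrightarrow> \<kappa> (f x) = \<kappa> x"
  shows "(\<forall>x\<in>topspace Y. f x = x) \<or> (\<forall>x\<in>topspace Y. f x = \<sigma> x)"
proof (rule map_dichotomy[OF assms(1,2) continuous_id_Y continuous_on_id])
  show "z \<notin> S" if "z \<notin> lattice" for z using that S_lattice by blast
qed (use assms(3) in auto)

text \<open>The composites of the two lifts lie over the identity, so by \<open>deck_map\<close>
  they are the identity or \<sigma>; composing g with \<sigma> in the second case gives a genuine
  inverse.\<close>

lemma symmetry_homeomorphic:
  assumes ne: "S \<noteq> {}" and fg: "continuous_map Y X f" "continuous_map Y X g"
    and M: "\<And>z. M z \<in> lattice \<longleftrightarrow> z \<in> lattice" "\<And>z. M' z \<in> lattice \<longleftrightarrow> z \<in> lattice"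
      "\<And>z. M (M' z) = z" "\<And>z. M' (M z) = z"
    and f\<kappa>: "\<And>x z. x \<in> topspace Y \<Longrightarrow> \<kappa> x = coset n z \<Longrightarrow> \<kappa> (f x) = coset n (M z)"
    and g\<kappa>: "\<And>x z. x \<in> topspace Y \<Longrightarrow> \<kappa> x = coset n z \<Longrightarrow> \<kappa> (g x) = coset n (M' z)"
  shows "homeomorphic_map Y Y f"
proof -
  have f: "continuous_map Y Y f" by (rule lift_map_Y[OF fg(1) M(1) f\<kappa>])
  have g: "continuous_map Y Y g" by (rule lift_map_Y[OF fg(2) M(2) g\<kappa>])
  have fY: "f x \<in> topspace Y" and gY: "g x \<in> topspace Y" if "x \<in> topspace Y" for x
    using f g that by (metis continuous_map_image_subset_topspace image_subset_iff)+
  have co: "continuous_map Y X (\<lambda>x. g (f x))" "continuous_map Y X (\<lambda>x. f (g x))"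
    using continuous_map_compose[OF f fg(2)] continuous_map_compose[OF g fg(1)] by (simp_all add: o_def)
  have k: "\<kappa> (g (f x)) = \<kappa> x" "\<kappa> (f (g x)) = \<kappa> x" if x: "x \<in> topspace Y" for x
  proof -
    obtain z where z: "\<kappa> x = coset n z" using obtain_Y[OF x] .
    show "\<kappa> (g (f x)) = \<kappa> x" "\<kappa> (f (g x)) = \<kappa> x"
      using g\<kappa>[OF fY[OF x] f\<kappa>[OF x z]] f\<kappa>[OF gY[OF x] g\<kappa>[OF x z]] M z by auto
  qed
  have gf: "(\<forall>x\<in>topspace Y. g (f x) = x) \<or> (\<forall>x\<in>topspace Y. g (f x) = \<sigma> x)"
    by (rule deck_map[OF ne co(1) k(1)])
  have fg': "(\<forall>x\<in>topspace Y. f (g x) = x) \<or> (\<forall>x\<in>topspace Y. f (g x) = \<sigma> x)"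
    by (rule deck_map[OF ne co(2) k(2)])
  obtain g' where g': "continuous_map Y Y g'" "\<And>x. x \<in> topspace Y \<Longrightarrow> g' (f x) = x"
  proof (cases "\<forall>x\<in>topspace Y. g (f x) = x")
    case True
    then show ?thesis using that[OF g] by blast
  next
    case False
    then have "\<sigma> (g (f x)) = x" if "x \<in> topspace Y" for x using gf \<sigma>_Y(2) that by metis
    moreover have "continuous_map Y Y (\<lambda>x. \<sigma> (g x))"
      using continuous_map_compose[OF g continuous_\<sigma>] by (simp add: o_def)
    ultimately show ?thesis using that by blast
  qed
  have surj: "\<exists>x\<in>topspace Y. y = f x" if "y \<in> topspace Y" for y
    using fg' \<sigma>_Y(1,2) gY that by metis
  have "homeomorphic_maps Y Y f g'" unfolding homeomorphic_maps_def using f g' surj by metis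
  then show ?thesis using homeomorphic_maps_map by blast
qed

text \<open>Charts differ by lattice vectors, and a continuous lattice-valued map is locally constant.\<close>

lemma lift_affine_diffeo:
  assumes A: "invertible A" "\<And>v. v \<in> lattice \<Longrightarrow> A *v v \<in> lattice"
    and f: "homeomorphic_map Y Y f"
    and f\<kappa>: "\<And>x z. x \<in> topspace Y \<Longrightarrow> \<kappa> x = coset n z \<Longrightarrow> \<kappa> (f x) = coset n (A *v z)"
  shows "affine_diffeo Y (pr \<circ> \<kappa>) A f"
  unfolding affine_diffeo_def
proof (intro conjI allI impI ballI A(1) f)
  fix U \<phi> V \<psi> x
  assume ch: "translation_chart Y (pr \<circ> \<kappa>) U \<phi> \<and> translation_chart Y (pr \<circ> \<kappa>) V \<psi>" and x: "x \<in> U" "f x \<in> V"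
  then have U: "openin Y U" "\<And>u. u \<in> U \<Longrightarrow> coset 1 (\<phi> u) = pr (\<kappa> u)" "continuous_map (subtopology Y U) euclidean \<phi>"
    and V: "openin Y V" "\<And>u. u \<in> V \<Longrightarrow> coset 1 (\<psi> u) = pr (\<kappa> u)" "continuous_map (subtopology Y V) euclidean \<psi>"
    unfolding translation_chart_def
    by (auto dest!: homeomorphic_imp_continuous_map intro: continuous_map_into_fulltopology)
  have fc: "continuous_map Y Y f" using f homeomorphic_imp_continuous_map by blast
  define N where "N = {u \<in> U. f u \<in> V}"
  have "N = U \<inter> {u \<in> topspace Y. f u \<in> V}" using openin_subset[OF U(1)] by (auto simp: N_def)
  then have N: "openin Y N" using U(1) openin_continuous_map_preimage[OF fc V(1)] by auto
  define \<theta> where "\<theta> u = \<psi> (f u) - A *v \<phi> u" for u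
  have \<theta>: "\<theta> u \<in> lattice" if u: "u \<in> N" for u
  proof -
    have uU: "u \<in> U" and fu: "f u \<in> V" using u by (auto simp: N_def)
    have uY: "u \<in> topspace Y" using uU openin_subset[OF U(1)] by blast
    obtain z where z: "\<kappa> u = coset n z" using obtain_Y[OF uY] .
    have "coset 1 (\<phi> u) = coset 1 z" using U(2)[OF uU] z by (simp only: pr_coset)
    then obtain a where a: "a \<in> lattice" "z = \<phi> u + real 1 *\<^sub>R a" unfolding coset_eq by blast
    have "coset 1 (\<psi> (f u)) = coset 1 (A *v z)" using V(2)[OF fu] f\<kappa>[OF uY z] by (simp only: pr_coset)
    then obtain b where b: "b \<in> lattice" "A *v z = \<psi> (f u) + real 1 *\<^sub>R b" unfolding coset_eq by blast
    have "\<theta> u = A *v a - b"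
      using a(2) b(2) by (simp add: \<theta>_def matrix_vector_right_distrib algebra_simps)
    then show ?thesis using lattice_diff A(2) a(1) b(1) by simp
  qed
  have "continuous_map (subtopology Y N) euclidean (\<lambda>u. \<psi> (f u))"
  proof -
    have "continuous_map (subtopology Y N) (subtopology Y V) f"
      using continuous_map_from_subtopology[OF fc] by (auto simp: continuous_map_in_subtopology N_def)
    from continuous_map_compose[OF this V(3)] show ?thesis by (simp only: o_def)
  qed
  moreover have "continuous_map (subtopology Y N) euclidean (\<lambda>u. A *v \<phi> u)"
  proof -
    have "continuous_map (subtopology Y N) euclidean \<phi>"
      using continuous_map_from_subtopology_mono[OF U(3)] by (auto simp: N_def)
    moreover have "continuous_map euclidean euclidean ((*v) A)"
      by (simp add: linear_continuous_on linear_conv_bounded_linear[symmetric])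
    ultimately have "continuous_map (subtopology Y N) euclidean ((*v) A \<circ> \<phi>)"
      by (rule continuous_map_compose)
    then show ?thesis by (simp only: o_def)
  qed
  ultimately have "continuous_map (subtopology Y N) euclidean \<theta>"
    unfolding \<theta>_def by (rule continuous_map_diff)
  then have "openin (subtopology Y N) {u \<in> topspace (subtopology Y N). \<theta> u \<in> ball (\<theta> x) 1}"
    by (rule openin_continuous_map_preimage) simp
  moreover have top: "topspace (subtopology Y N) = N" using openin_subset[OF N] by auto
  ultimately have N': "openin Y {u \<in> N. \<theta> u \<in> ball (\<theta> x) 1}"
    using N unfolding top openin_open_subtopology[OF N] by blast
  have xN: "x \<in> N" using x by (simp add: N_def)
  have "\<psi> (f u) = A *v \<phi> u + \<theta> x" if "u \<in> {u \<in> N. \<theta> u \<in> ball (\<theta> x) 1}" for u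
  proof -
    have "\<theta> x = \<theta> u" using lattice_dist[OF \<theta>[OF xN] \<theta>] that by simp
    then show ?thesis by (simp add: \<theta>_def)
  qed
  then show "\<exists>N b. openin Y N \<and> x \<in> N \<and> N \<subseteq> U \<and> f ` N \<subseteq> V \<and> (\<forall>u\<in>N. \<psi> (f u) = A *v \<phi> u + b)"
    using N' xN by (intro exI[of _ "{u \<in> N. \<theta> u \<in> ball (\<theta> x) 1}"] exI[of _ "\<theta> x"]) (auto simp: N_def)
qed

text \<open>If \<open>A s + b\<close> were not a branch point, a section around it would be carried back by \<open>g\<close>.\<close>

lemma branch_points_preserved:
  assumes g: "continuous_map Y X g"
    and g\<kappa>: "\<And>y w. y \<in> topspace Y \<Longrightarrow> \<kappa> y = coset n (A w + b) \<Longrightarrow> \<kappa> (g y) = coset n w"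
    and A: "linear A" "\<And>m. m \<in> lattice \<longleftrightarrow> A m + b \<in> lattice"
    and s: "s \<in> S"
  shows "A s + b \<in> S"
proof (rule ccontr)
  assume no: "A s + b \<notin> S"
  obtain x where x: "x \<in> topspace X" "\<kappa> x = coset n (A s + b)" using fibre_point[OF no] .
  obtain r t where t: "0 < r" "r \<le> 1 / 2" "lift (ball (A s + b) r) (\<lambda>w. w) t"
    using local_section[OF x no] by metis
  have cA: "continuous_on U A" for U using A(1) linear_conv_bounded_linear linear_continuous_on by blast
  have cE: "continuous_on U (\<lambda>w. A w + b)" for U by (intro continuous_intros cA)
  define N where "N = (\<lambda>w. A w + b) -` ball (A s + b) r \<inter> ball s 1"
  have N: "open N" unfolding N_def by (intro open_Int open_vimage open_ball cE)
  have sN: "s \<in> N" using t(1) by (simp add: N_def)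
  have nl: "A w + b \<notin> lattice" if "w \<in> N - {s}" for w
    using lattice_dist[of s w] s S_lattice that A(2) by (auto simp: N_def)
  have l: "lift (N - {s}) (\<lambda>w. A w + b) (\<lambda>w. t (A w + b))"
    by (rule lift_compose[OF t(3) cE]) (auto simp: N_def)
  have "lift (N - {s}) (\<lambda>w. w) (\<lambda>w. g (t (A w + b)))" unfolding lift_def
  proof
    have tY: "t (A w + b) \<in> topspace Y" if "w \<in> N - {s}" for w
      using Y_iff[OF lift_in[OF l that] lift_coset[OF l that]] nl[OF that] by simp
    then have "continuous_map (top_of_set (N - {s})) Y (\<lambda>w. t (A w + b))"
      using l by (subst Y_subtopology) (auto simp: lift_def continuous_map_in_subtopology)
    from continuous_map_compose[OF this g]
    show "continuous_map (top_of_set (N - {s})) X (\<lambda>w. g (t (A w + b)))" by (simp add: o_def)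
    show "\<forall>u\<in>N - {s}. \<kappa> (g (t (A u + b))) = coset n u" using g\<kappa> tY lift_coset[OF l] by blast
  qed
  then show False using no_section[OF s N sN] by blast
qed

end

section \<open>Commutation with the involution\<close>

context involution_cover begin

lemma h_Y:
  assumes "x \<in> topspace Y"
  shows "h x \<in> topspace Y"
proof -
  obtain z where z: "x \<in> topspace X" "\<kappa> x = coset n z" "z \<notin> lattice" using obtain_Y[OF assms] .
  then show ?thesis using Y_iff[OF h_in h_\<kappa>] lattice_uminus[of "- z"] by auto
qed

lemma continuous_h_Y: "continuous_map Y Y h"
  by (rule continuous_into_Y[OF _ h_Y]) (use h(1) Y_subtopology continuous_map_from_subtopology in metis)

text \<open>h fixes the points over 0, so the lifts \<open>h (s w)\<close> and
  \<open>s (- w)\<close> of -w agree at the centre of the ball, hence throughout.\<close>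

lemma section_at_0:
  obtains r s where "0 < r" "r \<le> 1 / 2" "ball 0 r \<inter> S = {}" "lift (ball 0 r) (\<lambda>w. w) s"
    "\<And>w. w \<in> ball 0 r \<Longrightarrow> h (s w) = s (- w)"
proof -
  have 0: "0 \<notin> S" by (rule S_2_torsion) simp
  obtain x where x: "x \<in> topspace X" "\<kappa> x = coset n 0" using fibre_point[OF 0] .
  obtain r s where s: "0 < r" "r \<le> 1 / 2" "ball 0 r \<inter> S = {}" "lift (ball 0 r) (\<lambda>w. w) s" "s 0 = x"
    using local_section[OF x 0] by metis
  have l1: "lift (ball 0 r) (\<lambda>w. - w) (\<lambda>w. h (s w))" using lift_h[OF s(4)] .
  have l2: "lift (ball 0 r) (\<lambda>w. - w) (\<lambda>w. s (- w))"
    by (rule lift_compose[OF s(4)]) (auto intro!: continuous_intros)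
  have nS: "- w \<notin> S" if "w \<in> ball 0 r" for w using s(3) that S_uminus by blast
  have hx: "h x = x" using h_fix[OF x] T_0 by simp
  have "x \<noteq> \<sigma> x" using \<sigma>_neq[OF x 0] by simp
  moreover have "(\<forall>w\<in>ball 0 r. h (s w) = s (- w)) \<or> (\<forall>w\<in>ball 0 r. h (s w) = \<sigma> (s (- w)))"
    by (rule lift_dichotomy[OF connected_ball _ nS l1 l2]) (auto intro!: continuous_intros)
  moreover have "h (s 0) = s (- 0)" using hx s(5) by simp
  ultimately have "\<forall>w\<in>ball 0 r. h (s w) = s (- w)" using s(1,5) by (metis centre_in_ball minus_zero)
  then show ?thesis using that[OF s(1-4)] by blast
qed

text \<open>Both composites lie over -A z, so they agree or differ by \<sigma>, and one point
  decides. Near a point over O, h takes \<open>s w\<close> to \<open>s (- w)\<close>, while f takes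
  \<open>s w\<close> to a sheet over A w; whichever sheet this is, the two maps commute
  there.\<close>

lemma commutes_with_h:
  assumes ne: "S \<noteq> {}" and f: "continuous_map Y X f" "\<And>x. x \<in> topspace Y \<Longrightarrow> f x \<in> topspace Y"
    and f\<kappa>: "\<And>x z. x \<in> topspace Y \<Longrightarrow> \<kappa> x = coset n z \<Longrightarrow> \<kappa> (f x) = coset n (A z)"
    and A: "linear A" "\<And>z. A z \<in> lattice \<longleftrightarrow> z \<in> lattice"
    and x: "x \<in> topspace Y"
  shows "f (h x) = h (f x)"
proof -
  have cA: "continuous_on U A" for U using A(1) linear_conv_bounded_linear linear_continuous_on by blast
  have Aneg: "A (- z) = - A z" for z using A(1) by (simp add: linear_neg)
  have c: "continuous_map Y X (\<lambda>x. f (h x))" "continuous_map Y X (\<lambda>x. h (f x))"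
    using continuous_map_compose[OF continuous_h_Y f(1)] continuous_map_compose[OF f(1) h(1)] by (simp_all add: o_def)
  have dich: "(\<forall>x\<in>topspace Y. f (h x) = h (f x)) \<or> (\<forall>x\<in>topspace Y. f (h x) = \<sigma> (h (f x)))"
  proof (rule map_dichotomy[OF ne c])
    show "continuous_on (- lattice) (\<lambda>z. - A z)" by (intro continuous_intros cA)
    show "- A z \<notin> S" if "z \<notin> lattice" for z using that A(2) S_uminus S_lattice by blast
    show "\<kappa> (f (h x)) = coset n (- A z)" "\<kappa> (h (f x)) = coset n (- A z)"
      if "x \<in> topspace Y" "\<kappa> x = coset n z" for x z
      using f\<kappa>[OF h_Y[OF that(1)], of "- z"] h_\<kappa>[of x z] h_\<kappa>[OF continuous_Y_in[OF f(1) that(1)] f\<kappa>[OF that]]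
        that topspace_Y_subset Aneg by auto
  qed
  obtain r s where s: "0 < r" "r \<le> 1 / 2" "ball 0 r \<inter> S = {}" "lift (ball 0 r) (\<lambda>w. w) s"
    "\<And>w. w \<in> ball 0 r \<Longrightarrow> h (s w) = s (- w)" using section_at_0 by blast
  have "open (A -` ball 0 r)" by (rule open_vimage[OF open_ball cA])
  then obtain d where d: "d > 0" "ball 0 d \<subseteq> A -` ball 0 r"
    using A(1) s(1) by (metis centre_in_ball linear_0 open_contains_ball vimageI)
  define e where "e = min d r"
  have e: "0 < e" "ball 0 e \<subseteq> ball 0 r" "ball 0 e \<subseteq> A -` ball 0 r"
    using d s(1) by (auto simp: e_def)
  \<comment> \<open>The points over the centre are punctures, at which nothing is assumed of f; in
    dimension 2 the punctured ball is still connected.\<close>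
  define D where "D = ball 0 e - {0::real^2}"
  have Dr: "w \<in> ball 0 r" "A w \<in> ball 0 r" "w \<notin> lattice" if "w \<in> D" for w
  proof -
    show wr: "w \<in> ball 0 r" "A w \<in> ball 0 r" using that subsetD[OF e(2), of w] subsetD[OF e(3), of w] unfolding D_def by blast+
    have "dist 0 w < 1" using wr(1) s(2) by simp
    then show "w \<notin> lattice" using lattice_dist[OF lattice_0, of w] that by (auto simp: D_def)
  qed
  have conn: "connected D" unfolding D_def by (rule connected_punctured_ball) simp
  have lsD: "lift D (\<lambda>w. w) s" by (rule lift_subset[OF s(4)]) (use Dr in blast)
  have sY: "s w \<in> topspace Y" "\<kappa> (s w) = coset n w" if "w \<in> D" for w
    using Y_iff[OF lift_in[OF lsD that] lift_coset[OF lsD that]] lift_coset[OF lsD that] Dr(3)[OF that] by auto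
  have lf: "lift D A (\<lambda>w. f (s w))" by (rule lift_map[OF f(1) lsD]) (use Dr f\<kappa> sY in auto)
  have lt: "lift D A (\<lambda>w. s (A w))" by (rule lift_compose[OF s(4) cA]) (use Dr in auto)
  have two: "(\<forall>w\<in>D. f (s w) = s (A w)) \<or> (\<forall>w\<in>D. f (s w) = \<sigma> (s (A w)))"
    by (rule lift_dichotomy[OF conn cA _ lf lt]) (use Dr(2) s(3) in blast)
  define w :: "real^2" where "w = (e / 2) *\<^sub>R axis 1 1"
  have wD: "w \<in> D" "- w \<in> D" using e(1) by (auto simp: D_def w_def dist_norm norm_axis_1)
  have "f (h (s w)) = h (f (s w))"
  proof -
    have 1: "h (s w) = s (- w)" "h (s (A w)) = s (A (- w))" using s(5) Dr[OF wD(1)] Aneg by auto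
    have ls: "s (A w) \<in> topspace X" "\<kappa> (s (A w)) = coset n (A w)" "A w \<notin> S"
      using lift_in[OF lt wD(1)] lift_coset[OF lt wD(1)] Dr(2)[OF wD(1)] s(3) by auto
    from two show ?thesis
    proof
      assume "\<forall>w\<in>D. f (s w) = s (A w)"
      then show ?thesis using 1 wD by simp
    next
      assume "\<forall>w\<in>D. f (s w) = \<sigma> (s (A w))"
      then show ?thesis using 1 wD h_\<sigma>[OF ls] by simp
    qed
  qed
  moreover have "\<sigma> (h (f (s w))) \<noteq> h (f (s w))"
  proof -
    have "h (f (s w)) \<in> topspace Y" using h_Y f(2) sY(1)[OF wD(1)] by blast
    then obtain z where "h (f (s w)) \<in> topspace X" "\<kappa> (h (f (s w))) = coset n z" "z \<notin> lattice" "z \<notin> S"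
      by (rule obtain_Y)
    then show ?thesis using \<sigma>_neq by blast
  qed
  ultimately show ?thesis using dich sY(1)[OF wD(1)] x by metis
qed

end

section \<open>The orbit of the torsion point\<close>

definition unit_vectors :: "(int \<times> int) set" where
  "unit_vectors = {(1, 0), (-1, 0), (0, 1), (0, -1)}"

text \<open>Up to sign these are the powers of 2 that the case distinctions on signed unit vectors
  leave over.\<close>

lemma odd_not_dvd:
  fixes n :: int
  assumes "odd n" "n \<ge> 3"
  shows "\<not> n dvd 1" "\<not> n dvd 2" "\<not> n dvd 4" "\<not> n dvd 8"
    "\<not> n dvd - 1" "\<not> n dvd - 2" "\<not> n dvd - 4" "\<not> n dvd - 8"
proof -
  have *: "\<not> n dvd 2 ^ k" for k :: nat
  proof
    assume dvd: "n dvd 2 ^ k"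
    have "coprime n (2 ^ k)" using assms(1) by simp
    then have "is_unit n" using dvd by (meson coprime_common_divisor dvd_refl)
    then show False using assms(2) by simp
  qed
  show "\<not> n dvd 1" "\<not> n dvd 2" "\<not> n dvd 4" "\<not> n dvd 8"
    using *[of 0] *[of 1] *[of 2] *[of 3] by simp_all
  then show "\<not> n dvd - 1" "\<not> n dvd - 2" "\<not> n dvd - 4" "\<not> n dvd - 8" by simp_all
qed

text \<open>The four vectors are the images of P, -P, P_1, -P_1 in the basis P, P_1. The two pairs
  have equal sums, twice the translation part, and their differences have determinant 4. All 256
  cases are checked, and each one not of the stated form violates a divisibility.\<close>

lemma unit_vectors_pairs:
  fixes n :: int
  assumes n: "odd n" "n \<ge> 3"
    and e: "(x1, y1) \<in> unit_vectors" "(x2, y2) \<in> unit_vectors" "(x3, y3) \<in> unit_vectors" "(x4, y4) \<in> unit_vectors"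
    and d: "n dvd x1 + x2 - (x3 + x4)" "n dvd y1 + y2 - (y3 + y4)"
      "n dvd (x1 - x2) * (y3 - y4) - (x3 - x4) * (y1 - y2) - 4"
  shows "x2 = - x1 \<and> y2 = - y1 \<and> x4 = - x3 \<and> y4 = - y3"
proof -
  note nd = odd_not_dvd[OF n]
  have a: "x1 = 1 \<and> y1 = 0 \<or> x1 = -1 \<and> y1 = 0 \<or> x1 = 0 \<and> y1 = 1 \<or> x1 = 0 \<and> y1 = -1"
    "x2 = 1 \<and> y2 = 0 \<or> x2 = -1 \<and> y2 = 0 \<or> x2 = 0 \<and> y2 = 1 \<or> x2 = 0 \<and> y2 = -1"
    "x3 = 1 \<and> y3 = 0 \<or> x3 = -1 \<and> y3 = 0 \<or> x3 = 0 \<and> y3 = 1 \<or> x3 = 0 \<and> y3 = -1"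
    "x4 = 1 \<and> y4 = 0 \<or> x4 = -1 \<and> y4 = 0 \<or> x4 = 0 \<and> y4 = 1 \<or> x4 = 0 \<and> y4 = -1"
    using e by (auto simp: unit_vectors_def)
  show ?thesis using a(1)
    by (elim disjE; use a(2) in \<open>elim disjE\<close>; use a(3) in \<open>elim disjE\<close>; use a(4) in \<open>elim disjE\<close>;
        use d nd in simp)
qed

lemma cancel_unit:
  fixes n :: int
  assumes "n dvd N * u - 1" "n dvd x * N"
  shows "n dvd x"
proof -
  have "n dvd x * N * u" using assms(2) by simp
  moreover have "n dvd x * (N * u - 1)" using assms(1) by simp
  ultimately have "n dvd x * N * u - x * (N * u - 1)" by (rule dvd_diff)
  then show ?thesis by (simp add: algebra_simps)
qed

text \<open>Multiplication by the transposed matrix turns the hypotheses into x and y times the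
  determinant \<open>p\<^sup>2 + q\<^sup>2\<close>, which u inverts modulo n.\<close>

lemma independent:
  fixes n p q :: int
  assumes u: "n dvd (p\<^sup>2 + q\<^sup>2) * u - 1" and d: "n dvd x * p - y * q" "n dvd x * q + y * p"
  shows "n dvd x" "n dvd y"
proof -
  have "n dvd (x * p - y * q) * p + (x * q + y * p) * q" by (rule dvd_add[OF dvd_mult2[OF d(1)] dvd_mult2[OF d(2)]])
  then have "n dvd x * (p\<^sup>2 + q\<^sup>2)" by (simp add: algebra_simps power2_eq_square)
  then show "n dvd x" using cancel_unit u by blast
  have "n dvd (x * q + y * p) * p - (x * p - y * q) * q" by (rule dvd_diff[OF dvd_mult2[OF d(2)] dvd_mult2[OF d(1)]])
  then have "n dvd y * (p\<^sup>2 + q\<^sup>2)" by (simp add: algebra_simps power2_eq_square)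
  then show "n dvd y" using cancel_unit u by blast
qed

definition residues :: "int \<Rightarrow> int \<Rightarrow> int \<Rightarrow> int \<Rightarrow> int \<Rightarrow> bool" where
  "residues n p q s t \<longleftrightarrow> (\<exists>(x, y)\<in>unit_vectors. n dvd s - (x * p - y * q) \<and> n dvd t - (x * q + y * p))"

text \<open>The orbit of \<open>(p, q)\<close> consists of the \<open>x P + y P\<^sub>1\<close> with \<open>(x, y)\<close> a signed unit vector; an affine map
  preserving it has its translation part determined by the sums of images of opposite points.\<close>

lemma affine_orbit:
  fixes n p q a b c d t1 t2 :: int
  assumes n: "odd n" "n \<ge> 3" and u: "n dvd (p\<^sup>2 + q\<^sup>2) * u - 1"
    and det: "a * d - b * c = 1"
    and pres: "\<And>s t. residues n p q s t \<Longrightarrow> residues n p q (a * s + b * t + t1) (c * s + d * t + t2)"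
  shows "n dvd t1 \<and> n dvd t2 \<and>
    (n dvd a - 1 \<and> n dvd b \<and> n dvd c \<and> n dvd d - 1 \<or> n dvd a + 1 \<and> n dvd b \<and> n dvd c \<and> n dvd d + 1 \<or>
     n dvd a \<and> n dvd b + 1 \<and> n dvd c - 1 \<and> n dvd d \<or> n dvd a \<and> n dvd b - 1 \<and> n dvd c + 1 \<and> n dvd d)"
proof -
  let ?N = "p\<^sup>2 + q\<^sup>2"
  have R: "residues n p q p q" "residues n p q (- p) (- q)" "residues n p q (- q) p" "residues n p q q (- p)"
    unfolding residues_def unit_vectors_def by auto
  obtain x1 y1 where 1: "(x1, y1) \<in> unit_vectors"
    "n dvd a * p + b * q + t1 - (x1 * p - y1 * q)" "n dvd c * p + d * q + t2 - (x1 * q + y1 * p)"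
    using pres[OF R(1)] unfolding residues_def by auto
  obtain x2 y2 where 2: "(x2, y2) \<in> unit_vectors"
    "n dvd a * (- p) + b * (- q) + t1 - (x2 * p - y2 * q)" "n dvd c * (- p) + d * (- q) + t2 - (x2 * q + y2 * p)"
    using pres[OF R(2)] unfolding residues_def by blast
  obtain x3 y3 where 3: "(x3, y3) \<in> unit_vectors"
    "n dvd a * (- q) + b * p + t1 - (x3 * p - y3 * q)" "n dvd c * (- q) + d * p + t2 - (x3 * q + y3 * p)"
    using pres[OF R(3)] unfolding residues_def by blast
  obtain x4 y4 where 4: "(x4, y4) \<in> unit_vectors"
    "n dvd a * q + b * (- p) + t1 - (x4 * p - y4 * q)" "n dvd c * q + d * (- p) + t2 - (x4 * q + y4 * p)"
    using pres[OF R(4)] unfolding residues_def by blast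
  \<comment> \<open>For opposite points the linear parts cancel, leaving twice the translation
    part.\<close>
  have s12: "n dvd 2 * t1 - ((x1 + x2) * p - (y1 + y2) * q)" "n dvd 2 * t2 - ((x1 + x2) * q + (y1 + y2) * p)"
    using dvd_add[OF 1(2) 2(2)] dvd_add[OF 1(3) 2(3)] by (simp_all add: algebra_simps)
  have s34: "n dvd 2 * t1 - ((x3 + x4) * p - (y3 + y4) * q)" "n dvd 2 * t2 - ((x3 + x4) * q + (y3 + y4) * p)"
    using dvd_add[OF 3(2) 4(2)] dvd_add[OF 3(3) 4(3)] by (simp_all add: algebra_simps)
  have D: "n dvd (x1 + x2 - (x3 + x4)) * p - (y1 + y2 - (y3 + y4)) * q"
    "n dvd (x1 + x2 - (x3 + x4)) * q + (y1 + y2 - (y3 + y4)) * p"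
    using dvd_diff[OF s34(1) s12(1)] dvd_diff[OF s34(2) s12(2)] by (simp_all add: algebra_simps)
  note D12 = independent[OF u D]
  \<comment> \<open>Differences of the images of opposite points, in A and B computed from the
    matrix, in U and V from the unit vectors. Equality of their determinants modulo n is the last
    hypothesis of \<open>unit_vectors_pairs\<close>.\<close>
  define A1 where "A1 = 2 * (a * p + b * q)"
  define A2 where "A2 = 2 * (c * p + d * q)"
  define B1 where "B1 = 2 * (b * p - a * q)"
  define B2 where "B2 = 2 * (d * p - c * q)"
  define U1 where "U1 = (x1 - x2) * p - (y1 - y2) * q"
  define U2 where "U2 = (x1 - x2) * q + (y1 - y2) * p"
  define V1 where "V1 = (x3 - x4) * p - (y3 - y4) * q"
  define V2 where "V2 = (x3 - x4) * q + (y3 - y4) * p"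
  have AU: "n dvd A1 - U1" "n dvd A2 - U2" "n dvd B1 - V1" "n dvd B2 - V2"
    using dvd_diff[OF 1(2) 2(2)] dvd_diff[OF 1(3) 2(3)] dvd_diff[OF 3(2) 4(2)] dvd_diff[OF 3(3) 4(3)]
    by (simp_all add: algebra_simps A1_def A2_def B1_def B2_def U1_def U2_def V1_def V2_def)
  have "n dvd (A1 - U1) * B2 + U1 * (B2 - V2) - ((A2 - U2) * B1 + U2 * (B1 - V1))"
    by (intro dvd_diff[OF dvd_add dvd_add] dvd_mult2[OF AU(1)] dvd_mult[OF AU(4)] dvd_mult2[OF AU(2)] dvd_mult[OF AU(3)])
  then have "n dvd (A1 * B2 - A2 * B1) - (U1 * V2 - U2 * V1)" by (simp add: algebra_simps)
  moreover have "A1 * B2 - A2 * B1 = 4 * (a * d - b * c) * ?N"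
    unfolding A1_def A2_def B1_def B2_def by (simp add: algebra_simps power2_eq_square)
  moreover have "U1 * V2 - U2 * V1 = ((x1 - x2) * (y3 - y4) - (x3 - x4) * (y1 - y2)) * ?N"
    unfolding U1_def U2_def V1_def V2_def by (simp add: algebra_simps power2_eq_square)
  ultimately have "n dvd 4 * ?N - ((x1 - x2) * (y3 - y4) - (x3 - x4) * (y1 - y2)) * ?N" using det by simp
  then have "n dvd (4 - ((x1 - x2) * (y3 - y4) - (x3 - x4) * (y1 - y2))) * ?N" by (simp add: left_diff_distrib)
  then have "n dvd 4 - ((x1 - x2) * (y3 - y4) - (x3 - x4) * (y1 - y2))" using cancel_unit u by blast
  then have D3: "n dvd (x1 - x2) * (y3 - y4) - (x3 - x4) * (y1 - y2) - 4" by (subst dvd_diff_commute)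
  have opp: "x2 = - x1" "y2 = - y1" "x4 = - x3" "y4 = - y3"
    using unit_vectors_pairs[OF n 1(1) 2(1) 3(1) 4(1) D12 D3] by auto
  have c2: "coprime n 2" using n(1) by simp
  have t: "n dvd t1" "n dvd t2" using s12 opp c2 by (simp_all add: coprime_dvd_mult_right_iff)
  have e: "n dvd a * p + b * q - (x1 * p - y1 * q)" "n dvd c * p + d * q - (x1 * q + y1 * p)"
    "n dvd b * p - a * q - (x3 * p - y3 * q)" "n dvd d * p - c * q - (x3 * q + y3 * p)"
    using dvd_diff[OF 1(2) t(1)] dvd_diff[OF 1(3) t(2)] dvd_diff[OF 3(2) t(1)] dvd_diff[OF 3(3) t(2)]
    by (simp_all add: algebra_simps)
  have "n dvd 4 * (x1 * y3 - x3 * y1) - 4" using D3 opp by (simp add: algebra_simps)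
  then have "n dvd 4 * (x1 * y3 - x3 * y1 - 1)" by (simp add: algebra_simps)
  moreover have "coprime n 4" using c2 by (metis coprime_mult_right_iff mult_2_right numeral_Bit0)
  ultimately have d1: "n dvd x1 * y3 - x3 * y1 - 1" by (metis coprime_dvd_mult_right_iff)
  have cases: "(x1, y1, x3, y3) \<in> {(1, 0, 0, 1), (-1, 0, 0, -1), (0, 1, -1, 0), (0, -1, 1, 0)}"
  proof -
    have "x1 = 1 \<and> y1 = 0 \<or> x1 = -1 \<and> y1 = 0 \<or> x1 = 0 \<and> y1 = 1 \<or> x1 = 0 \<and> y1 = -1"
      "x3 = 1 \<and> y3 = 0 \<or> x3 = -1 \<and> y3 = 0 \<or> x3 = 0 \<and> y3 = 1 \<or> x3 = 0 \<and> y3 = -1"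
      using 1(1) 3(1) by (auto simp: unit_vectors_def)
    then show ?thesis by (elim disjE; use d1 odd_not_dvd(1,2,5,6)[OF n] in simp)
  qed
  \<comment> \<open>A row (a, b) is determined modulo n by its products with P and P_1;
    \<open>independent\<close> is applied to \<open>a - x\<close> and
    \<open>- (b + y)\<close>.\<close>
  have lin: "n dvd a - x" "n dvd b + y"
    if "n dvd a * p + b * q - (x * p - y * q)" "n dvd b * p - a * q - (- y * p - x * q)" for a b x y :: int
  proof -
    have "n dvd (a - x) * p - (- (b + y)) * q" "n dvd (a - x) * q + (- (b + y)) * p"
      using that(1) that(2)[THEN dvd_minus_iff[THEN iffD2]] by (simp_all add: algebra_simps)
    then show "n dvd a - x" "n dvd b + y" using independent[OF u] by (metis dvd_minus_iff)+
  qed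
  have abcd: "n dvd a - x1 \<and> n dvd b + y1 \<and> n dvd c - y1 \<and> n dvd d - x1"
  proof -
    have xy: "x3 = - y1" "y3 = x1" using cases by auto
    have "n dvd a - x1" "n dvd b + y1" using lin[of a b x1 y1] e xy by simp_all
    moreover have "n dvd c - y1" "n dvd d + - x1" using lin[of c d y1 "- x1"] e xy by (simp_all add: algebra_simps)
    ultimately show ?thesis by simp
  qed
  have "x1 = 1 \<and> y1 = 0 \<or> x1 = -1 \<and> y1 = 0 \<or> x1 = 0 \<and> y1 = 1 \<or> x1 = 0 \<and> y1 = -1"
    using cases by auto
  then show ?thesis using t abcd by (elim disjE) simp_all
qed

section \<open>The Veech group\<close>

definition rvec :: "int \<Rightarrow> int \<Rightarrow> real^2" where
  "rvec a b = vector [of_int a, of_int b]"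

lemma rvec_nth [simp]: "rvec a b $ 1 = of_int a" "rvec a b $ 2 = of_int b"
  by (simp_all add: rvec_def)

lemma rvec_add: "rvec a b + rvec c d = rvec (a + c) (b + d)"
  and rvec_scale: "real m *\<^sub>R rvec a b = rvec (int m * a) (int m * b)"
  and rvec_uminus: "- rvec a b = rvec (- a) (- b)"
  and rvec_eq: "rvec a b = rvec c d \<longleftrightarrow> a = c \<and> b = d" by (simp_all add: vec_eq_iff forall_2)

lemma rvec_lattice: "rvec a b \<in> lattice"
  by (simp add: lattice_def forall_2)

lemma lattice_rvec:
  assumes "v \<in> lattice"
  obtains a b where "v = rvec a b"
proof -
  have "v $ 1 \<in> \<int>" "v $ 2 \<in> \<int>" using assms by (simp_all add: lattice_def)
  then obtain a b where "v $ 1 = of_int a" "v $ 2 = of_int b" by (auto elim!: Ints_cases)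
  then have "v = rvec a b" by (simp add: vec_eq_iff forall_2)
  then show ?thesis by (rule that)
qed

lemma coset_rvec: "coset m (rvec a b) = coset m (rvec c d) \<longleftrightarrow> int m dvd c - a \<and> int m dvd d - b"
proof
  assume "coset m (rvec a b) = coset m (rvec c d)"
  then obtain v where v: "v \<in> lattice" "rvec c d = rvec a b + real m *\<^sub>R v" unfolding coset_eq by blast
  obtain e f where "v = rvec e f" using lattice_rvec[OF v(1)] .
  then have "c = a + int m * e" "d = b + int m * f" using v(2) by (simp_all add: rvec_scale rvec_add rvec_eq)
  then show "int m dvd c - a \<and> int m dvd d - b" by simp
next
  assume "int m dvd c - a \<and> int m dvd d - b"
  then obtain e f where "c - a = int m * e" "d - b = int m * f" by (auto elim!: dvdE)
  then have "rvec c d = rvec a b + real m *\<^sub>R rvec e f"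
    by (simp add: rvec_scale rvec_add rvec_eq algebra_simps)
  then show "coset m (rvec a b) = coset m (rvec c d)" unfolding coset_eq using rvec_lattice by blast
qed

lemma real_matrix_rvec:
  "real_matrix A *v rvec s t = rvec (A$1$1 * s + A$1$2 * t) (A$2$1 * s + A$2$2 * t)"
  by (simp add: vec_eq_iff forall_2 matrix_vector_mult_def sum_2 real_matrix_def)

lemma real_matrix_lattice: "v \<in> lattice \<Longrightarrow> real_matrix A *v v \<in> lattice"
  by (metis lattice_rvec real_matrix_rvec rvec_lattice)

lemma det_real_matrix: "det (real_matrix A) = real_of_int (det A)"
  by (simp add: det_2 real_matrix_def)

lemma integral_matrix:
  assumes "\<And>v. v \<in> lattice \<Longrightarrow> R *v v \<in> lattice"
  obtains A where "R = real_matrix A"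
proof -
  have "R *v rvec 1 0 \<in> lattice" "R *v rvec 0 1 \<in> lattice" using assms rvec_lattice by blast+
  then have "R $ i $ j \<in> \<int>" for i j using exhaust_2[of i] exhaust_2[of j]
    by (auto simp: lattice_def forall_2 matrix_vector_mult_def sum_2)
  then have "R $ i $ j = of_int \<lfloor>R $ i $ j\<rfloor>" for i j by (simp add: of_int_floor_cancel)
  then have "R = real_matrix (\<chi> i j. \<lfloor>R $ i $ j\<rfloor>)" by (simp add: real_matrix_def vec_eq_iff)
  then show ?thesis by (rule that)
qed

lemma mat2_nth [simp]: "mat2 a b c d $ 1 $ 1 = a" "mat2 a b c d $ 1 $ 2 = b"
   "mat2 a b c d $ 2 $ 1 = c" "mat2 a b c d $ 2 $ 2 = d" by (simp_all add: mat2_def)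

lemma mat2_eta: "mat2 (A$1$1) (A$1$2) (A$2$1) (A$2$2) = A"
  by (simp add: vec_eq_iff forall_2)

lemma cong_quarter_turn_iff:
  "cong_quarter_turn n A \<longleftrightarrow>
    (n dvd A$1$1 - 1 \<and> n dvd A$1$2 \<and> n dvd A$2$1 \<and> n dvd A$2$2 - 1 \<or>
     n dvd A$1$1 + 1 \<and> n dvd A$1$2 \<and> n dvd A$2$1 \<and> n dvd A$2$2 + 1 \<or>
     n dvd A$1$1 \<and> n dvd A$1$2 + 1 \<and> n dvd A$2$1 - 1 \<and> n dvd A$2$2 \<or>
     n dvd A$1$1 \<and> n dvd A$1$2 - 1 \<and> n dvd A$2$1 + 1 \<and> n dvd A$2$2)"
  by (simp add: cong_quarter_turn_def mat_cong_def forall_2 cong_iff_dvd_diff)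

lemma SL2Z_iff: "A \<in> SL2Z \<longleftrightarrow> A$1$1 * A$2$2 - A$1$2 * A$2$1 = 1"
  by (simp add: SL2Z_def det_2)

text \<open>Modulo 2 a column with odd sum is a unit vector, and two distinct unit vectors form the
  identity or the swap, which are the quarter turns modulo 2. Columns give the form in the theorem;
  the analogue for rows expresses that A fixes M.\<close>

lemma cong_quarter_turn_2_columns:
  assumes "A \<in> SL2Z"
  shows "cong_quarter_turn 2 A \<longleftrightarrow> odd (A$1$1 + A$2$1) \<and> odd (A$1$2 + A$2$2)"
proof -
  have "odd (A$1$1 * A$2$2 - A$1$2 * A$2$1)" using assms by (simp add: SL2Z_iff)
  then show ?thesis unfolding cong_quarter_turn_iff by auto
qed

lemma cong_quarter_turn_2_rows:
  assumes "A \<in> SL2Z"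
  shows "cong_quarter_turn 2 A \<longleftrightarrow> odd (A$1$1 + A$1$2) \<and> odd (A$2$1 + A$2$2)"
proof -
  have "odd (A$1$1 * A$2$2 - A$1$2 * A$2$1)" using assms by (simp add: SL2Z_iff)
  then show ?thesis unfolding cong_quarter_turn_iff by auto
qed

definition adj :: "int^2^2 \<Rightarrow> int^2^2" where
  "adj A = mat2 (A$2$2) (- A$1$2) (- A$2$1) (A$1$1)"

lemma adj_SL2Z: "A \<in> SL2Z \<Longrightarrow> adj A \<in> SL2Z"
  by (simp add: SL2Z_iff adj_def algebra_simps)

lemma cong_quarter_turn_adj: "cong_quarter_turn m A \<Longrightarrow> cong_quarter_turn m (adj A)"
proof -
  have m: "m dvd - x - 1 \<longleftrightarrow> m dvd x + 1" "m dvd - x + 1 \<longleftrightarrow> m dvd x - 1" "m dvd 1 - x \<longleftrightarrow> m dvd x - 1" for x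
    using dvd_minus_iff[of m "x + 1"] dvd_diff_commute[of m 1 x] by (simp_all del: dvd_minus_iff)
  show "cong_quarter_turn m A \<Longrightarrow> cong_quarter_turn m (adj A)"
    unfolding cong_quarter_turn_iff adj_def by (auto simp: m)
qed

lemma adj_inverse:
  assumes "A \<in> SL2Z"
  shows "real_matrix A *v (real_matrix (adj A) *v v) = v" "real_matrix (adj A) *v (real_matrix A *v v) = v"
proof -
  have d: "real_of_int (A$1$1) * real_of_int (A$2$2) - real_of_int (A$1$2) * real_of_int (A$2$1) = 1"
    using arg_cong[OF assms[unfolded SL2Z_iff], of real_of_int] by simp
  have "real_matrix A ** real_matrix (adj A) = mat 1" "real_matrix (adj A) ** real_matrix A = mat 1"
    using d by (simp_all add: vec_eq_iff forall_2 matrix_matrix_mult_def sum_2 real_matrix_def adj_def mat_def algebra_simps)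
  then show "real_matrix A *v (real_matrix (adj A) *v v) = v" "real_matrix (adj A) *v (real_matrix A *v v) = v"
    by (simp_all add: matrix_vector_mul_assoc)
qed

lemma adj_lattice:
  assumes "A \<in> SL2Z"
  shows "real_matrix A *v v \<in> lattice \<longleftrightarrow> v \<in> lattice"
  using real_matrix_lattice adj_inverse(2)[OF assms] by metis

lemma linear_mult: "linear ((*v) (R :: real^2^2))"
  by (simp add: linear_conv_bounded_linear[symmetric])

lemma coset_mult:
  assumes "coset m z = coset m w"
  shows "coset m (real_matrix A *v z) = coset m (real_matrix A *v w)"
proof -
  obtain v where "v \<in> lattice" "w = z + real m *\<^sub>R v" using assms coset_eq by blast
  then have "real_matrix A *v w = real_matrix A *v z + real m *\<^sub>R (real_matrix A *v v)" "real_matrix A *v v \<in> lattice"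
    by (simp_all add: matrix_vector_right_distrib matrix_vector_mult_scaleR real_matrix_lattice)
  then show ?thesis using coset_eq by blast
qed

text \<open>u is the determinant of an inverse B, since the determinant of the product is 1 modulo
  n.\<close>

lemma invertible_mod_norm:
  assumes "invertible_mod n (mat2 p (- q) q p)"
  obtains u where "n dvd (p\<^sup>2 + q\<^sup>2) * u - 1"
proof -
  obtain B where "mat_cong n (mat2 p (- q) q p ** B) (mat 1)" using assms by (auto simp: invertible_mod_def)
  then have B: "n dvd (p * B$1$1 - q * B$2$1) - 1" "n dvd p * B$1$2 - q * B$2$2"
    "n dvd q * B$1$1 + p * B$2$1" "n dvd (q * B$1$2 + p * B$2$2) - 1"
    by (simp_all add: mat_cong_def forall_2 cong_iff_dvd_diff matrix_matrix_mult_def sum_2 mat_def)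
  define a b c d where "a = p * B$1$1 - q * B$2$1" and "b = p * B$1$2 - q * B$2$2"
    and "c = q * B$1$1 + p * B$2$1" and "d = q * B$1$2 + p * B$2$2"
  \<comment> \<open>This is a d - b c - 1, split so that each summand is divisible by n.\<close>
  have "n dvd (a - 1) * d + (d - 1) - b * c"
    using B unfolding a_def[symmetric] b_def[symmetric] c_def[symmetric] d_def[symmetric]
    by (intro dvd_diff[OF dvd_add] dvd_mult2) auto
  moreover have "(a - 1) * d + (d - 1) - b * c = (p\<^sup>2 + q\<^sup>2) * (B$1$1 * B$2$2 - B$1$2 * B$2$1) - 1"
    unfolding a_def b_def c_def d_def by (simp add: algebra_simps power2_eq_square)
  ultimately show ?thesis using that by metis
qed

text \<open>The representative of M in the plane.\<close>

definition half :: "nat \<Rightarrow> real^2" where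
  "half n = vector [real n / 2, real n / 2]"

text \<open>For odd n the point M is not n-torsion; the points over it are therefore not punctures,
  and affine maps can be evaluated there.\<close>

lemma half_not_lattice: "odd n \<Longrightarrow> half n \<notin> lattice"
proof
  assume n: "odd n" and "half n \<in> lattice"
  then have "real n / 2 \<in> \<int>" by (auto simp: lattice_def half_def forall_2)
  then obtain k where "real n / 2 = of_int k" by (auto elim: Ints_cases)
  then have "int n = 2 * k" by linarith
  then show False using n by presburger
qed

text \<open>The i-th coordinate of the image is n / 2 times the i-th row sum, which is n / 2 modulo
  n exactly for an odd row sum.\<close>

lemma half_image:
  assumes "n > 0"
  shows "coset n (real_matrix A *v half n) = coset n (half n) \<longleftrightarrow> odd (A$1$1 + A$1$2) \<and> odd (A$2$1 + A$2$2)"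
proof -
  have nth: "(real_matrix A *v half n) $ 1 = real n / 2 * real_of_int (A$1$1 + A$1$2)"
    "(real_matrix A *v half n) $ 2 = real n / 2 * real_of_int (A$2$1 + A$2$2)"
    by (simp_all add: half_def real_matrix_def matrix_vector_mult_def sum_2 algebra_simps)
  show ?thesis
  proof
    assume "coset n (real_matrix A *v half n) = coset n (half n)"
    then obtain v where v: "v \<in> lattice" "real_matrix A *v half n = half n + real n *\<^sub>R v"
      unfolding coset_eq[of n "half n"] by (metis coset_eq)
    obtain e f where ef: "v = rvec e f" using lattice_rvec[OF v(1)] .
    have "real n / 2 * real_of_int (A$1$1 + A$1$2) = real n / 2 * (1 + 2 * real_of_int e)"
      "real n / 2 * real_of_int (A$2$1 + A$2$2) = real n / 2 * (1 + 2 * real_of_int f)"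
      using nth v(2) ef by (simp_all add: half_def algebra_simps)
    then have "real_of_int (A$1$1 + A$1$2) = 1 + 2 * real_of_int e" "real_of_int (A$2$1 + A$2$2) = 1 + 2 * real_of_int f"
      using assms by simp_all
    then have "A$1$1 + A$1$2 = 1 + 2 * e" "A$2$1 + A$2$2 = 1 + 2 * f" by linarith+
    then show "odd (A$1$1 + A$1$2) \<and> odd (A$2$1 + A$2$2)" by presburger
  next
    assume odd: "odd (A$1$1 + A$1$2) \<and> odd (A$2$1 + A$2$2)"
    obtain e where "A$1$1 + A$1$2 = 2 * e + 1" using conjunct1[OF odd] by (rule oddE)
    moreover obtain f where "A$2$1 + A$2$2 = 2 * f + 1" using conjunct2[OF odd] by (rule oddE)
    ultimately have "real_matrix A *v half n = half n + real n *\<^sub>R rvec e f"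
      using nth by (simp add: vec_eq_iff forall_2 half_def algebra_simps)
    then have "coset n (half n) = coset n (real_matrix A *v half n)" unfolding coset_eq using rvec_lattice by blast
    then show "coset n (real_matrix A *v half n) = coset n (half n)" by simp
  qed
qed

lemma torsion_point_rvec: "torsion_point n a b = coset n (rvec a b)"
  by (simp add: torsion_point_def rvec_def)

lemma rot90_rot90: "rot90 (rot90 z) = - z"
  by (simp add: rot90_def vec_eq_iff forall_2)

section \<open>The origami covering and the two inclusions\<close>

locale origami =
  fixes n :: nat and p q :: int and X :: "'a topology" and \<kappa> :: "'a \<Rightarrow> (real^2) set"
  assumes n: "n \<ge> 3" "odd n"
    and unit: "invertible_mod (int n) (mat2 p (- q) q p)"
    and origami: "origami_covering n p q X \<kappa>"
begin

definition B :: "(real^2) set set" where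
  "B = {torsion_point n p q, torsion_point n (- q) p, torsion_point n (- p) (- q), torsion_point n q (- p)}"

definition T :: "real^2 \<Rightarrow> bool" where
  "T z \<longleftrightarrow> coset n z \<in> {coset n 0, coset n (half n)}"

sublocale double_cover n X \<kappa> B
proof
  show "n > 0" using n by simp
  show "ramified_covering X (torus n) \<kappa> 2 B" using origami by (simp add: origami_covering_def B_def)
  show "B \<subseteq> coset n ` lattice" using rvec_lattice by (auto simp only: B_def torsion_point_rvec)
qed

lemma B_eq: "B = (\<lambda>(x, y). coset n (rvec (x * p - y * q) (x * q + y * p))) ` unit_vectors"
  by (auto simp: B_def unit_vectors_def torsion_point_rvec)

lemma S_residues: "z \<in> S \<longleftrightarrow> (\<exists>s t. z = rvec s t \<and> residues (int n) p q s t)"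
proof
  assume z: "z \<in> S"
  then obtain s t where st: "z = rvec s t" using S_lattice lattice_rvec by blast
  have "coset n z \<in> B" using z by (simp add: S_def)
  then obtain x y where "(x, y) \<in> unit_vectors" "coset n z = coset n (rvec (x * p - y * q) (x * q + y * p))"
    unfolding B_eq by auto
  then have "residues (int n) p q s t" unfolding residues_def st coset_rvec by (auto simp: dvd_diff_commute)
  then show "\<exists>s t. z = rvec s t \<and> residues (int n) p q s t" using st by blast
next
  assume "\<exists>s t. z = rvec s t \<and> residues (int n) p q s t"
  then obtain s t x y where "z = rvec s t" "(x, y) \<in> unit_vectors"
    "int n dvd s - (x * p - y * q)" "int n dvd t - (x * q + y * p)" unfolding residues_def by blast
  then have "coset n z = coset n (rvec (x * p - y * q) (x * q + y * p))" "(x, y) \<in> unit_vectors"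
    by (simp_all add: coset_rvec dvd_diff_commute)
  then have "coset n z \<in> B" unfolding B_eq by force
  then show "z \<in> S" by (simp add: S_def)
qed

lemma S_rvec: "rvec s t \<in> S \<longleftrightarrow> residues (int n) p q s t"
  unfolding S_residues rvec_eq by blast

lemma S_nonempty: "S \<noteq> {}"
proof -
  have "residues (int n) p q p q" unfolding residues_def unit_vectors_def by auto
  then show ?thesis using S_rvec by blast
qed

lemma involution:
  obtains h where "involution_cover n X \<kappa> B h T"
proof -
  obtain c where c: "homeomorphic_map X X c" "\<And>x. x \<in> topspace X \<Longrightarrow> \<kappa> (c x) = cbar (\<kappa> x)"
    "{x \<in> topspace X. c (c x) = x} = {x \<in> topspace X. \<kappa> x \<in> {coset n 0, coset n (half n)}}"
    using origami unfolding origami_covering_def half_def by blast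
  have c_in: "c x \<in> topspace X" if "x \<in> topspace X" for x
    using homeomorphic_imp_surjective_map[OF c(1)] that by blast
  have c_inj: "inj_on c (topspace X)" using homeomorphic_imp_injective_map[OF c(1)] .
  obtain u where u: "int n dvd (p\<^sup>2 + q\<^sup>2) * u - 1" using invertible_mod_norm[OF unit] .
  have "involution_cover n X \<kappa> B (\<lambda>x. c (c x)) T"
  proof (unfold_locales)
    show "continuous_map X X (\<lambda>x. c (c x))"
      using continuous_map_compose[OF homeomorphic_imp_continuous_map[OF c(1)] homeomorphic_imp_continuous_map[OF c(1)]]
      by (simp add: o_def)
    show "inj_on (\<lambda>x. c (c x)) (topspace X)" using c_inj c_in by (simp add: inj_on_def)
    show "\<kappa> (c (c x)) = coset n (- z)" if "x \<in> topspace X" "\<kappa> x = coset n z" for x z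
      using c(2)[OF c_in[OF that(1)]] c(2)[OF that(1)] that(2) by (simp add: cbar_coset rot90_rot90)
    show "(c (c x) = x) = T z" if "x \<in> topspace X" "\<kappa> x = coset n z" for x z
      using c(3) that unfolding T_def by (metis (mono_tags, lifting) mem_Collect_eq)
    show "T 0" by (simp add: T_def)
    show "(- z \<in> S) = (z \<in> S)" for z
    proof -
      have sym: "- z \<in> S" if "z \<in> S" for z
      proof -
        obtain s t where st: "z = rvec s t" "residues (int n) p q s t" using \<open>z \<in> S\<close> S_residues by blast
        then obtain x y where xy: "(x, y) \<in> unit_vectors"
          "int n dvd s - (x * p - y * q)" "int n dvd t - (x * q + y * p)" unfolding residues_def by blast
        have "(- x, - y) \<in> unit_vectors" using xy(1) by (auto simp: unit_vectors_def)
        moreover have "int n dvd - s - (- x * p - (- y) * q)" "int n dvd - t - (- x * q + (- y) * p)"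
          using xy(2,3)[THEN dvd_minus_iff[THEN iffD2]] by (simp_all add: algebra_simps)
        ultimately have "residues (int n) p q (- s) (- t)" unfolding residues_def by blast
        then show ?thesis using st(1) S_rvec by (simp add: rvec_uminus)
      qed
      show ?thesis using sym[of z] sym[of "- z"] by auto
    qed
    \<comment> \<open>As n is odd, a 2-torsion point with integer coordinates is zero modulo n,
      whereas a signed unit vector in the basis P, P_1 is not.\<close>
    show "z \<notin> S" if "coset n (- z) = coset n z" for z
    proof
      assume "z \<in> S"
      then obtain s t where st: "z = rvec s t" "residues (int n) p q s t" using S_residues by blast
      have "int n dvd 2 * s" "int n dvd 2 * t" using that unfolding st(1) rvec_uminus coset_rvec by simp_all
      moreover have "coprime (int n) 2" using n(2) by simp
      ultimately have "int n dvd s" "int n dvd t" by (simp_all add: coprime_dvd_mult_right_iff)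
      moreover obtain x y where xy: "(x, y) \<in> unit_vectors"
          "int n dvd s - (x * p - y * q)" "int n dvd t - (x * q + y * p)" using st(2) unfolding residues_def by blast
      ultimately have "int n dvd x * p - y * q" "int n dvd x * q + y * p"
        using dvd_diff[of "int n" s "s - (x * p - y * q)"] dvd_diff[of "int n" t "t - (x * q + y * p)"] by simp_all
      then have "int n dvd x" "int n dvd y" using independent[OF u] by blast+
      moreover have "\<not> int n dvd 1" using n(1) by simp
      ultimately show False using xy(1) by (auto simp: unit_vectors_def)
    qed
  qed
  then show ?thesis by (rule that)
qed

lemma quarter_turn_S:
  assumes "cong_quarter_turn (int n) A" "z \<in> S"
  shows "real_matrix A *v z \<in> S"
proof -
  obtain s t where st: "z = rvec s t" "residues (int n) p q s t" using assms(2) S_residues by blast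
  then obtain x y where xy: "(x, y) \<in> unit_vectors"
    "int n dvd s - (x * p - y * q)" "int n dvd t - (x * q + y * p)" unfolding residues_def by blast
  define a b c d where "a = A$1$1" and "b = A$1$2" and "c = A$2$1" and "d = A$2$2"
  \<comment> \<open>Modulo n the matrix is multiplication by the Gaussian integer k + l i. It
    commutes with the basis matrix of P and P_1 and so acts on the coordinates (x, y) as on x + y
    i.\<close>
  have *: "residues (int n) p q (a * s + b * t) (c * s + d * t)"
    if k: "int n dvd a - k" "int n dvd b + l" "int n dvd c - l" "int n dvd d - k"
      and kl: "(k * x - l * y, k * y + l * x) \<in> unit_vectors" for k l
  proof -
    have "int n dvd ((a - k) * s + (b + l) * t) + (k * (s - (x * p - y * q)) - l * (t - (x * q + y * p)))"
      "int n dvd ((c - l) * s + (d - k) * t) + (l * (s - (x * p - y * q)) + k * (t - (x * q + y * p)))"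
      by (intro dvd_add[OF dvd_add dvd_diff] dvd_mult2[OF k(1)] dvd_mult2[OF k(2)] dvd_mult[OF xy(2)] dvd_mult[OF xy(3)])
         (intro dvd_add[OF dvd_add dvd_add] dvd_mult2[OF k(3)] dvd_mult2[OF k(4)] dvd_mult[OF xy(2)] dvd_mult[OF xy(3)])
    then have "int n dvd a * s + b * t - ((k * x - l * y) * p - (k * y + l * x) * q)"
      "int n dvd c * s + d * t - ((k * x - l * y) * q + (k * y + l * x) * p)" by (simp_all add: algebra_simps)
    then show ?thesis using kl unfolding residues_def by blast
  qed
  have "residues (int n) p q (a * s + b * t) (c * s + d * t)"
    using assms(1) *[of 1 0] *[of "-1" 0] *[of 0 1] *[of 0 "-1"] xy(1)
    unfolding cong_quarter_turn_iff a_def[symmetric] b_def[symmetric] c_def[symmetric] d_def[symmetric]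
    by (auto simp: unit_vectors_def)
  then show ?thesis unfolding st(1) real_matrix_rvec S_rvec a_def b_def c_def d_def .
qed

lemma quarter_turn_T:
  assumes "A \<in> SL2Z" "cong_quarter_turn 2 A" "T z"
  shows "T (real_matrix A *v z)"
proof -
  have "coset n (real_matrix A *v half n) = coset n (half n)"
    using half_image[OF n_pos] cong_quarter_turn_2_rows assms(1,2) by blast
  then show ?thesis using assms(3) coset_mult[of n z 0 A] coset_mult[of n z "half n" A] unfolding T_def by auto
qed

lemma symmetry_lift:
  assumes A: "A \<in> SL2Z" "cong_quarter_turn (int n) A" "cong_quarter_turn 2 A"
  obtains f where "continuous_map Y X f"
    "\<And>x z. x \<in> topspace Y \<Longrightarrow> \<kappa> x = coset n z \<Longrightarrow> \<kappa> (f x) = coset n (real_matrix A *v z)"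
proof -
  note A' = adj_SL2Z[OF A(1)] cong_quarter_turn_adj[OF A(2)] cong_quarter_turn_adj[OF A(3)]
  note inv = adj_inverse[OF A(1)]
  obtain h where "involution_cover n X \<kappa> B h T" using involution .
  then interpret h: involution_cover n X \<kappa> B h T .
  interpret involution_symmetry n X \<kappa> B "(*v) (real_matrix A)" "(*v) (real_matrix (adj A))" h T
  proof
    show "(real_matrix A *v z \<in> S) = (z \<in> S)" for z
      using quarter_turn_S[OF A(2), of z] quarter_turn_S[OF A'(2), of "real_matrix A *v z"] inv(2) by auto
    show "T (real_matrix A *v z) = T z" for z
      using quarter_turn_T[OF A(1,3), of z] quarter_turn_T[OF A'(1,3), of "real_matrix A *v z"] inv(2) by auto
  qed (use inv adj_lattice[OF A(1)] in \<open>auto simp: matrix_vector_right_distrib matrix_vector_mult_scaleR\<close>)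
  show ?thesis using symmetry_lifts that by blast
qed

lemma in_veech_group:
  assumes A: "A \<in> SL2Z" "cong_quarter_turn (int n) A" "cong_quarter_turn 2 A"
  shows "real_matrix A \<in> veech_group X (pr \<circ> \<kappa>)"
proof -
  note A' = adj_SL2Z[OF A(1)] cong_quarter_turn_adj[OF A(2)] cong_quarter_turn_adj[OF A(3)]
  obtain f where f: "continuous_map Y X f"
    "\<And>x z. x \<in> topspace Y \<Longrightarrow> \<kappa> x = coset n z \<Longrightarrow> \<kappa> (f x) = coset n (real_matrix A *v z)"
    using symmetry_lift[OF A] by blast
  obtain g where g: "continuous_map Y X g"
    "\<And>x z. x \<in> topspace Y \<Longrightarrow> \<kappa> x = coset n z \<Longrightarrow> \<kappa> (g x) = coset n (real_matrix (adj A) *v z)"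
    using symmetry_lift[OF A'] by blast
  have f_homeo: "homeomorphic_map Y Y f"
    by (rule symmetry_homeomorphic[OF S_nonempty f(1) g(1) adj_lattice[OF A(1)] adj_lattice[OF A'(1)]
      adj_inverse[OF A(1)] f(2) g(2)])
  have det: "det (real_matrix A) = 1" using A(1) by (simp add: det_real_matrix SL2Z_def)
  then have inv: "invertible (real_matrix A)" by (simp add: invertible_det_nz)
  have "affine_diffeo Y (pr \<circ> \<kappa>) (real_matrix A) f"
    by (rule lift_affine_diffeo[OF inv real_matrix_lattice f_homeo f(2)])
  then show ?thesis unfolding veech_group_def Y_def using det by auto
qed

lemma veech_group_sub:
  assumes R: "R \<in> veech_group X (pr \<circ> \<kappa>)"
  obtains A where "R = real_matrix A" "A \<in> SL2Z" "cong_quarter_turn (int n) A" "cong_quarter_turn 2 A"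
proof -
  obtain f where det: "det R > 0" and f: "affine_diffeo Y (pr \<circ> \<kappa>) R f"
    using R unfolding veech_group_def Y_def by blast
  have "invertible R" using f by (simp add: affine_diffeo_def)
  then obtain R' where RR: "R ** R' = mat 1" "R' ** R = mat 1" unfolding invertible_def by blast
  have R_inv: "R *v (R' *v v) = v" "R' *v (R *v v) = v" for v using RR by (simp_all add: matrix_vector_mul_assoc)
  have "homeomorphic_map Y Y f" using f by (simp add: affine_diffeo_def)
  then obtain g where g: "homeomorphic_maps Y Y f g" using homeomorphic_map_maps by blast
  have gf: "g (f y) = y" "f (g y) = y" if "y \<in> topspace Y" for y
    using g that by (simp_all add: homeomorphic_maps_def)
  have fa: "affine_along ((*v) R) f" using affine_diffeo_along[OF f] .
  have ga: "affine_along ((*v) R') g" using affine_diffeo_along[OF affine_diffeo_inverse[OF f g RR]] .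
  obtain x0 z0 b where x0: "x0 \<in> topspace Y" "\<kappa> x0 = coset n z0" "b \<in> lattice" "\<kappa> (f x0) = coset n (R *v z0 + b)"
    and Rl: "\<And>m. m \<in> lattice \<Longrightarrow> R *v m \<in> lattice"
    using affine_lattice[OF fa ga gf(1) linear_mult linear_mult R_inv(2)] by blast
  \<comment> \<open>The same argument for the inverse g makes R invertible over the
    integers.\<close>
  have R'l: "\<And>m. m \<in> lattice \<Longrightarrow> R' *v m \<in> lattice"
    using affine_lattice[OF ga fa gf(2) linear_mult linear_mult R_inv(1)] by blast
  obtain A where A: "R = real_matrix A" using integral_matrix Rl by blast
  obtain A' where A': "R' = real_matrix A'" using integral_matrix R'l by blast
  \<comment> \<open>Both determinants are integers with product 1, and positivity leaves 1.\<close>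
  have "det R * det R' = 1" using RR(1) by (metis det_I det_mul)
  then have "real_of_int (det A * det A') = real_of_int 1" by (simp add: A A' det_real_matrix)
  then have "det A * det A' = 1" by linarith
  moreover have "det A > 0" using det by (simp add: A det_real_matrix)
  ultimately have detA: "det A = 1" by (metis pos_zmult_eq_1_iff)
  then have SL: "A \<in> SL2Z" by (simp add: SL2Z_def)
  have f\<kappa>: "\<kappa> (f x) = coset n (R *v z + b)" if "x \<in> topspace Y" "\<kappa> x = coset n z" for x z
    by (rule affine_global[OF S_nonempty fa linear_mult Rl x0(1,2,4) that])
  have fY: "f x \<in> topspace Y" and gY: "g x \<in> topspace Y" if "x \<in> topspace Y" for x
    using affine_along_in[OF fa that] affine_along_in[OF ga that] by auto
  have g\<kappa>: "\<kappa> (g y) = coset n w" if y: "y \<in> topspace Y" "\<kappa> y = coset n (R *v w + b)" for y w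
  proof -
    obtain u where u: "\<kappa> (g y) = coset n u" using obtain_Y[OF gY[OF y(1)]] .
    have "coset n (R *v u + b) = coset n (R *v w + b)" using f\<kappa>[OF gY[OF y(1)] u] gf(2)[OF y(1)] y(2) by simp
    then have "coset n (R *v u) = coset n (R *v w)" using coset_add_cong by metis
    then have "coset n (R' *v (R *v u)) = coset n (R' *v (R *v w))" unfolding A' by (rule coset_mult)
    then show ?thesis using u R_inv(2) by simp
  qed
  have Rb: "m \<in> lattice \<longleftrightarrow> R *v m + b \<in> lattice" for m
  proof
    assume "R *v m + b \<in> lattice"
    then have "R' *v (R *v m + b - b) \<in> lattice" using R'l lattice_diff x0(3) by blast
    then show "m \<in> lattice" using R_inv(2) by simp
  qed (use Rl x0(3) lattice_add in blast)
  have RS: "R *v s + b \<in> S" if "s \<in> S" for s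
    by (rule branch_points_preserved[OF affine_along_cont[OF ga] g\<kappa> linear_mult Rb that])
  obtain u where u: "int n dvd (p\<^sup>2 + q\<^sup>2) * u - 1" using invertible_mod_norm[OF unit] .
  obtain t1 t2 where b: "b = rvec t1 t2" using lattice_rvec[OF x0(3)] .
  have pres: "residues (int n) p q (A$1$1 * s + A$1$2 * t + t1) (A$2$1 * s + A$2$2 * t + t2)"
    if "residues (int n) p q s t" for s t
    using RS[of "rvec s t"] that unfolding S_rvec A b real_matrix_rvec rvec_add by simp
  have "int n dvd t1 \<and> int n dvd t2 \<and> cong_quarter_turn (int n) A" unfolding cong_quarter_turn_iff
    by (rule affine_orbit[OF _ _ u _ pres]) (use n SL in \<open>auto simp: SL2Z_iff\<close>)
  then have t: "int n dvd t1" "int n dvd t2" and cong_n: "cong_quarter_turn (int n) A" by auto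
  \<comment> \<open>The translation part is zero modulo n and disappears on the torus.\<close>
  have f\<kappa>': "\<kappa> (f x) = coset n (R *v z)" if "x \<in> topspace Y" "\<kappa> x = coset n z" for x z
  proof -
    obtain k1 k2 where "t1 = int n * k1" "t2 = int n * k2" using t by (auto elim!: dvdE)
    then have "b = real n *\<^sub>R rvec k1 k2" by (simp add: b rvec_scale)
    then have "coset n (R *v z) = coset n (R *v z + b)" using coset_eq rvec_lattice by blast
    then show ?thesis using f\<kappa>[OF that] by simp
  qed
  obtain h where "involution_cover n X \<kappa> B h T" using involution .
  then interpret h: involution_cover n X \<kappa> B h T .
  have half_lat: "half n \<notin> lattice" using half_not_lattice n(2) by blast
  obtain e s where s: "chart (s (half n)) (half n) e s" using chart_pair[OF half_lat] by blast
  \<comment> \<open>A point over M is fixed by h, hence so is its image, which therefore lies over O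
    or M; O is excluded because R maps no noninteger point to an integer one.\<close>
  define x where "x = s (half n)"
  have x: "x \<in> topspace Y" "x \<in> topspace X" "\<kappa> x = coset n (half n)"
    using chart_in[OF s chart_centre(1)[OF s]] by (auto simp: x_def)
  have Rlat: "R *v z \<in> lattice \<longleftrightarrow> z \<in> lattice" for z unfolding A using adj_lattice[OF SL] .
  have "f (h x) = h (f x)"
    by (rule h.commutes_with_h[OF S_nonempty affine_along_cont[OF fa] fY f\<kappa>' linear_mult Rlat x(1)])
  moreover have "h x = x" using h.h_fix[OF x(2,3)] by (simp add: T_def)
  ultimately have "h (f x) = f x" by simp
  then have "T (R *v half n)" using h.h_fix[OF _ f\<kappa>'[OF x(1,3)]] fY[OF x(1)] topspace_Y_subset by blast
  moreover have "coset n (R *v half n) \<noteq> coset n 0"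
  proof
    assume "coset n (R *v half n) = coset n 0"
    then obtain v where "v \<in> lattice" "R *v half n = 0 + real n *\<^sub>R v" using coset_eq by metis
    then have "R *v half n \<in> lattice" using lattice_scale[of v n] by simp
    then show False using Rlat half_lat by blast
  qed
  ultimately have "coset n (R *v half n) = coset n (half n)" by (simp add: T_def)
  then have "cong_quarter_turn 2 A" using half_image[OF n_pos] cong_quarter_turn_2_rows[OF SL] A by blast
  then show ?thesis using that A SL cong_n by blast
qed

end

theorem theorem2:
  fixes n :: nat and p q :: int
    and X :: "'a topology" and \<kappa> :: "'a \<Rightarrow> (real^2) set"
  assumes "n \<ge> 3" and "odd n"
    and "invertible_mod (int n) (mat2 p (- q) q p)"
    and "origami_covering n p q X \<kappa>"
  shows "veech_group X (pr \<circ> \<kappa>) =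
           real_matrix ` ({A \<in> SL2Z. cong_quarter_turn (int n) A} \<inter>
                          {A \<in> SL2Z. cong_quarter_turn 2 A})
    \<and> {A \<in> SL2Z. cong_quarter_turn (int n) A} \<inter> {A \<in> SL2Z. cong_quarter_turn 2 A} =
         {mat2 a b c d | a b c d. mat2 a b c d \<in> SL2Z \<and> odd (a + c) \<and> odd (b + d) \<and>
                                  cong_quarter_turn (int n) (mat2 a b c d)}"
proof
  interpret origami n p q X \<kappa> using assms by (rule origami.intro)
  show "veech_group X (pr \<circ> \<kappa>) =
           real_matrix ` ({A \<in> SL2Z. cong_quarter_turn (int n) A} \<inter>
                          {A \<in> SL2Z. cong_quarter_turn 2 A})" using in_veech_group veech_group_sub by blast
  show "{A \<in> SL2Z. cong_quarter_turn (int n) A} \<inter> {A \<in> SL2Z. cong_quarter_turn 2 A} =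
         {mat2 a b c d | a b c d. mat2 a b c d \<in> SL2Z \<and> odd (a + c) \<and> odd (b + d) \<and>
                                  cong_quarter_turn (int n) (mat2 a b c d)}" (is "?L = ?R")
  proof (intro set_eqI iffI)
    fix A assume "A \<in> ?L"
    then have "A \<in> SL2Z" "cong_quarter_turn (int n) A" "odd (A$1$1 + A$2$1)" "odd (A$1$2 + A$2$2)"
      using cong_quarter_turn_2_columns by auto
    then show "A \<in> ?R" using mat2_eta[of A] by (intro CollectI exI[of _ "A$1$1"] exI[of _ "A$1$2"]
        exI[of _ "A$2$1"] exI[of _ "A$2$2"]) simp
  next
    fix A assume "A \<in> ?R"
    then show "A \<in> ?L" using cong_quarter_turn_2_columns by auto
  qed
qed

end
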